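(* There exists an $O(k^k m^2 n)$-time algorithm that, for any given integer $k \ge 1$ and any given directed graph $G$ with $n$ vertices and $m$ edges, together with a weight function $w:E(G) \to \mathbb{Z}$ and a source vertex $s$, constructs a $k$-WTSS of $G$ (with respect to $s$) having at most $O_k(n)$ edges, where $O_k(\cdot)$ hides a constant depending only on $k$. Moreover, the in-degree of every vertex in this $k$-WTSS is at most $e\cdot (k-1)!\, 2^k$.
   Context: $\mathbb{N}$ denotes the natural numbers including $0$. For a directed graph $G$ with edge weights $w$, $dist_{G,w}(x,y)$ is the minimum weight of an $x$–$y$ path in $G$. Given $G$, $w:E(G)\to\mathbb{Z}$, a source $s\in V(G)$ and an integer $k\ge 1$, a subgraph $H=(V(G),E')$ with $E'\subseteq E(G)$ is a $k$-Weight Tolerant Shortest-path Subgraph ($k$-WTSS) of $G$ if for every weight increment function $I:E(G)\to\mathbb{N}$ with $\sum_{e\in E(G)} I(e)\le k$, setting $w'(e)=w(e)+I(e)$ for all $e\in E(G)$, one has $dist_{G,w'}(s,t)=dist_{H,w'}(s,t)$ for every $t\in V(G)$. Here $e$ denotes Euler's number.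
   Formalization: It is assumed that minimum-weight walks from s exist, i.e. no negative-weight cycle is reachable from s (otherwise dist is undefined or, for simple paths, the in-degree bound fails); the time bound is O(k^k m^2 n + 1), which differs only when m = 0. *)

theory Defs
  imports "Graph_Theory.Graph_Theory" "HOL-Analysis.Analysis"
begin

section \<open>Weight tolerant shortest-path subgraphs\<close>

text \<open>
  In \<^const>\<open>wf_digraph.\<mu>\<close> the infimum ranges over all walks. It is \<open>\<infinity>\<close> iff \<open>y\<close> is not
  reachable from \<open>x\<close>. If \<open>y\<close> is reachable, it is a minimum, and then agrees with the minimum
  over simple paths, iff no walk from \<open>x\<close> to \<open>y\<close> meets a cycle of negative weight.
\<close>

definition sp_dist :: "('a, 'b) pre_digraph \<Rightarrow> ('b \<Rightarrow> int) \<Rightarrow> 'a \<Rightarrow> 'a \<Rightarrow> ereal" where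
  "sp_dist G w x y = wf_digraph.\<mu> G (\<lambda>a. real_of_int (w a)) x y"

text \<open>
  Distances from \<open>s\<close> are minima of walk weights, i.e. no cycle of negative weight is
  reachable from \<open>s\<close>.
\<close>

definition min_dists_exist :: "('a, 'b) pre_digraph \<Rightarrow> ('b \<Rightarrow> int) \<Rightarrow> 'a \<Rightarrow> bool" where
  "min_dists_exist G w s \<longleftrightarrow>
     (\<forall>t \<in> verts G. (\<exists>p. pre_digraph.awalk G s p t) \<longrightarrow>
        (\<exists>p. pre_digraph.awalk G s p t \<and>
             (\<forall>q. pre_digraph.awalk G s q t \<longrightarrow> (\<Sum>a\<leftarrow>p. w a) \<le> (\<Sum>a\<leftarrow>q. w a))))"

definition wtss ::
  "nat \<Rightarrow> ('a, 'b) pre_digraph \<Rightarrow> ('b \<Rightarrow> int) \<Rightarrow> 'a \<Rightarrow> ('a, 'b) pre_digraph \<Rightarrow> bool" where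
  "wtss k G w s H \<longleftrightarrow> spanning H G \<and>
     (\<forall>I :: 'b \<Rightarrow> nat. (\<Sum>a\<in>arcs G. I a) \<le> k \<longrightarrow>
        (\<forall>t \<in> verts G. sp_dist G (\<lambda>a. w a + int (I a)) s t = sp_dist H (\<lambda>a. w a + int (I a)) s t))"


section \<open>Machine model\<close>

text \<open>
  A structured form of the random access machine under the uniform cost measure, with
  addition and subtraction as the only arithmetic. A program refers to finitely many integer
  registers and finitely many integer arrays; the syntax of a program is fixed, so every
  construct corresponds to a bounded number of machine instructions. Multiplication is left out
  because at unit cost it is unreasonably powerful on unbounded integers.
\<close>

record store =
  reg :: "nat \<Rightarrow> int"
  arr :: "nat \<Rightarrow> int \<Rightarrow> int"

datatype aexp = Const int | Reg nat | Get nat aexp | Plus aexp aexp | Minus aexp aexp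

datatype bexp = Less aexp aexp | Neg bexp | Conj bexp bexp

datatype com =
    Skip
  | Assign nat aexp
  | Put nat aexp aexp
  | Seq com com
  | Cond bexp com com
  | While bexp com

fun aval :: "aexp \<Rightarrow> store \<Rightarrow> int" where
  "aval (Const c) \<sigma> = c"
| "aval (Reg x) \<sigma> = reg \<sigma> x"
| "aval (Get x e) \<sigma> = arr \<sigma> x (aval e \<sigma>)"
| "aval (Plus e1 e2) \<sigma> = aval e1 \<sigma> + aval e2 \<sigma>"
| "aval (Minus e1 e2) \<sigma> = aval e1 \<sigma> - aval e2 \<sigma>"

fun acost :: "aexp \<Rightarrow> nat" where
  "acost (Const c) = 1"
| "acost (Reg x) = 1"
| "acost (Get x e) = acost e + 1"
| "acost (Plus e1 e2) = acost e1 + acost e2 + 1"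
| "acost (Minus e1 e2) = acost e1 + acost e2 + 1"

fun bval :: "bexp \<Rightarrow> store \<Rightarrow> bool" where
  "bval (Less e1 e2) \<sigma> \<longleftrightarrow> aval e1 \<sigma> < aval e2 \<sigma>"
| "bval (Neg b) \<sigma> \<longleftrightarrow> \<not> bval b \<sigma>"
| "bval (Conj b1 b2) \<sigma> \<longleftrightarrow> bval b1 \<sigma> \<and> bval b2 \<sigma>"

fun bcost :: "bexp \<Rightarrow> nat" where
  "bcost (Less e1 e2) = acost e1 + acost e2 + 1"
| "bcost (Neg b) = bcost b + 1"
| "bcost (Conj b1 b2) = bcost b1 + bcost b2 + 1"

text \<open>
  \<open>exec c \<sigma> T \<sigma>'\<close>: started in \<open>\<sigma>\<close>, the program \<open>c\<close> halts in \<open>\<sigma>'\<close> after exactly \<open>T\<close> steps.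
\<close>

inductive exec :: "com \<Rightarrow> store \<Rightarrow> nat \<Rightarrow> store \<Rightarrow> bool" where
  Skip: "exec Skip \<sigma> 1 \<sigma>"
| Assign: "exec (Assign x e) \<sigma> (acost e + 1) (\<sigma>\<lparr>reg := (reg \<sigma>)(x := aval e \<sigma>)\<rparr>)"
| Put: "exec (Put x i e) \<sigma> (acost i + acost e + 1)
          (\<sigma>\<lparr>arr := (arr \<sigma>)(x := (arr \<sigma> x)(aval i \<sigma> := aval e \<sigma>))\<rparr>)"
| Seq: "\<lbrakk>exec c1 \<sigma> T1 \<sigma>'; exec c2 \<sigma>' T2 \<sigma>''\<rbrakk> \<Longrightarrow> exec (Seq c1 c2) \<sigma> (T1 + T2) \<sigma>''"
| CondTrue: "\<lbrakk>bval b \<sigma>; exec c1 \<sigma> T \<sigma>'\<rbrakk> \<Longrightarrow> exec (Cond b c1 c2) \<sigma> (bcost b + T) \<sigma>'"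
| CondFalse: "\<lbrakk>\<not> bval b \<sigma>; exec c2 \<sigma> T \<sigma>'\<rbrakk> \<Longrightarrow> exec (Cond b c1 c2) \<sigma> (bcost b + T) \<sigma>'"
| WhileFalse: "\<not> bval b \<sigma> \<Longrightarrow> exec (While b c) \<sigma> (bcost b) \<sigma>"
| WhileTrue: "\<lbrakk>bval b \<sigma>; exec c \<sigma> T1 \<sigma>'; exec (While b c) \<sigma>' T2 \<sigma>''\<rbrakk>
    \<Longrightarrow> exec (While b c) \<sigma> (bcost b + T1 + T2) \<sigma>''"

inductive_cases exec_SkipE: "exec Skip \<sigma> T \<sigma>'"
inductive_cases exec_AssignE: "exec (Assign x e) \<sigma> T \<sigma>'"
inductive_cases exec_PutE: "exec (Put x i e) \<sigma> T \<sigma>'"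
inductive_cases exec_SeqE: "exec (Seq c1 c2) \<sigma> T \<sigma>'"
inductive_cases exec_CondE: "exec (Cond b c1 c2) \<sigma> T \<sigma>'"
inductive_cases exec_WhileE: "exec (While b c) \<sigma> T \<sigma>'"

lemma exec_deterministic:
  assumes "exec c \<sigma> T1 \<sigma>1" and "exec c \<sigma> T2 \<sigma>2"
  shows "T1 = T2 \<and> \<sigma>1 = \<sigma>2"
  using assms
proof (induction arbitrary: T2 \<sigma>2 rule: exec.induct)
  case (Seq c1 \<sigma> T1 \<sigma>' c2 T2' \<sigma>'')
  show ?case by (rule exec_SeqE[OF Seq.prems]) (use Seq.IH in blast)
next
  case (CondTrue b \<sigma> c1 T \<sigma>' c2)
  show ?case by (rule exec_CondE[OF CondTrue.prems]) (use CondTrue in blast)+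
next
  case (CondFalse b \<sigma> c2 T \<sigma>' c1)
  show ?case by (rule exec_CondE[OF CondFalse.prems]) (use CondFalse in blast)+
next
  case (WhileFalse b \<sigma> c)
  show ?case by (rule exec_WhileE[OF WhileFalse.prems]) (use WhileFalse in blast)+
next
  case (WhileTrue b \<sigma> c T1 \<sigma>' T2' \<sigma>'')
  show ?case by (rule exec_WhileE[OF WhileTrue.prems]) (use WhileTrue in blast)+
qed (auto elim: exec_SkipE exec_AssignE exec_PutE)


section \<open>Input and output\<close>

text \<open>
  An input graph has the vertices \<open>0, ..., n - 1\<close> and the arcs \<open>0, ..., m - 1\<close>; loops and
  parallel arcs may occur. It is presented in no particular order, by the arrays of the tails,
  heads and weights of its arcs. All other memory cells are 0 initially.
\<close>

definition input_digraph :: "nat \<Rightarrow> nat \<Rightarrow> (nat, nat) pre_digraph \<Rightarrow> bool" where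
  "input_digraph n m G \<longleftrightarrow> fin_digraph G \<and> verts G = {..<n} \<and> arcs G = {..<m}"

definition array_of :: "nat \<Rightarrow> (nat \<Rightarrow> int) \<Rightarrow> int \<Rightarrow> int" where
  "array_of m f i = (if 0 \<le> i \<and> i < int m then f (nat i) else 0)"

definition input_store ::
  "nat \<Rightarrow> nat \<Rightarrow> nat \<Rightarrow> (nat, nat) pre_digraph \<Rightarrow> (nat \<Rightarrow> int) \<Rightarrow> nat \<Rightarrow> store" where
  "input_store k n m G w s =
     \<lparr>reg = (\<lambda>_. 0)(0 := int k, 1 := int n, 2 := int m, 3 := int s),
      arr = (\<lambda>_ _. 0)(0 := array_of m (\<lambda>a. int (tail G a)),
                      1 := array_of m (\<lambda>a. int (head G a)),
                      2 := array_of m w)\<rparr>"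

text \<open>Array 3 of the final store holds the characteristic vector of the selected arcs.\<close>

definition output_digraph :: "(nat, nat) pre_digraph \<Rightarrow> store \<Rightarrow> (nat, nat) pre_digraph" where
  "output_digraph G \<sigma> = G\<lparr>arcs := {a \<in> arcs G. arr \<sigma> 3 (int a) \<noteq> 0}\<rparr>"

end

theory Submission
  imports Defs
begin

text \<open>
  Subtracting the potential given by the distances from \<open>s\<close> makes all weights nonnegative, with
  distance \<open>0\<close> to every reachable vertex. Fix a target \<open>t\<close> and a cost \<open>D < k\<close>, and let node \<open>(x, j)\<close>
  of a layered network stand for \<open>reaching x with cost at most j \<le> D\<close>. If an increment \<open>I\<close> of total
  at most \<open>k\<close> makes the distance to \<open>t\<close> exceed \<open>D\<close>, then at most \<open>k\<close> arcs of the layered network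
  leave the set of the nodes \<open>(x, j)\<close> such that \<open>x\<close> has distance at most \<open>j\<close> under \<open>I\<close>: an arc \<open>e\<close> has
  copies on all levels, but at most \<open>I e\<close> of them leave the set. So it suffices to keep arcs into
  \<open>t\<close> that preserve reachability in the layered network under \<open>k\<close> faults. As in the work of Baswana,
  Choudhary and Roditty, these are the last arcs of a maximum flow, after the set of sources
  has been advanced \<open>k\<close> times to the heads of its farthest minimum cut. The out-degrees are at
  most two, so that each round at most doubles the cut and \<open>2 ^ k\<close> arcs are kept for each \<open>D\<close>.
  A cost \<open>D \<ge> k\<close> needs no arcs of its own, because a walk of reduced cost \<open>0\<close> remains and its cost
  rises to at most \<open>k\<close>. This gives in-degree \<open>k * 2 ^ k \<le> e * (k - 1)! * 2 ^ k\<close>. The time bound leaves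
  room for finding augmenting paths by naive repeated sweeps over all arcs.
\<close>

section \<open>Cuts and flows\<close>

text \<open>Two choices of form carry the argument. A maximum flow is certified by a set
  \<open>B\<close> that is closed under residual predecessors and ranked towards the sink, so the
  farthest minimum cut can be read off from the labels that a search leaves in memory. And a set of
  faults is not a set of deleted arcs, but the arcs leaving a set \<open>X\<close> inside which the
  tail of a discarded arc can still be reached. Such a condition only compares cut sizes, so it
  passes through a round by submodularity.

  Targets are treated in turn, each in the graph that the earlier ones left over. This is sound
  because each step preserves all distances under all admissible increments, and an arc is only ever
  discarded on behalf of its head.

  The factors of the running time: \<open>n\<close> targets, \<open>k\<close> values of
  \<open>D\<close>, \<open>k + 1\<close> flows per network, \<open>2 ^ k + 1\<close> searches per
  flow, and a search is quadratic in the about \<open>m * k\<close> nodes. So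
  \<open>n * m ^ 2\<close> is multiplied by roughly \<open>k ^ 4 * 2 ^ k\<close>, which is within a
  constant of \<open>k ^ k\<close>.\<close>

locale network =
  fixes Es :: "'e set" and tl hd :: "'e \<Rightarrow> 'v" and z :: 'v
  assumes finite_edges: "finite Es" and tl_ne_sink: "\<And>q. q \<in> Es \<Longrightarrow> tl q \<noteq> z"
begin

definition cut :: "'v set \<Rightarrow> 'e set" where
  "cut X = {q \<in> Es. tl q \<in> X \<and> hd q \<notin> X}"

definition net_out :: "('e \<Rightarrow> int) \<Rightarrow> 'v \<Rightarrow> int" where
  "net_out f x = (\<Sum>q\<in>Es. f q * (of_bool (tl q = x) - of_bool (hd q = x)))"

definition flow :: "('e \<Rightarrow> int) \<Rightarrow> 'v set \<Rightarrow> bool" where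
  "flow f S \<longleftrightarrow> (\<forall>q\<in>Es. f q = 0 \<or> f q = 1) \<and> (\<forall>x. x \<notin> S \<longrightarrow> x \<noteq> z \<longrightarrow> net_out f x = 0)"

definition flow_value :: "('e \<Rightarrow> int) \<Rightarrow> int" where
  "flow_value f = - net_out f z"

text \<open>That \<open>B\<close> is the set of the nodes from which the residual network has a walk to the sink:
  the first property is one inclusion, and decreasing ranks witness the other.\<close>

definition residual_closed :: "('e \<Rightarrow> int) \<Rightarrow> 'v set \<Rightarrow> bool" where
  "residual_closed f B \<longleftrightarrow>
     (\<forall>q\<in>Es. (f q = 0 \<and> hd q \<in> B \<longrightarrow> tl q \<in> B) \<and> (f q \<noteq> 0 \<and> tl q \<in> B \<longrightarrow> hd q \<in> B))"

definition residual_ranked :: "('e \<Rightarrow> int) \<Rightarrow> 'v set \<Rightarrow> ('v \<Rightarrow> nat) \<Rightarrow> bool" where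
  "residual_ranked f B rk \<longleftrightarrow> (\<forall>b\<in>B. b \<noteq> z \<longrightarrow> (\<exists>q\<in>Es.
     f q = 0 \<and> tl q = b \<and> hd q \<in> B \<and> rk (hd q) < rk b \<or>
     f q \<noteq> 0 \<and> hd q = b \<and> tl q \<in> B \<and> rk (tl q) < rk b))"

lemma finite_cut [simp]: "finite (cut X)"
  using finite_edges by (simp add: cut_def)

text \<open>An arc counted on the left is counted on the right, and one counted twice on the left is
  counted twice on the right. The filter \<open>E\<close> is there for
  \<open>fault_tolerant\<close>, where discarded arcs into the sink must not count.\<close>

lemma cut_submodular:
  "card (cut (X \<inter> Y) \<inter> E) + card (cut (X \<union> Y) \<inter> E) \<le> card (cut X \<inter> E) + card (cut Y \<inter> E)"
proof -
  let ?a = "cut (X \<inter> Y) \<inter> E" and ?b = "cut (X \<union> Y) \<inter> E"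
  let ?c = "cut X \<inter> E" and ?d = "cut Y \<inter> E"
  have f: "finite ?a" "finite ?b" "finite ?c" "finite ?d" by simp_all
  have "?a \<union> ?b \<subseteq> ?c \<union> ?d" "?a \<inter> ?b \<subseteq> ?c \<inter> ?d"
    by (auto simp: cut_def)
  then have "card (?a \<union> ?b) \<le> card (?c \<union> ?d)" "card (?a \<inter> ?b) \<le> card (?c \<inter> ?d)"
    using f by (auto intro!: card_mono)
  then show ?thesis
    using card_Un_Int[OF f(1,2)] card_Un_Int[OF f(3,4)] by linarith
qed

text \<open>Sum the net outflow over all nodes outside \<open>X\<close>: only the sink contributes,
  because the sources are inside \<open>X\<close> and the other nodes are balanced. The sum ranges
  over the endpoints of arcs, since the type of nodes may be infinite.\<close>

lemma flow_value_across:
  assumes fl: "flow f S" and S: "S \<subseteq> X" and z: "z \<notin> X"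
  shows "flow_value f = (\<Sum>q\<in>Es. f q * (of_bool (tl q \<in> X) - of_bool (hd q \<in> X)))"
proof -
  define N where "N = (insert z (tl ` Es \<union> hd ` Es)) - X"
  have fin: "finite N" using finite_edges by (simp add: N_def)
  have zN: "z \<in> N" using z by (simp add: N_def)
  have "(\<Sum>x\<in>N. net_out f x) = net_out f z + (\<Sum>x\<in>N - {z}. net_out f x)"
    using fin zN by (rule sum.remove)
  also have "(\<Sum>x\<in>N - {z}. net_out f x) = 0"
    using fl S by (intro sum.neutral) (auto simp: flow_def N_def)
  finally have 1: "(\<Sum>x\<in>N. net_out f x) = net_out f z" by simp
  have "(\<Sum>x\<in>N. net_out f x)
      = (\<Sum>q\<in>Es. \<Sum>x\<in>N. f q * (of_bool (tl q = x) - of_bool (hd q = x)))"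
    unfolding net_out_def by (rule sum.swap)
  also have "\<dots> = (\<Sum>q\<in>Es. f q * (of_bool (hd q \<in> X) - of_bool (tl q \<in> X)))"
  proof (rule sum.cong[OF refl])
    fix q assume q: "q \<in> Es"
    have *: "(\<Sum>x\<in>N. of_bool (y = x) :: int) = of_bool (y \<notin> X)" if "y \<in> tl ` Es \<union> hd ` Es" for y
      using fin that by (simp add: of_bool_def N_def sum.delta' sum.delta)
    have "(\<Sum>x\<in>N. f q * (of_bool (tl q = x) - of_bool (hd q = x)))
        = f q * ((\<Sum>x\<in>N. of_bool (tl q = x)) - (\<Sum>x\<in>N. of_bool (hd q = x)))"
      by (simp add: sum_distrib_left[symmetric] sum_subtractf)
    also have "\<dots> = f q * (of_bool (hd q \<in> X) - of_bool (tl q \<in> X))"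
      using *[of "tl q"] *[of "hd q"] q by auto
    finally show "(\<Sum>x\<in>N. f q * (of_bool (tl q = x) - of_bool (hd q = x)))
        = f q * (of_bool (hd q \<in> X) - of_bool (tl q \<in> X))" .
  qed
  finally have "net_out f z = (\<Sum>q\<in>Es. f q * (of_bool (hd q \<in> X) - of_bool (tl q \<in> X)))"
    using 1 by simp
  then show ?thesis
    by (simp add: flow_value_def sum_negf[symmetric] algebra_simps)
qed

lemma flow_value_eq:
  assumes fl: "flow f S" and S: "S \<subseteq> X" and z: "z \<notin> X"
  shows "flow_value f = int (card {q \<in> cut X. f q = 1})
    - int (card {q \<in> Es. f q = 1 \<and> tl q \<notin> X \<and> hd q \<in> X})"
proof -
  let ?C = "{q \<in> cut X. f q = 1}" and ?D = "{q \<in> Es. f q = 1 \<and> tl q \<notin> X \<and> hd q \<in> X}"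
  have "flow_value f = (\<Sum>q\<in>Es. of_bool (q \<in> ?C) - of_bool (q \<in> ?D))"
    unfolding flow_value_across[OF assms]
    using fl by (intro sum.cong) (auto simp: flow_def cut_def)
  also have "\<dots> = int (card ?C) - int (card ?D)"
    using finite_edges
    by (simp add: sum_subtractf of_bool_def sum.If_cases cut_def Int_def conj_ac)
  finally show ?thesis .
qed

lemma flow_value_le_cut:
  assumes "flow f S" "S \<subseteq> X" "z \<notin> X"
  shows "flow_value f \<le> int (card {q \<in> cut X. f q = 1})"
  using flow_value_eq[OF assms] by simp

lemma flow_value_sink:
  assumes "flow f S" "z \<notin> S"
  shows "flow_value f = int (card {q \<in> Es. hd q = z \<and> f q = 1})"
proof -
  have "{q \<in> cut (- {z}). f q = 1} = {q \<in> Es. hd q = z \<and> f q = 1}"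
    "{q \<in> Es. f q = 1 \<and> tl q \<notin> - {z} \<and> hd q \<in> - {z}} = {}"
    using tl_ne_sink by (auto simp: cut_def)
  moreover have "S \<subseteq> - {z}" "z \<notin> - {z}" using assms(2) by auto
  ultimately show ?thesis using flow_value_eq[OF assms(1), of "- {z}"] by (simp only: card.empty) simp
qed

text \<open>Induction on the rank follows a residual path to the sink. Consequently, if a ranked set
  meets the sources, no closed set with the sink is disjoint from them, so the flow has no
  certificate of maximality.\<close>

lemma residual_ranked_subset:
  assumes ranked: "residual_ranked f B rk" and closed: "residual_closed f B'" and z: "z \<in> B'"
  shows "B \<subseteq> B'"
proof -
  have "b \<in> B \<Longrightarrow> b \<in> B'" for b
  proof (induction "rk b" arbitrary: b rule: less_induct)
    case less
    show ?case
    proof (cases "b = z")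
      case False
      then obtain q where "q \<in> Es" and
        "f q = 0 \<and> tl q = b \<and> hd q \<in> B \<and> rk (hd q) < rk b \<or>
         f q \<noteq> 0 \<and> hd q = b \<and> tl q \<in> B \<and> rk (tl q) < rk b"
        using ranked less.prems unfolding residual_ranked_def by blast
      then show ?thesis using less.hyps closed unfolding residual_closed_def by blast
    qed (use z in simp)
  qed
  then show ?thesis by blast
qed

lemma flow_mono: "flow f S \<Longrightarrow> S \<subseteq> S' \<Longrightarrow> flow f S'"
  by (auto simp: flow_def)

lemma net_out_update:
  assumes "q \<in> Es"
  shows "net_out (f(q := c)) x = net_out f x + (c - f q) * (of_bool (tl q = x) - of_bool (hd q = x))"
proof -
  have "net_out (f(q := c)) x = c * (of_bool (tl q = x) - of_bool (hd q = x))
      + (\<Sum>p\<in>Es - {q}. f p * (of_bool (tl p = x) - of_bool (hd p = x)))"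
    unfolding net_out_def sum.remove[OF finite_edges assms]
    by (intro arg_cong2[where f="(+)"] sum.cong) auto
  then show ?thesis
    unfolding net_out_def sum.remove[OF finite_edges assms] by (simp add: algebra_simps)
qed

end

section \<open>Certified maximum flows and their farthest minimum cuts\<close>

text \<open>Since \<open>S\<close> and \<open>B\<close> are disjoint, the flow is maximum, and \<open>- B\<close> is the minimum cut
  that is farthest from \<open>S\<close>.\<close>

locale max_flow = network Es tl hd z
  for Es :: "'e set" and tl hd :: "'e \<Rightarrow> 'v" and z :: 'v +
  fixes f :: "'e \<Rightarrow> int" and S B :: "'v set" and rk :: "'v \<Rightarrow> nat"
  assumes flow: "flow f S" and sink: "z \<in> B" and disjoint: "S \<inter> B = {}"
    and closed: "residual_closed f B" and ranked: "residual_ranked f B rk"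
begin

lemma saturated: "q \<in> cut (- B) \<Longrightarrow> f q = 1"
  using closed flow unfolding residual_closed_def flow_def cut_def by fastforce

lemma value_eq_cut: "flow_value f = int (card (cut (- B)))"
proof -
  have "{q \<in> Es. f q = 1 \<and> tl q \<notin> - B \<and> hd q \<in> - B} = {}"
    using closed unfolding residual_closed_def by fastforce
  moreover have "{q \<in> cut (- B). f q = 1} = cut (- B)" using saturated by blast
  moreover have "S \<subseteq> - B" "z \<notin> - B" using disjoint sink by auto
  ultimately show ?thesis using flow_value_eq[OF flow, of "- B"] by (simp only: card.empty) simp
qed

text \<open>If the cut of \<open>X\<close> is no larger than the flow value, then all arcs leaving
  \<open>X\<close> are saturated and no flow enters \<open>X\<close>. Hence no residual arc leaves
  \<open>X\<close>, and a residual path to the sink cannot start there.\<close>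

lemma farthest:
  assumes X: "S \<subseteq> X" "z \<notin> X" and le: "int (card (cut X)) \<le> flow_value f"
  shows "X \<subseteq> - B"
proof -
  let ?C = "{q \<in> cut X. f q = 1}" and ?D = "{q \<in> Es. f q = 1 \<and> tl q \<notin> X \<and> hd q \<in> X}"
  have sub: "?C \<subseteq> cut X" by auto
  then have "card ?C \<le> card (cut X)" by (intro card_mono) auto
  then have "card ?C = card (cut X)" "card ?D = 0"
    using flow_value_eq[OF flow X] le by auto
  then have "?C = cut X" and D: "?D = {}"
    using card_subset_eq[OF finite_cut sub] finite_edges by simp_all
  then have C: "q \<in> cut X \<Longrightarrow> f q = 1" for q by blast
  have "b \<in> B \<Longrightarrow> b \<notin> X" for b
  proof (induction "rk b" arbitrary: b rule: less_induct)
    case less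
    show ?case
    proof (cases "b = z")
      case False
      then obtain q where q: "q \<in> Es" and
        "f q = 0 \<and> tl q = b \<and> hd q \<in> B \<and> rk (hd q) < rk b \<or>
         f q \<noteq> 0 \<and> hd q = b \<and> tl q \<in> B \<and> rk (tl q) < rk b"
        using ranked less.prems unfolding residual_ranked_def by blast
      then show ?thesis
      proof (elim disjE conjE)
        assume "f q = 0" "tl q = b" "hd q \<in> B" "rk (hd q) < rk b"
        then show ?thesis using less.hyps[of "hd q"] C[of q] q by (auto simp: cut_def)
      next
        assume "f q \<noteq> 0" "hd q = b" "tl q \<in> B" "rk (tl q) < rk b"
        moreover from this have "f q = 1" using flow q by (auto simp: flow_def)
        ultimately show ?thesis using less.hyps[of "tl q"] D q by auto
      qed
    qed (use X in simp)
  qed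
  then show ?thesis by blast
qed

end

section \<open>Fault tolerance by iterated farthest minimum cuts\<close>

context network
begin

definition linked :: "'v \<Rightarrow> 'v set \<Rightarrow> 'v \<Rightarrow> bool" where
  "linked a X b \<longleftrightarrow> (a, b) \<in> {(tl q, hd q) | q. q \<in> Es \<and> tl q \<in> X \<and> hd q \<in> X}\<^sup>*"

lemma linked_leaves:
  assumes "linked a X b" "a \<in> A" "b \<notin> A"
  obtains q where "q \<in> Es" "tl q \<in> X \<inter> A" "hd q \<in> X - A"
proof -
  have "b \<notin> A \<longrightarrow> (\<exists>q\<in>Es. tl q \<in> X \<inter> A \<and> hd q \<in> X - A)"
    using assms(1) unfolding linked_def
    by (induction rule: rtrancl_induct) (use assms(2) in auto)
  then show ?thesis using that assms(3) by blast
qed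

text \<open>Think of the arcs leaving \<open>X\<close> as faults that leave \<open>b\<close> reachable from \<open>a\<close>. If \<open>b\<close> is
  outside \<open>S\<close>, they cannot have been few. Every round of the algorithm raises \<open>r\<close> by one.\<close>

definition expanding :: "'v \<Rightarrow> nat \<Rightarrow> 'v set \<Rightarrow> bool" where
  "expanding a r S \<longleftrightarrow> a \<in> S \<and> z \<notin> S \<and>
     (\<forall>X Y b. a \<in> X \<longrightarrow> z \<notin> X \<longrightarrow> linked a X b \<longrightarrow> b \<notin> S \<longrightarrow> X \<inter> S \<subseteq> Y \<longrightarrow> z \<notin> Y \<longrightarrow>
        r < card (cut Y))"

text \<open>The sink is never made a source: arcs from \<open>A\<close> straight into it stay in the
  cut and survive all later rounds.\<close>

definition advance :: "'v set \<Rightarrow> 'v set" where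
  "advance A = A \<union> {hd q | q. q \<in> Es \<and> tl q \<in> A \<and> hd q \<noteq> z}"

text \<open>Compare \<open>Y\<close> with the minimum cut \<open>- B\<close>. The intersection still
  contains \<open>X \<inter> S\<close>, so its cut exceeds \<open>r\<close> by assumption. The walk
  inside \<open>X\<close> has to leave \<open>- B\<close>, and the node where it arrives is a new
  source in \<open>X\<close>, hence in \<open>Y\<close>; so the union properly extends the farthest
  minimum cut and has a strictly larger cut. Submodularity adds the two gains.\<close>

lemma expanding_advance:
  assumes ex: "expanding a r S" and mf: "max_flow Es tl hd z f S B rk"
  shows "expanding a (Suc r) (advance (- B))"
proof -
  interpret max_flow Es tl hd z f S B rk by fact
  have SB: "S \<subseteq> - B" using disjoint by blast
  have "Suc r < card (cut Y)"
    if X: "a \<in> X" "z \<notin> X" and li: "linked a X b" and b: "b \<notin> advance (- B)"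
      and Y: "X \<inter> advance (- B) \<subseteq> Y" "z \<notin> Y" for X Y b
  proof -
    have bB: "b \<in> B" using b by (auto simp: advance_def)
    have 1: "r < card (cut (Y \<inter> - B))"
    proof -
      have "X \<inter> S \<subseteq> Y \<inter> - B" "b \<notin> S" "z \<notin> Y \<inter> - B"
        using SB Y b sink by (auto simp: advance_def)
      then show ?thesis using ex X li unfolding expanding_def by blast
    qed
    have "a \<in> - B" using ex SB by (auto simp: expanding_def)
    then obtain q where q: "q \<in> Es" "tl q \<in> X \<inter> - B" "hd q \<in> X - - B"
      using linked_leaves[OF li, of "- B"] bB by blast
    then have "hd q \<in> Y \<union> - B" "hd q \<notin> - B" using X Y by (auto simp: advance_def)
    then have "\<not> Y \<union> - B \<subseteq> - B" by blast
    moreover have "S \<subseteq> Y \<union> - B" "z \<notin> Y \<union> - B" using SB Y sink by auto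
    ultimately have "card (cut (- B)) < card (cut (Y \<union> - B))"
      using farthest[of "Y \<union> - B"] value_eq_cut by linarith
    moreover have "card (cut (Y \<inter> - B)) + card (cut (Y \<union> - B)) \<le> card (cut Y) + card (cut (- B))"
      using cut_submodular[of Y "- B" UNIV] by simp
    ultimately show ?thesis using 1 by linarith
  qed
  moreover have "a \<in> advance (- B)" "z \<notin> advance (- B)"
    using ex SB sink by (auto simp: expanding_def advance_def)
  ultimately show ?thesis unfolding expanding_def by blast
qed

text \<open>The start of the iteration: if the sink is reachable at all, every set that separates it
  from \<open>a\<close> has an outgoing arc.\<close>

lemma expanding_source:
  assumes "linked a UNIV z" "a \<in> S" "z \<notin> S"
  shows "expanding a 0 S"
proof -
  have "0 < card (cut Y)" if "a \<in> Y" "z \<notin> Y" for Y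
  proof -
    obtain q where "q \<in> Es" "tl q \<in> UNIV \<inter> Y" "hd q \<in> UNIV - Y"
      by (rule linked_leaves[OF assms(1) \<open>a \<in> Y\<close> \<open>z \<notin> Y\<close>])
    then have "q \<in> cut Y" by (auto simp: cut_def)
    then show ?thesis by (auto simp: card_gt_0_iff)
  qed
  then show ?thesis using assms(2,3) by (auto simp: expanding_def)
qed

text \<open>An arc leaving the advanced set is either an old cut arc into the sink or starts at the
  head of another old cut arc, and each such head has at most two outgoing arcs.\<close>

lemma card_cut_advance:
  assumes deg: "\<And>x. card {q \<in> Es. tl q = x} \<le> 2" and z: "z \<notin> A"
  shows "card (cut (advance A)) \<le> 2 * card (cut A)"
proof -
  let ?C = "{q \<in> cut A. hd q = z}" and ?D = "{q \<in> cut A. hd q \<noteq> z}"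
  have "cut (advance A) \<subseteq> ?C \<union> (\<Union>x\<in>hd ` ?D. {q \<in> Es. tl q = x})"
    by (force simp: cut_def advance_def)
  then have "card (cut (advance A)) \<le> card (?C \<union> (\<Union>x\<in>hd ` ?D. {q \<in> Es. tl q = x}))"
    using finite_edges by (intro card_mono) auto
  also have "\<dots> \<le> card ?C + card (\<Union>x\<in>hd ` ?D. {q \<in> Es. tl q = x})" by (rule card_Un_le)
  also have "card (\<Union>x\<in>hd ` ?D. {q \<in> Es. tl q = x}) \<le> (\<Sum>x\<in>hd ` ?D. card {q \<in> Es. tl q = x})"
    by (intro card_UN_le) simp
  also have "\<dots> \<le> card (hd ` ?D) * 2" using sum_bounded_above[of "hd ` ?D", OF deg] by simp
  also have "card (hd ` ?D) \<le> card ?D" by (intro card_image_le) simp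
  also have "card ?C + card ?D * 2 \<le> 2 * (card ?C + card ?D)" by simp
  also have "card ?C + card ?D = card (?C \<union> ?D)" by (subst card_Un_disjoint) auto
  also have "?C \<union> ?D = cut A" by auto
  finally show ?thesis by simp
qed

text \<open>The arcs that are kept are those into the sink that carry flow.\<close>

theorem fault_tolerant:
  assumes ex: "expanding a r S" and mf: "max_flow Es tl hd z f S B rk"
    and X: "a \<in> X" "z \<notin> X" and li: "linked a X (tl p)"
    and p: "p \<in> Es" "hd p = z" "f p = 0"
  shows "r < card {q \<in> cut X. hd q = z \<longrightarrow> f q = 1}"
proof -
  interpret max_flow Es tl hd z f S B rk by fact
  define E where "E = {q. hd q = z \<longrightarrow> f q = 1}"
  have SB: "S \<subseteq> - B" using disjoint by blast
  \<comment> \<open>The arc \<open>p\<close> enters the sink without flow, so it is not in the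
    saturated cut of \<open>- B\<close>, and its tail must already be beyond that cut.\<close>
  have "tl p \<in> B" using saturated[of p] p sink by (auto simp: cut_def)
  then have "tl p \<notin> S" using SB by blast
  moreover have "X \<inter> S \<subseteq> X \<inter> - B" "z \<notin> X \<inter> - B" using SB sink by auto
  ultimately have 1: "r < card (cut (X \<inter> - B))" using ex X li unfolding expanding_def by blast
  \<comment> \<open>An arc from \<open>- B\<close> into the sink crosses the minimum cut and is
    therefore saturated.\<close>
  have "cut (X \<inter> - B) \<subseteq> E" using saturated sink by (auto simp: cut_def E_def)
  then have 2: "cut (X \<inter> - B) \<inter> E = cut (X \<inter> - B)" by blast
  have 3: "cut (- B) \<inter> E = cut (- B)" using saturated by (auto simp: E_def)
  have "S \<subseteq> X \<union> - B" "z \<notin> X \<union> - B" using SB sink X by auto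
  \<comment> \<open>The flow enters the sink only through kept arcs, so it still certifies a lower
    bound for the cut when the discarded arcs are not counted.\<close>
  then have "flow_value f \<le> int (card {q \<in> cut (X \<union> - B). f q = 1})"
    by (intro flow_value_le_cut[OF flow])
  also have "card {q \<in> cut (X \<union> - B). f q = 1} \<le> card (cut (X \<union> - B) \<inter> E)"
    by (intro card_mono) (auto simp: E_def)
  finally have "card (cut (- B)) \<le> card (cut (X \<union> - B) \<inter> E)" using value_eq_cut by simp
  moreover have "cut X \<inter> E = {q \<in> cut X. hd q = z \<longrightarrow> f q = 1}" by (auto simp: E_def)
  ultimately show ?thesis using cut_submodular[of X "- B" E] 1 2 3 by simp
qed

end

section \<open>Costs of walks\<close>

locale arc_structure =
  fixes ta he :: "nat \<Rightarrow> nat" and s :: nat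
begin

text \<open>A walk is represented only by its end and its cost, and grows at the end. Lists of arcs
  appear only where distances are interpreted, in \<open>awalk_walk_cost\<close>.\<close>

inductive walk_cost :: "nat set \<Rightarrow> (nat \<Rightarrow> int) \<Rightarrow> nat \<Rightarrow> int \<Rightarrow> bool" for A \<omega> where
  start: "walk_cost A \<omega> s 0"
| step: "walk_cost A \<omega> (ta e) d \<Longrightarrow> e \<in> A \<Longrightarrow> walk_cost A \<omega> (he e) (d + \<omega> e)"

lemma walk_cost_mono: "walk_cost A \<omega> x d \<Longrightarrow> A \<subseteq> A' \<Longrightarrow> walk_cost A' \<omega> x d"
  by (induction rule: walk_cost.induct) (auto intro: walk_cost.intros)

lemma walk_cost_cong:
  "walk_cost A \<omega> x d \<Longrightarrow> (\<And>e. e \<in> A \<Longrightarrow> \<omega> e = \<omega>' e) \<Longrightarrow> walk_cost A \<omega>' x d"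
  by (induction rule: walk_cost.induct) (auto intro: walk_cost.intros)

lemma walk_cost_nonneg:
  "walk_cost A \<omega> x d \<Longrightarrow> (\<And>e. e \<in> A \<Longrightarrow> 0 \<le> \<omega> e) \<Longrightarrow> 0 \<le> d"
  by (induction rule: walk_cost.induct) auto

lemma walk_cost_reweight:
  assumes "walk_cost A \<omega> x d"
    and "\<And>e. e \<in> A \<Longrightarrow> \<omega>' e = \<omega> e + \<phi> (ta e) - \<phi> (he e)"
  shows "walk_cost A \<omega>' x (d + \<phi> s - \<phi> x)"
  using assms(1)
proof (induction rule: walk_cost.induct)
  case start
  then show ?case using walk_cost.start by simp
next
  case (step e d)
  have "walk_cost A \<omega>' (he e) (d + \<phi> s - \<phi> (ta e) + \<omega>' e)"
    using step by (intro walk_cost.step) auto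
  then show ?case using assms(2)[OF step.hyps(2)] by (simp add: algebra_simps)
qed

text \<open>This allows the targets to be processed one after the other.\<close>

lemma walk_cost_dominated:
  assumes "walk_cost H \<omega> x d"
    and "\<And>d. walk_cost H \<omega> t d \<Longrightarrow> \<exists>d'\<le>d. walk_cost H' \<omega> t d'"
    and "\<And>e. e \<in> H \<Longrightarrow> he e \<noteq> t \<Longrightarrow> e \<in> H'"
  shows "\<exists>d'\<le>d. walk_cost H' \<omega> x d'"
  using assms(1)
proof (induction rule: walk_cost.induct)
  case start
  then show ?case using walk_cost.start by blast
next
  case (step e d)
  show ?case
  proof (cases "he e = t")
    case True
    then show ?thesis using assms(2) walk_cost.step[OF step.hyps] by simp
  next
    case False
    then have "e \<in> H'" using assms(3) step.hyps by blast
    moreover obtain d' where "d' \<le> d" "walk_cost H' \<omega> (ta e) d'" using step.IH by blast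
    ultimately show ?thesis
      by (intro exI[of _ "d' + \<omega> e"]) (auto intro: walk_cost.step)
  qed
qed

lemma walk_cost_avoid: "walk_cost {a \<in> A. he a \<noteq> t} \<omega> x d \<Longrightarrow> t \<noteq> s \<Longrightarrow> x \<noteq> t"
  by (erule walk_cost.cases) auto

text \<open>Truncate the walk where it first enters \<open>t\<close>; with nonnegative weights the
  remainder cannot make it cheaper.\<close>

lemma walk_cost_first_arrival:
  assumes "walk_cost A \<omega> t d" "t \<noteq> s" "\<And>e. e \<in> A \<Longrightarrow> 0 \<le> \<omega> e"
  shows "\<exists>e\<in>A. he e = t \<and> (\<exists>d0. walk_cost {a \<in> A. he a \<noteq> t} \<omega> (ta e) d0 \<and> d0 + \<omega> e \<le> d)"
proof -
  let ?P = "\<lambda>d. \<exists>e\<in>A. he e = t \<and> (\<exists>d0. walk_cost {a \<in> A. he a \<noteq> t} \<omega> (ta e) d0 \<and> d0 + \<omega> e \<le> d)"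
  \<comment> \<open>Generalized to all ends: a walk either has avoided \<open>t\<close> so far, or
    some prefix of it already arrived there at no larger cost.\<close>
  have "(\<exists>d'\<le>d. walk_cost {a \<in> A. he a \<noteq> t} \<omega> x d') \<or> ?P d" if "walk_cost A \<omega> x d" for x
    using that
  proof (induction rule: walk_cost.induct)
    case start
    then show ?case using walk_cost.start by blast
  next
    case (step e d)
    show ?case
    proof (cases "?P d")
      case True
      then obtain e' d0 where "e' \<in> A" "he e' = t"
        "walk_cost {a \<in> A. he a \<noteq> t} \<omega> (ta e') d0" "d0 + \<omega> e' \<le> d" by blast
      moreover have "d \<le> d + \<omega> e" using assms(3) step.hyps by simp
      ultimately have "?P (d + \<omega> e)" using order_trans by blast
      then show ?thesis ..
    next
      case False
      then obtain d' where d': "d' \<le> d" "walk_cost {a \<in> A. he a \<noteq> t} \<omega> (ta e) d'"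
        using step.IH by blast
      show ?thesis
      proof (cases "he e = t")
        case True
        have "d' + \<omega> e \<le> d + \<omega> e" using d' by simp
        then have "?P (d + \<omega> e)" using d'(2) step.hyps(2) True by blast
        then show ?thesis ..
      next
        case False
        then have "walk_cost {a \<in> A. he a \<noteq> t} \<omega> (he e) (d' + \<omega> e)"
          using d' step.hyps by (intro walk_cost.step) auto
        then show ?thesis using d' by (intro disjI1 exI[of _ "d' + \<omega> e"]) simp
      qed
    qed
  qed
  from this[OF assms(1)] show ?thesis using walk_cost_avoid[of A t \<omega> t] assms(2) by blast
qed

text \<open>The reason is that a walk can be chosen to use every arc at most once.\<close>

lemma walk_cost_le_sum:
  assumes "finite A" "walk_cost A (\<lambda>e. int (I e)) x d"
  shows "\<exists>d'\<le>int (\<Sum>e\<in>A. I e). walk_cost A (\<lambda>e. int (I e)) x d'"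
  using assms
proof (induction "card A" arbitrary: A x d rule: less_induct)
  case less
  show ?case
  proof (cases "x = s")
    case True
    then show ?thesis using walk_cost.start by (intro exI[of _ 0]) (simp add: sum_nonneg)
  next
    case False
    then obtain e d0 where e: "e \<in> A" "he e = x"
      and w: "walk_cost {a \<in> A. he a \<noteq> x} (\<lambda>e. int (I e)) (ta e) d0"
      using walk_cost_first_arrival[OF less.prems(2)] by auto
    \<comment> \<open>Before its first arrival at \<open>x\<close> the walk takes no arc into
      \<open>x\<close>, in particular not \<open>e\<close>. So \<open>e\<close> can be removed from
      \<open>A\<close> for the induction.\<close>
    have "walk_cost (A - {e}) (\<lambda>e. int (I e)) (ta e) d0"
      by (rule walk_cost_mono[OF w]) (use e in auto)
    moreover have "card (A - {e}) < card A" using less.prems e by (intro card_Diff1_less)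
    ultimately obtain d' where d': "d' \<le> int (\<Sum>e\<in>A - {e}. I e)"
      "walk_cost (A - {e}) (\<lambda>e. int (I e)) (ta e) d'"
      using less.hyps less.prems by blast
    have "walk_cost A (\<lambda>e. int (I e)) (ta e) d'" using d'(2) by (rule walk_cost_mono) auto
    then have "walk_cost A (\<lambda>e. int (I e)) x (d' + int (I e))" using e walk_cost.step by blast
    moreover have "d' + int (I e) \<le> int (\<Sum>e\<in>A. I e)"
      using d'(1) sum.remove[OF less.prems(1) e(1), of I] by simp
    ultimately show ?thesis by blast
  qed
qed

end

section \<open>The layered network\<close>

text \<open>\<open>last_arc ta x b\<close> is \<open>a + 1\<close> for the last arc \<open>a < b\<close> with tail \<open>x\<close>, and \<open>0\<close> if there is none.\<close>

fun last_arc :: "(nat \<Rightarrow> nat) \<Rightarrow> nat \<Rightarrow> nat \<Rightarrow> nat" where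
  "last_arc ta x 0 = 0"
| "last_arc ta x (Suc b) = (if ta b = x then Suc b else last_arc ta x b)"

lemma last_arc_le: "last_arc ta x b \<le> b"
  by (induction b) auto

lemma last_arc_tail: "last_arc ta x b = Suc a \<Longrightarrow> ta a = x"
  by (induction b) (auto split: if_splits)

lemma last_arc_pos: "a < b \<Longrightarrow> ta a = x \<Longrightarrow> last_arc ta x b \<noteq> 0"
  by (induction b) (auto simp: less_Suc_eq)

text \<open>Induction along the linked list of the arcs with tail \<open>x\<close>, which runs from
  the last arc to the first one.\<close>

lemma last_arc_closed:
  assumes "\<And>a. P a \<Longrightarrow> ta a = x \<Longrightarrow> last_arc ta x a \<noteq> 0 \<Longrightarrow> P (last_arc ta x a - 1)"
    and "\<And>a. last_arc ta x b = Suc a \<Longrightarrow> P a"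
    and "a < b" "ta a = x"
  shows "P a"
  using assms(2,3)
proof (induction b)
  case (Suc b)
  show ?case
  proof (cases "ta b = x")
    case True
    then have Pb: "P b" using Suc.prems(1) by simp
    show ?thesis
    proof (cases "a = b")
      case False
      have "P a0" if "last_arc ta x b = Suc a0" for a0
        using assms(1)[OF Pb True] that by simp
      then show ?thesis using Suc.IH Suc.prems False by simp
    qed (use Pb in simp)
  next
    case False
    then have "a \<noteq> b" using assms(4) by blast
    then show ?thesis using False Suc by simp
  qed
qed simp

text \<open>Node \<open>node m e j\<close> stands for choosing whether to traverse arc \<open>e\<close> when its tail has been
  reached with cost \<open>j\<close>. Its two outgoing arcs, which have the ids \<open>node m e j\<close> and
  \<open>- node m e j\<close>, take \<open>e\<close> or go on to the next arc with the same tail, and from the last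
  such arc to the first one with cost \<open>j + 1\<close>. Node \<open>0\<close> is the source and \<open>-1\<close> the sink;
  missing arcs are represented by loops.\<close>

definition node :: "nat \<Rightarrow> nat \<Rightarrow> int \<Rightarrow> int" where
  "node m e j = j * int m + int e + 1"

lemma node_inject:
  assumes "e < m" "e' < m" "node m e j = node m e' j'"
  shows "e = e' \<and> j = j'"
proof -
  have "(node m e j - 1) div int m = j" "(node m e' j' - 1) div int m = j'"
    using assms(1,2) by (simp_all add: node_def)
  then have "j = j'" using assms(3) by simp
  then show ?thesis using assms(3) by (simp add: node_def)
qed

text \<open>Because \<open>last_arc\<close> and \<open>node\<close> are both shifted by one,
  \<open>j * int m + int (last_arc ta x m)\<close> is the node of the last arc with tail
  \<open>x\<close> on level \<open>j\<close>, that is, the entry of the list of \<open>x\<close>. In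
  the same way \<open>hd_source\<close> leads to the entry of \<open>s\<close> on level
  \<open>0\<close>, or is a loop at node \<open>0\<close> if that list is empty.\<close>

locale layered = arc_structure ta he s for ta he :: "nat \<Rightarrow> nat" and s :: nat +
  fixes m t :: nat and D :: int and H :: "nat set" and c :: "nat \<Rightarrow> int" and hd :: "int \<Rightarrow> int"
  assumes m_pos: "0 < m" and D_nonneg: "0 \<le> D"
    and hd_source: "hd 0 = int (last_arc ta s m)"
    and hd_take: "\<And>e j. e < m \<Longrightarrow> 0 \<le> j \<Longrightarrow> j \<le> D \<Longrightarrow> hd (node m e j) =
      (if e \<in> H \<and> j + c e \<le> D then
         if he e = t then -1
         else if last_arc ta (he e) m = 0 then node m e j
         else (j + c e) * int m + int (last_arc ta (he e) m)
       else node m e j)"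
    and hd_skip: "\<And>e j. e < m \<Longrightarrow> 0 \<le> j \<Longrightarrow> j \<le> D \<Longrightarrow> hd (- node m e j) =
      (if last_arc ta (ta e) e \<noteq> 0 then j * int m + int (last_arc ta (ta e) e)
       else if j < D then (j + 1) * int m + int (last_arc ta (ta e) m)
       else node m e j)"
    and H_arcs: "H \<subseteq> {..<m}" and c_nonneg: "\<And>e. e \<in> H \<Longrightarrow> 0 \<le> c e"
begin

definition M :: int where "M = int m * (D + 1)"

lemma node_bounds: "e < m \<Longrightarrow> 0 \<le> j \<Longrightarrow> j \<le> D \<Longrightarrow> 1 \<le> node m e j \<and> node m e j \<le> M"
proof -
  assume *: "e < m" "0 \<le> j" "j \<le> D"
  then have "j * int m \<le> D * int m" by (intro mult_right_mono) auto
  moreover have "0 \<le> j * int m" using * by simp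
  moreover have "int e + 1 \<le> int m" using * by simp
  ultimately have "1 \<le> j * int m + int e + 1 \<and> j * int m + int e + 1 \<le> D * int m + int m"
    by linarith
  then show ?thesis by (simp add: node_def M_def algebra_simps)
qed

lemma node_cases:
  assumes "1 \<le> v" "v \<le> M"
  obtains e j where "e < m" "0 \<le> j" "j \<le> D" "v = node m e j"
proof
  let ?j = "(v - 1) div int m" and ?e = "nat ((v - 1) mod int m)"
  show e: "?e < m" using m_pos by (simp add: nat_less_iff)
  show "0 \<le> ?j" using assms by (simp add: pos_imp_zdiv_nonneg_iff m_pos)
  have "v - 1 \<le> D * int m + (int m - 1)" using assms by (simp add: M_def algebra_simps)
  then have "?j \<le> (D * int m + (int m - 1)) div int m" using m_pos by (intro zdiv_mono1) auto
  also have "\<dots> = D" using m_pos by simp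
  finally show "?j \<le> D" .
  show "v = node m ?e ?j" using m_pos by (simp add: node_def)
qed

text \<open>The tail of arc \<open>q\<close> is \<open>\<bar>q\<bar>\<close>: a positive node
  \<open>v\<close> has the two arcs \<open>v\<close> and \<open>- v\<close>, the source has the
  single arc \<open>0\<close>, and the sink has none.\<close>

sublocale network "{- M..M}" abs hd "-1"
  by unfold_locales auto

section \<open>Sets of nodes given by the levels on which vertices have been reached\<close>

context
  fixes W :: "nat \<Rightarrow> int \<Rightarrow> bool"
  assumes W_mono: "\<forall>x i j. W x i \<longrightarrow> i \<le> j \<longrightarrow> W x j"
begin

definition X :: "int set" where
  "X = insert 0 {node m e j | e j. e < m \<and> 0 \<le> j \<and> j \<le> D \<and> W (ta e) j}"

lemma node_in_X:
  assumes "e < m" "0 \<le> j" "j \<le> D"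
  shows "node m e j \<in> X \<longleftrightarrow> W (ta e) j"
proof -
  have "node m e j \<noteq> 0" using node_bounds[OF assms] by simp
  then show ?thesis using node_inject[OF assms(1)] assms by (auto simp: X_def)
qed

lemma entry_in_X:
  assumes "last_arc ta x m \<noteq> 0" "0 \<le> j" "j \<le> D"
  shows "j * int m + int (last_arc ta x m) \<in> X \<longleftrightarrow> W x j"
proof -
  obtain a where a: "last_arc ta x m = Suc a" using assms(1) not0_implies_Suc by blast
  then have "a < m" "ta a = x" using last_arc_le[of ta x m] last_arc_tail by auto
  then show ?thesis using node_in_X[of a j] assms a by (simp add: node_def algebra_simps)
qed

text \<open>Membership in \<open>X\<close> depends only on tail and level and is monotone in the
  level. So the arcs that merely wait or browse a list never leave \<open>X\<close>, and only arcs
  that take some \<open>e\<close> can be faults.\<close>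

lemma skip_in_X:
  assumes e: "e < m" and j: "0 \<le> j" "j \<le> D" and W: "W (ta e) j"
  shows "hd (- node m e j) \<in> X"
proof (cases "last_arc ta (ta e) e")
  case 0
  have pos: "last_arc ta (ta e) m \<noteq> 0" using e by (intro last_arc_pos) auto
  show ?thesis
    using hd_skip[OF e j] 0 node_in_X[OF e j] entry_in_X[OF pos, of "j + 1"] W_mono j W by auto
next
  case (Suc a)
  then have "a < m" "ta a = ta e" using last_arc_le[of ta "ta e" e] last_arc_tail e by auto
  then show ?thesis
    using node_in_X[of a j] hd_skip[OF e j] j W Suc by (simp add: node_def algebra_simps)
qed

lemma sink_notin_X: "-1 \<notin> X"
proof -
  have "node m e j \<noteq> -1" if "e < m" "0 \<le> j" "j \<le> D" for e j using node_bounds[OF that] by simp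
  then show ?thesis by (force simp: X_def)
qed

lemma linked_step:
  assumes "linked 0 X u" "u \<in> X" "q \<in> {- M..M}" "\<bar>q\<bar> = u" "hd q \<in> X"
  shows "linked 0 X (hd q)"
proof -
  have "(u, hd q) \<in> {(\<bar>q\<bar>, hd q) | q. q \<in> {- M..M} \<and> \<bar>q\<bar> \<in> X \<and> hd q \<in> X}"
    using assms by blast
  then show ?thesis using assms(1) unfolding linked_def by (rule rtrancl_into_rtrancl[rotated])
qed

text \<open>From the entry of the list of \<open>x\<close>, the skip arcs visit every arc with tail
  \<open>x\<close> without changing the level.\<close>

lemma linked_list:
  assumes li: "last_arc ta x m \<noteq> 0 \<Longrightarrow> linked 0 X (j * int m + int (last_arc ta x m))"
    and W: "W x j" and j: "0 \<le> j" "j \<le> D" and e: "e < m" "ta e = x"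
  shows "linked 0 X (node m e j)"
proof -
  have "e < m \<and> linked 0 X (node m e j)"
  proof (rule last_arc_closed[where b = m and ta = ta and x = x])
    fix a assume a: "a < m \<and> linked 0 X (node m a j)" "ta a = x" "last_arc ta x a \<noteq> 0"
    have "hd (- node m a j) = node m (last_arc ta x a - 1) j"
      using hd_skip[OF _ j, of a] a by (simp add: node_def of_nat_diff)
    moreover have "- node m a j \<in> {- M..M}" "\<bar>- node m a j\<bar> = node m a j"
      using node_bounds[OF _ j, of a] a by auto
    ultimately have "linked 0 X (node m (last_arc ta x a - 1) j)"
      using linked_step[of "node m a j" "- node m a j"] a node_in_X[OF _ j, of a]
        skip_in_X[OF _ j, of a] W by simp
    moreover have "last_arc ta x a - 1 < m" using last_arc_le[of ta x a] a by linarith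
    ultimately show "last_arc ta x a - 1 < m \<and> linked 0 X (node m (last_arc ta x a - 1) j)" by simp
  next
    fix a assume a: "last_arc ta x m = Suc a"
    then show "a < m \<and> linked 0 X (node m a j)"
      using li last_arc_le[of ta x m] by (simp add: node_def algebra_simps)
  qed (use e in auto)
  then show ?thesis by blast
qed

lemma linked_later:
  assumes li: "linked 0 X (i * int m + int (last_arc ta x m))" and pos: "last_arc ta x m \<noteq> 0"
    and W: "W x i" and ij: "0 \<le> i" "i \<le> j" and j: "j \<le> D"
  shows "linked 0 X (j * int m + int (last_arc ta x m))"
  using ij(2) j
proof (induction j rule: int_ge_induct)
  case (step j)
  \<comment> \<open>The first arc with tail \<open>x\<close> ends the list, so its skip arc is the
    one that climbs to the next level.\<close>
  define e where "e = (LEAST e. ta e = x)"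
  obtain a where a: "last_arc ta x m = Suc a" using pos not0_implies_Suc by blast
  have ex: "ta a = x" using last_arc_tail[OF a] .
  have e: "ta e = x" unfolding e_def using ex by (rule LeastI)
  have "e \<le> a" unfolding e_def using ex by (rule Least_le)
  then have em: "e < m" using last_arc_le[of ta x m] a by simp
  have last: "last_arc ta x e = 0"
  proof (rule ccontr)
    assume "last_arc ta x e \<noteq> 0"
    then obtain b where b: "last_arc ta x e = Suc b" using not0_implies_Suc by blast
    have "b < e" using last_arc_le[of ta x e] b by simp
    then show False using not_less_Least[of b "\<lambda>e. ta e = x"] last_arc_tail[OF b] e_def by blast
  qed
  have j: "0 \<le> j" "j \<le> D" using step ij by auto
  have Wj: "W x j" using W_mono W step by auto
  have "linked 0 X (node m e j)" using step j Wj em e by (intro linked_list) auto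
  moreover have "hd (- node m e j) = (j + 1) * int m + int (last_arc ta x m)"
    using hd_skip[OF em j] last e step by simp
  moreover have "- node m e j \<in> {- M..M}" "\<bar>- node m e j\<bar> = node m e j"
    using node_bounds[OF em j] by auto
  ultimately show ?case
    using linked_step[of "node m e j" "- node m e j"] node_in_X[OF em j] skip_in_X[OF em j] Wj e
    by simp
qed (use li in simp)

lemma source_in_X: "W s 0 \<Longrightarrow> hd 0 \<in> X"
  using hd_source entry_in_X[of s 0] D_nonneg by (cases "last_arc ta s m = 0") (auto simp: X_def)

lemma linked_source:
  assumes "W s 0"
  shows "linked 0 X (int (last_arc ta s m))"
proof -
  have "linked 0 X 0" "0 \<in> X" by (auto simp: linked_def X_def)
  moreover have "(0::int) \<in> {- M..M}" using D_nonneg by (simp add: M_def)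
  ultimately show ?thesis using linked_step[of 0 0] source_in_X[OF assms] hd_source by simp
qed

end

lemma linked_walk:
  fixes I :: "nat \<Rightarrow> nat"
  defines "\<omega> \<equiv> \<lambda>e. c e + int (I e)" and "H' \<equiv> {a \<in> H. he a \<noteq> t}"
  defines "W \<equiv> \<lambda>x j. \<exists>d\<le>j. walk_cost H' \<omega> x d"
  assumes "walk_cost H' \<omega> x d" "d \<le> D" "last_arc ta x m \<noteq> 0"
  shows "linked 0 (X W) (d * int m + int (last_arc ta x m))"
proof -
  have W_mono: "\<forall>x i j. W x i \<longrightarrow> i \<le> j \<longrightarrow> W x j"
    unfolding W_def using order_trans by blast
  show ?thesis
    using assms(4-6)
  proof (induction rule: walk_cost.induct)
    case start
    have "W s 0" using walk_cost.start unfolding W_def by blast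
    then show ?case using linked_source[OF W_mono] by simp
  next
    case (step e d)
    have e: "e < m" "e \<in> H" "he e \<noteq> t" using step.hyps H_arcs by (auto simp: H'_def)
    have nn: "\<And>e. e \<in> H' \<Longrightarrow> 0 \<le> \<omega> e" using c_nonneg by (simp add: H'_def \<omega>_def)
    \<comment> \<open>The network charges \<open>c e\<close> for taking \<open>e\<close>, but the
      increment makes it cost \<open>\<omega> e\<close>. Waiting for \<open>I e\<close> levels
      before taking \<open>e\<close> pays the difference, so that its head is entered on a level
      where it belongs to \<open>X\<close>.\<close>
    define j where "j = d + int (I e)"
    have d: "0 \<le> d" using walk_cost_nonneg[OF step.hyps(1) nn] .
    have j: "d \<le> j" "0 \<le> j" "j \<le> D" "j + c e = d + \<omega> e" "j + c e \<le> D"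
      using step.prems c_nonneg[OF e(2)] d by (simp_all add: j_def \<omega>_def)
    have pos: "last_arc ta (ta e) m \<noteq> 0" using e by (intro last_arc_pos) auto
    have Wd: "W (ta e) d" using step.hyps unfolding W_def by blast
    have Wj: "W (ta e) j" using W_mono Wd j(1) by blast
    have "linked 0 (X W) (d * int m + int (last_arc ta (ta e) m))"
      using step.IH j pos c_nonneg[OF e(2)] by simp
    then have "linked 0 (X W) (j * int m + int (last_arc ta (ta e) m))"
      using linked_later[OF W_mono] pos Wd d j by blast
    then have l: "linked 0 (X W) (node m e j)"
      using linked_list[OF W_mono] Wj j e by blast
    have hd: "hd (node m e j) = (d + \<omega> e) * int m + int (last_arc ta (he e) m)"
      using hd_take[OF e(1) j(2,3)] e j step.prems by simp
    have "W (he e) (d + \<omega> e)" using walk_cost.step[OF step.hyps] unfolding W_def by blast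
    then have "hd (node m e j) \<in> X W"
      using entry_in_X[OF W_mono] step.prems j c_nonneg[OF e(2)] unfolding hd by simp
    moreover have "node m e j \<in> X W" using node_in_X[OF W_mono] e j Wj by blast
    ultimately show ?case
      using linked_step[OF W_mono l, of "node m e j"] node_bounds[OF e(1) j(2,3)] hd by simp
  qed
qed

text \<open>The faults: the copies of the arcs that an increment \<open>I\<close> makes cross \<open>X\<close>. For each arc
  \<open>e\<close> there are at most \<open>I e\<close> of them, on consecutive levels.\<close>

theorem layered_tolerant:
  fixes I :: "nat \<Rightarrow> nat"
  assumes tolerant: "\<And>X p. 0 \<in> X \<Longrightarrow> -1 \<notin> X \<Longrightarrow> p \<in> {- M..M} \<Longrightarrow> linked 0 X \<bar>p\<bar> \<Longrightarrow>
      hd p = -1 \<Longrightarrow> f p \<noteq> 1 \<Longrightarrow> k < card {q \<in> cut X. hd q = -1 \<longrightarrow> f q = 1}"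
    and K: "\<And>e j. e < m \<Longrightarrow> 0 \<le> j \<Longrightarrow> j \<le> D \<Longrightarrow> hd (node m e j) = -1 \<Longrightarrow>
      f (node m e j) = (1::int) \<Longrightarrow> e \<in> K"
    and I: "(\<Sum>e<m. I e) \<le> k" and ts: "t \<noteq> s"
    and walk: "walk_cost H (\<lambda>e. c e + int (I e)) t d" and d: "d \<le> D"
  shows "\<exists>d'\<le>D. walk_cost {e \<in> H. he e = t \<longrightarrow> e \<in> K} (\<lambda>e. c e + int (I e)) t d'"
proof (rule ccontr)
  define \<omega> where "\<omega> = (\<lambda>e. c e + int (I e))"
  \<comment> \<open>Walks are stopped before they enter \<open>t\<close>, as in the network, where
    the arcs into \<open>t\<close> end in the sink.\<close>
  define H' where "H' = {a \<in> H. he a \<noteq> t}"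
  define W where "W = (\<lambda>x j. \<exists>d\<le>j. walk_cost H' \<omega> x d)"
  define L where "L = {e \<in> H. he e = t \<longrightarrow> e \<in> K}"
  assume "\<not> ?thesis"
  then have far: "\<And>d'. walk_cost L \<omega> t d' \<Longrightarrow> D < d'" unfolding L_def \<omega>_def by (metis linorder_not_less)
  have W_mono: "\<forall>x i j. W x i \<longrightarrow> i \<le> j \<longrightarrow> W x j"
    unfolding W_def using order_trans by blast
  have nn: "\<And>e. e \<in> H \<Longrightarrow> 0 \<le> \<omega> e" using c_nonneg by (simp add: \<omega>_def)
  have sub: "H' \<subseteq> L" by (auto simp: H'_def L_def)
  \<comment> \<open>A surviving arc into \<open>t\<close> would complete a walk that has been
    assumed not to exist within cost \<open>D\<close>.\<close>
  have into: "D < d0 + \<omega> e" if "walk_cost H' \<omega> (ta e) d0" "e \<in> L" "he e = t" for e d0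
    using far walk_cost.step[OF walk_cost_mono[OF that(1) sub] that(2)] that(3) by simp
  note X_lemmas = node_in_X[OF W_mono] entry_in_X[OF W_mono]
  have "W s 0" using walk_cost.start unfolding W_def by blast
  note source = source_in_X[OF W_mono this]
  have zX: "-1 \<notin> X W" using sink_notin_X[OF W_mono] .
  obtain e d0 where e: "e \<in> H" "he e = t" and w: "walk_cost H' \<omega> (ta e) d0"
    and d0: "d0 + \<omega> e \<le> d"
    using walk_cost_first_arrival[OF walk ts] nn unfolding \<omega>_def H'_def by blast
  have em: "e < m" using e H_arcs by auto
  have "0 \<le> d0" using walk_cost_nonneg[OF w] nn by (simp add: H'_def)
  then have j: "0 \<le> d0" "d0 \<le> D" "d0 + c e \<le> D"
    using d0 d nn[OF e(1)] c_nonneg[OF e(1)] by (auto simp: \<omega>_def)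
  have pos: "last_arc ta (ta e) m \<noteq> 0" using em by (intro last_arc_pos) auto
  have "linked 0 (X W) (d0 * int m + int (last_arc ta (ta e) m))"
    unfolding W_def H'_def \<omega>_def
    by (rule linked_walk) (use w j pos in \<open>auto simp: H'_def \<omega>_def\<close>)
  moreover have "W (ta e) d0" using w unfolding W_def by blast
  ultimately have li: "linked 0 (X W) (node m e d0)"
    using linked_list[OF W_mono] j em by blast
  have hd: "hd (node m e d0) = -1" using hd_take[OF em j(1,2)] e j by simp
  have "e \<notin> L" using into[OF w] e d0 d by force
  then have "f (node m e d0) \<noteq> 1" using K[OF em j(1,2) hd] e by (auto simp: L_def)
  moreover have "node m e d0 \<in> {- M..M}" "\<bar>node m e d0\<bar> = node m e d0"
    using node_bounds[OF em j(1,2)] by auto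
  moreover have "0 \<in> X W" by (simp add: X_def[OF W_mono])
  ultimately have big: "k < card {q \<in> cut (X W). hd q = -1 \<longrightarrow> f q = 1}"
    using tolerant zX li hd by simp
  \<comment> \<open>The copies of \<open>e\<close> that count as faults lie within
    \<open>I e\<close> consecutive levels, starting at some \<open>j0\<close>.\<close>
  define Q where "Q = (\<lambda>e j0. \<forall>j. 0 \<le> j \<longrightarrow> j \<le> D \<longrightarrow> node m e j \<in> cut (X W) \<longrightarrow>
      (hd (node m e j) = -1 \<longrightarrow> f (node m e j) = 1) \<longrightarrow> j \<in> {j0..<j0 + int (I e)})"
  have "\<exists>j0. Q e j0" if em: "e < m" for e
  proof (cases "\<exists>d. walk_cost H' \<omega> (ta e) d")
    \<comment> \<open>The tail of \<open>e\<close> is never reached, so no copy starts in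
      \<open>X\<close> and any \<open>j0\<close> will do.\<close>
    case False
    have "node m e j \<notin> cut (X W)" if "0 \<le> j" "j \<le> D" for j
      using X_lemmas(1)[OF em that] False node_bounds[OF em that] by (simp add: cut_def W_def)
    then show ?thesis by (simp add: Q_def)
  next
    case True
    define P where "P = (\<lambda>d. walk_cost H' \<omega> (ta e) (int d))"
    have P: "walk_cost H' \<omega> (ta e) d \<longleftrightarrow> 0 \<le> d \<and> P (nat d)" for d
      using walk_cost_nonneg[of H' \<omega> "ta e" d] nn by (auto simp: P_def H'_def)
    \<comment> \<open>The cheapest cost of reaching the tail of \<open>e\<close> is the first level
      whose copy starts in \<open>X\<close>.\<close>
    define d1 where "d1 = (LEAST d. P d)"
    have d1: "P d1" unfolding d1_def using True P by (metis LeastI)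
    have d1_le: "int d1 \<le> d" if "walk_cost H' \<omega> (ta e) d" for d
      using P[of d] that Least_le[of P "nat d"] d1_def by auto
    have "j \<in> {int d1..<int d1 + int (I e)}"
      if j: "0 \<le> j" "j \<le> D" and q: "node m e j \<in> cut (X W)"
        and f: "hd (node m e j) = -1 \<longrightarrow> f (node m e j) = 1" for j
    proof -
      have b: "\<bar>node m e j\<bar> = node m e j" using node_bounds[OF em j] by simp
      have "W (ta e) j" and hX: "hd (node m e j) \<notin> X W"
        using q b X_lemmas(1)[OF em j] by (auto simp: cut_def)
      then have lower: "int d1 \<le> j" using d1_le unfolding W_def by force
      have ne: "hd (node m e j) \<noteq> node m e j" using hX q b by (auto simp: cut_def)
      then have eH: "e \<in> H" "j + c e \<le> D"
        using hd_take[OF em j] by (auto split: if_splits)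
      have wd: "walk_cost H' \<omega> (ta e) (int d1)" using d1 by (simp add: P_def)
      \<comment> \<open>From its first level on, the head of \<open>e\<close> is reached at cost
        \<open>int d1 + \<omega> e\<close>. A copy that leaves \<open>X\<close> must arrive earlier,
        which leaves only \<open>I e\<close> levels for it. If \<open>e\<close> enters
        \<open>t\<close>, the same bound comes from \<open>into\<close>.\<close>
      have "j + c e < int d1 + \<omega> e"
      proof (cases "he e = t")
        case True
        then have "hd (node m e j) = -1" using hd_take[OF em j] eH by simp
        then have "e \<in> L" using K[OF em j] f eH by (auto simp: L_def)
        then show ?thesis using into[OF wd] True eH by force
      next
        case False
        then have eH': "e \<in> H'" using eH by (simp add: H'_def)
        have ne: "last_arc ta (he e) m \<noteq> 0" using ne hd_take[OF em j] eH False by (auto split: if_splits)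
        then have "hd (node m e j) = (j + c e) * int m + int (last_arc ta (he e) m)"
          using hd_take[OF em j] eH False by simp
        then have "\<not> W (he e) (j + c e)"
          using X_lemmas(2)[OF ne] hX j eH c_nonneg[OF eH(1)] by simp
        then show ?thesis using walk_cost.step[OF wd eH'] unfolding W_def by (meson not_le)
      qed
      then show ?thesis using lower by (simp add: \<omega>_def)
    qed
    then have "Q e (int d1)" by (simp add: Q_def)
    then show ?thesis ..
  qed
  then obtain j0 where j0: "\<And>e. e < m \<Longrightarrow> Q e (j0 e)" by metis
  have "{q \<in> cut (X W). hd q = -1 \<longrightarrow> f q = 1} \<subseteq> (\<Union>e<m. node m e ` {j0 e..<j0 e + int (I e)})"
  proof
    fix q assume q: "q \<in> {q \<in> cut (X W). hd q = -1 \<longrightarrow> f q = 1}"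
    then have qM: "q \<in> {- M..M}" "\<bar>q\<bar> \<in> X W" "hd q \<notin> X W" by (auto simp: cut_def)
    \<comment> \<open>The arc of the source belongs to no arc of the graph, but it stays inside
      \<open>X\<close>.\<close>
    have "q \<noteq> 0" using qM source by blast
    then have "1 \<le> \<bar>q\<bar>" "\<bar>q\<bar> \<le> M" using qM by auto
    then obtain e j where ej: "e < m" "0 \<le> j" "j \<le> D" "\<bar>q\<bar> = node m e j" by (rule node_cases)
    have "W (ta e) j" using X_lemmas(1)[OF ej(1-3)] qM ej by simp
    then have "hd (- node m e j) \<in> X W" using skip_in_X[OF W_mono] ej by blast
    moreover have "q = node m e j \<or> q = - node m e j" using ej by linarith
    ultimately have "q = node m e j" using qM by blast
    moreover from this have "j \<in> {j0 e..<j0 e + int (I e)}"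
      using j0[OF ej(1)] ej(2,3) q unfolding Q_def by simp
    ultimately show "q \<in> (\<Union>e<m. node m e ` {j0 e..<j0 e + int (I e)})"
      using ej(1) by blast
  qed
  then have "card {q \<in> cut (X W). hd q = -1 \<longrightarrow> f q = 1}
      \<le> card (\<Union>e<m. node m e ` {j0 e..<j0 e + int (I e)})" by (intro card_mono) auto
  also have "\<dots> \<le> (\<Sum>e<m. card (node m e ` {j0 e..<j0 e + int (I e)}))" by (intro card_UN_le) simp
  also have "\<dots> \<le> (\<Sum>e<m. I e)"
  proof (rule sum_mono)
    fix e
    have "card (node m e ` {j0 e..<j0 e + int (I e)}) \<le> card {j0 e..<j0 e + int (I e)}"
      by (intro card_image_le) simp
    then show "card (node m e ` {j0 e..<j0 e + int (I e)}) \<le> I e" by simp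
  qed
  finally show False using big I by simp
qed

end

section \<open>Costs of at least \<open>k\<close>\<close>

context arc_structure
begin

lemma walk_cost_zero:
  assumes "walk_cost A c x d" "d \<le> 0" "\<And>e. e \<in> A \<Longrightarrow> 0 \<le> c e"
  shows "\<exists>d. walk_cost {e \<in> A. c e = 0} \<omega> x d"
  using assms(1,2)
proof (induction rule: walk_cost.induct)
  case (step e d)
  have "0 \<le> d" using walk_cost_nonneg[OF step.hyps(1) assms(3)] .
  then have "c e = 0" "d \<le> 0" using step.prems assms(3)[OF step.hyps(2)] by auto
  then show ?case using step by (blast intro: walk_cost.step)
qed (blast intro: walk_cost.start)

lemma walk_cost_exists: "walk_cost A \<omega> x d \<Longrightarrow> \<exists>d'. walk_cost A \<omega>' x d'"
  by (induction rule: walk_cost.induct) (blast intro: walk_cost.intros)+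

lemma walk_cost_append:
  "walk_cost A \<omega> s d0 \<Longrightarrow> walk_cost A \<omega> x d \<Longrightarrow> walk_cost A \<omega> x (d0 + d)"
  by (rotate_tac, induction rule: walk_cost.induct)
    (auto simp: add.assoc[symmetric] intro: walk_cost.intros)

text \<open>Costs below \<open>k\<close> are handled by the layered networks. A larger cost is matched by a walk
  of reduced cost \<open>0\<close>, which any admissible increment raises to at most \<open>k\<close>.\<close>

lemma walk_cost_tolerant:
  fixes I :: "nat \<Rightarrow> nat" and H K :: "nat set" and t :: nat
  defines "H' \<equiv> {e \<in> H. he e = t \<longrightarrow> e \<in> K}"
  assumes layer: "\<And>D I d. 0 \<le> D \<Longrightarrow> D < int k \<Longrightarrow> (\<Sum>e<m. I e) \<le> k \<Longrightarrow>
      walk_cost H (\<lambda>e. c e + int (I e)) t d \<Longrightarrow> d \<le> D \<Longrightarrow>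
      \<exists>d'\<le>D. walk_cost H' (\<lambda>e. c e + int (I e)) t d'"
    and zero: "walk_cost H c t 0" and k: "1 \<le> k"
    and H: "H \<subseteq> {..<m}" and c: "\<And>e. e \<in> H \<Longrightarrow> 0 \<le> c e"
    and I: "(\<Sum>e<m. I e) \<le> k" and walk: "walk_cost H (\<lambda>e. c e + int (I e)) t d"
  shows "\<exists>d'\<le>d. walk_cost H' (\<lambda>e. c e + int (I e)) t d'"
proof (cases "d < int k")
  case True
  have "0 \<le> d" using walk_cost_nonneg[OF walk] c by fastforce
  then show ?thesis using layer[OF _ True I walk] by simp
next
  case False
  define Z where "Z = {e \<in> H'. c e = 0}"
  have "H' \<subseteq> H" by (auto simp: H'_def)
  then have Z: "Z \<subseteq> H'" "Z \<subseteq> {..<m}" using H by (auto simp: Z_def)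
  then have "finite Z" using finite_subset by blast
  \<comment> \<open>The network for \<open>D = 0\<close> without increments already guarantees that
    a walk of reduced cost \<open>0\<close> survives.\<close>
  obtain d0 where d0: "d0 \<le> 0" "walk_cost H' c t d0"
    using layer[of 0 "\<lambda>_. 0" 0] zero k by auto
  then have "\<exists>d. walk_cost Z (\<lambda>e. int (I e)) t d"
    using walk_cost_zero[OF d0(2,1)] \<open>H' \<subseteq> H\<close> c unfolding Z_def by blast
  then obtain d' where d': "d' \<le> int (\<Sum>e\<in>Z. I e)" "walk_cost Z (\<lambda>e. int (I e)) t d'"
    using walk_cost_le_sum[OF \<open>finite Z\<close>] by blast
  have "(\<Sum>e\<in>Z. I e) \<le> (\<Sum>e<m. I e)" using Z by (intro sum_mono2) auto
  then have "d' \<le> d" using d' I False by linarith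
  moreover have "walk_cost Z (\<lambda>e. c e + int (I e)) t d'"
    using d'(2) by (rule walk_cost_cong) (simp add: Z_def)
  ultimately show ?thesis using walk_cost_mono Z(1) by blast
qed

end

text \<open>The contract between the flow computation and the graph argument. The last part is
  conditional because \<open>expanding\<close> can fail when the sink is unreachable: some
  separating sets then have no outgoing arc.\<close>

definition tolerant_flow :: "int \<Rightarrow> (int \<Rightarrow> int) \<Rightarrow> nat \<Rightarrow> (int \<Rightarrow> int) \<Rightarrow> bool" where
  "tolerant_flow M h k f \<longleftrightarrow> (\<forall>q\<in>{- M..M}. f q = 0 \<or> f q = 1) \<and>
     card {q \<in> {- M..M}. h q = -1 \<and> f q = 1} \<le> 2 ^ k \<and>
     (network.linked {- M..M} abs h 0 UNIV (-1) \<longrightarrow>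
       (\<exists>S B rk. network.expanding {- M..M} abs h (-1) 0 k S \<and>
         max_flow {- M..M} abs h (-1) f S B rk))"

context layered
begin

lemma tolerant_flow_layer:
  fixes I :: "nat \<Rightarrow> nat"
  assumes f: "tolerant_flow M hd k f"
    and K: "\<And>e j. e < m \<Longrightarrow> 0 \<le> j \<Longrightarrow> j \<le> D \<Longrightarrow> hd (node m e j) = -1 \<Longrightarrow>
      f (node m e j) = 1 \<Longrightarrow> e \<in> K"
    and I: "(\<Sum>e<m. I e) \<le> k" and ts: "t \<noteq> s"
    and walk: "walk_cost H (\<lambda>e. c e + int (I e)) t d" and d: "d \<le> D"
  shows "\<exists>d'\<le>D. walk_cost {e \<in> H. he e = t \<longrightarrow> e \<in> K} (\<lambda>e. c e + int (I e)) t d'"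
proof (rule layered_tolerant[OF _ K I ts walk d])
  fix X p
  assume X: "0 \<in> X" "-1 \<notin> X" and p: "p \<in> {- M..M}" "linked 0 X \<bar>p\<bar>" "hd p = -1" "f p \<noteq> 1"
  \<comment> \<open>The arc \<open>p\<close> into the sink and its linked tail show that the sink is
    reachable, so the condition in \<open>tolerant_flow\<close> is met.\<close>
  have "linked 0 UNIV \<bar>p\<bar>"
    using p(2) unfolding linked_def by (rule rtrancl_mono[THEN subsetD, rotated]) blast
  moreover have "(\<bar>p\<bar>, -1) \<in> {(\<bar>q\<bar>, hd q) | q. q \<in> {- M..M} \<and> \<bar>q\<bar> \<in> UNIV \<and> hd q \<in> UNIV}"
    using p by force
  ultimately have "linked 0 UNIV (-1)"
    unfolding linked_def by (rule rtrancl_into_rtrancl)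
  then obtain S B rk where "expanding 0 k S" "max_flow {- M..M} abs hd (-1) f S B rk"
    using f unfolding tolerant_flow_def by blast
  moreover have "f p = 0" using f p by (auto simp: tolerant_flow_def)
  ultimately show "k < card {q \<in> cut X. hd q = -1 \<longrightarrow> f q = 1}"
    using X p by (intro fault_tolerant)
qed

lemma tolerant_flow_card:
  assumes "tolerant_flow M hd k f"
  shows "card {e. e < m \<and> (\<exists>j. 0 \<le> j \<and> j \<le> D \<and> hd (node m e j) = -1 \<and> f (node m e j) = 1)} \<le> 2 ^ k"
    (is "card ?E \<le> _")
proof -
  have "\<forall>e\<in>?E. \<exists>j. 0 \<le> j \<and> j \<le> D \<and> hd (node m e j) = -1 \<and> f (node m e j) = 1" by blast
  then obtain g where g: "\<forall>e\<in>?E. 0 \<le> g e \<and> g e \<le> D \<and> hd (node m e (g e)) = -1 \<and> f (node m e (g e)) = 1"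
    by (rule bchoice[THEN exE])
  have "inj_on (\<lambda>e. node m e (g e)) ?E" using node_inject by (intro inj_onI) blast
  moreover have "(\<lambda>e. node m e (g e)) ` ?E \<subseteq> {q \<in> {- M..M}. hd q = -1 \<and> f q = 1}"
  proof
    fix q assume "q \<in> (\<lambda>e. node m e (g e)) ` ?E"
    then obtain e where e: "e \<in> ?E" "q = node m e (g e)" by blast
    then have "1 \<le> q \<and> q \<le> M" using node_bounds[of e "g e"] g by blast
    then show "q \<in> {q \<in> {- M..M}. hd q = -1 \<and> f q = 1}" using e g by auto
  qed
  ultimately have "card ?E \<le> card {q \<in> {- M..M}. hd q = -1 \<and> f q = 1}"
    by (rule card_inj_on_le) (auto intro: finite_subset[of _ "{- M..M}"])
  then show ?thesis using assms by (simp add: tolerant_flow_def)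
qed

end

section \<open>Reasoning about programs\<close>

notation Seq (infixr ";;" 60)

text \<open>The number \<open>T\<close> is the time already spent. With this accumulator the rules
  in \<open>wp_simps\<close> are equations, and simplification computes the effect and the cost of
  loop-free code together.\<close>

definition wp :: "com \<Rightarrow> (store \<Rightarrow> nat \<Rightarrow> bool) \<Rightarrow> store \<Rightarrow> nat \<Rightarrow> bool" where
  "wp c Q \<sigma> T \<longleftrightarrow> (\<exists>T' \<sigma>'. exec c \<sigma> T' \<sigma>' \<and> Q \<sigma>' (T + T'))"

definition runs :: "com \<Rightarrow> store \<Rightarrow> nat \<Rightarrow> (store \<Rightarrow> bool) \<Rightarrow> bool" where
  "runs c \<sigma> b R \<longleftrightarrow> (\<exists>T \<sigma>'. exec c \<sigma> T \<sigma>' \<and> T \<le> b \<and> R \<sigma>')"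

lemma runs_wp: "runs c \<sigma> b R \<longleftrightarrow> wp c (\<lambda>\<sigma>' T. T \<le> b \<and> R \<sigma>') \<sigma> 0"
  by (simp add: runs_def wp_def)

lemma wp_Skip: "wp Skip Q \<sigma> T \<longleftrightarrow> Q \<sigma> (Suc T)"
  unfolding wp_def by (metis exec_SkipE exec.Skip Suc_eq_plus1)

lemma wp_Assign:
  "wp (Assign x e) Q \<sigma> T \<longleftrightarrow> Q (\<sigma>\<lparr>reg := (reg \<sigma>)(x := aval e \<sigma>)\<rparr>) (T + (acost e + 1))"
  unfolding wp_def by (metis exec_AssignE exec.Assign)

lemma wp_Put:
  "wp (Put x i e) Q \<sigma> T \<longleftrightarrow>
    Q (\<sigma>\<lparr>arr := (arr \<sigma>)(x := (arr \<sigma> x)(aval i \<sigma> := aval e \<sigma>))\<rparr>) (T + (acost i + acost e + 1))"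
  unfolding wp_def by (metis exec_PutE exec.Put)

lemma wp_Seq: "wp (c1 ;; c2) Q \<sigma> T \<longleftrightarrow> wp c1 (wp c2 Q) \<sigma> T"
proof
  assume "wp (c1 ;; c2) Q \<sigma> T"
  then obtain T' \<sigma>' where e: "exec (c1 ;; c2) \<sigma> T' \<sigma>'" and q: "Q \<sigma>' (T + T')"
    unfolding wp_def by blast
  from e obtain T1 T2 \<sigma>1 where "T' = T1 + T2" "exec c1 \<sigma> T1 \<sigma>1" "exec c2 \<sigma>1 T2 \<sigma>'"
    by (rule exec_SeqE)
  with q show "wp c1 (wp c2 Q) \<sigma> T" unfolding wp_def by (metis add.assoc)
next
  assume "wp c1 (wp c2 Q) \<sigma> T"
  then obtain T1 \<sigma>1 T2 \<sigma>2 where "exec c1 \<sigma> T1 \<sigma>1" "exec c2 \<sigma>1 T2 \<sigma>2" "Q \<sigma>2 (T + T1 + T2)"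
    unfolding wp_def by blast
  then show "wp (c1 ;; c2) Q \<sigma> T" unfolding wp_def by (metis exec.Seq add.assoc)
qed

lemma wp_Cond:
  "wp (Cond b c1 c2) Q \<sigma> T \<longleftrightarrow>
    (if bval b \<sigma> then wp c1 Q \<sigma> (T + bcost b) else wp c2 Q \<sigma> (T + bcost b))"
proof (cases "bval b \<sigma>")
  case True
  then show ?thesis unfolding wp_def by (metis exec_CondE exec.CondTrue add.assoc)
next
  case False
  then show ?thesis unfolding wp_def by (metis exec_CondE exec.CondFalse add.assoc)
qed

lemmas wp_simps = wp_Skip wp_Assign wp_Put wp_Seq wp_Cond

lemma runs_mono: "runs c \<sigma> b R \<Longrightarrow> b \<le> b' \<Longrightarrow> (\<And>\<sigma>'. R \<sigma>' \<Longrightarrow> R' \<sigma>') \<Longrightarrow> runs c \<sigma> b' R'"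
  unfolding runs_def by (meson order_trans)

lemma runs_Seq:
  assumes "runs c1 \<sigma> b1 R1" "\<And>\<sigma>1. R1 \<sigma>1 \<Longrightarrow> runs c2 \<sigma>1 b2 R2"
  shows "runs (c1 ;; c2) \<sigma> (b1 + b2) R2"
proof -
  obtain T1 \<sigma>1 where 1: "exec c1 \<sigma> T1 \<sigma>1" "T1 \<le> b1" "R1 \<sigma>1" using assms(1) unfolding runs_def by blast
  obtain T2 \<sigma>2 where 2: "exec c2 \<sigma>1 T2 \<sigma>2" "T2 \<le> b2" "R2 \<sigma>2"
    using assms(2)[OF 1(3)] unfolding runs_def by blast
  show ?thesis unfolding runs_def
    using exec.Seq[OF 1(1) 2(1)] 1(2) 2(2,3) by (intro exI[of _ "T1 + T2"] exI[of _ \<sigma>2]) simp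
qed

section \<open>Frame conditions and counting loops\<close>

fun regs_written :: "com \<Rightarrow> nat set" where
  "regs_written Skip = {}"
| "regs_written (Assign x e) = {x}"
| "regs_written (Put x i e) = {}"
| "regs_written (c1 ;; c2) = regs_written c1 \<union> regs_written c2"
| "regs_written (Cond b c1 c2) = regs_written c1 \<union> regs_written c2"
| "regs_written (While b c) = regs_written c"

fun arrs_written :: "com \<Rightarrow> nat set" where
  "arrs_written Skip = {}"
| "arrs_written (Assign x e) = {}"
| "arrs_written (Put x i e) = {x}"
| "arrs_written (c1 ;; c2) = arrs_written c1 \<union> arrs_written c2"
| "arrs_written (Cond b c1 c2) = arrs_written c1 \<union> arrs_written c2"
| "arrs_written (While b c) = arrs_written c"

definition agree :: "nat set \<Rightarrow> nat set \<Rightarrow> store \<Rightarrow> store \<Rightarrow> bool" where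
  "agree R A \<sigma> \<sigma>' \<longleftrightarrow> (\<forall>x. x \<notin> R \<longrightarrow> reg \<sigma>' x = reg \<sigma> x) \<and> (\<forall>x. x \<notin> A \<longrightarrow> arr \<sigma>' x = arr \<sigma> x)"

abbreviation framed :: "com \<Rightarrow> store \<Rightarrow> store \<Rightarrow> bool" where
  "framed c \<equiv> agree (regs_written c) (arrs_written c)"

abbreviation loop_framed :: "nat \<Rightarrow> com \<Rightarrow> store \<Rightarrow> store \<Rightarrow> bool" where
  "loop_framed x c \<equiv> agree (insert x (regs_written c)) (arrs_written c)"

lemma agreeD:
  assumes "agree R A \<sigma> \<sigma>'"
  shows "x \<notin> R \<Longrightarrow> reg \<sigma>' x = reg \<sigma> x" "y \<notin> A \<Longrightarrow> arr \<sigma>' y = arr \<sigma> y"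
  using assms by (auto simp: agree_def)

lemma agree_disjoint:
  assumes "agree R A \<sigma> \<sigma>'"
  shows "R \<inter> X = {} \<Longrightarrow> \<forall>x\<in>X. reg \<sigma>' x = reg \<sigma> x" "A \<inter> Y = {} \<Longrightarrow> \<forall>y\<in>Y. arr \<sigma>' y = arr \<sigma> y"
  using assms by (auto simp: agree_def)

lemma agree_trans: "agree R A \<sigma> \<sigma>' \<Longrightarrow> agree R A \<sigma>' \<sigma>'' \<Longrightarrow> agree R A \<sigma> \<sigma>''"
  by (auto simp: agree_def)

lemma agree_mono: "agree R A \<sigma> \<sigma>' \<Longrightarrow> R \<subseteq> R' \<Longrightarrow> A \<subseteq> A' \<Longrightarrow> agree R' A' \<sigma> \<sigma>'"
  by (auto simp: agree_def)

lemma exec_agree: "exec c \<sigma> T \<sigma>' \<Longrightarrow> framed c \<sigma> \<sigma>'"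
  by (induction rule: exec.induct) (auto simp: agree_def)

lemma runs_agree:
  "runs c \<sigma> b R \<Longrightarrow> runs c \<sigma> b (\<lambda>\<sigma>'. R \<sigma>' \<and> framed c \<sigma> \<sigma>')"
  unfolding runs_def using exec_agree by blast

definition For :: "nat \<Rightarrow> aexp \<Rightarrow> aexp \<Rightarrow> com \<Rightarrow> com" where
  "For x lo hi c =
     Assign x lo ;; While (Less (Reg x) hi) (c ;; Assign x (Plus (Reg x) (Const 1)))"

text \<open>The 3 is 1 for the initial assignment and 2 for the final test, apart from the
  evaluation of the bounds; the 6 is 2 for a test and 4 for an increment of the counter.\<close>

abbreviation for_cost :: "aexp \<Rightarrow> aexp \<Rightarrow> int \<Rightarrow> nat \<Rightarrow> nat" where
  "for_cost lo hi r b \<equiv> acost lo + acost hi + 3 + nat r * (b + acost hi + 6)"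

lemma regs_written_For [simp]: "regs_written (For x lo hi c) = insert x (regs_written c)"
  and arrs_written_For [simp]: "arrs_written (For x lo hi c) = arrs_written c"
  by (auto simp: For_def)

text \<open>The invariant receives the loop counter as an argument, and must not mention its register.\<close>

lemma runs_For:
  fixes I :: "int \<Rightarrow> store \<Rightarrow> bool" and c :: com and x :: nat
  defines "F \<equiv> loop_framed x c"
  assumes x: "x \<notin> regs_written c"
    and init: "I (aval lo \<sigma>) \<sigma>"
    and lo: "a = aval lo \<sigma>" and hi: "\<And>\<sigma>'. F \<sigma> \<sigma>' \<Longrightarrow> aval hi \<sigma>' = h" and le: "a \<le> h"
    and indep: "\<And>i \<sigma>' v. I i \<sigma>' \<Longrightarrow> I i (\<sigma>'\<lparr>reg := (reg \<sigma>')(x := v)\<rparr>)"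
    and body: "\<And>i \<sigma>'. a \<le> i \<Longrightarrow> i < h \<Longrightarrow> reg \<sigma>' x = i \<Longrightarrow> F \<sigma> \<sigma>' \<Longrightarrow> I i \<sigma>' \<Longrightarrow>
        runs c \<sigma>' b (I (i + 1))"
  shows "runs (For x lo hi c) \<sigma> (for_cost lo hi (h - a) (b)) (I h)"
proof -
  let ?w = "While (Less (Reg x) hi) (c ;; Assign x (Plus (Reg x) (Const 1)))"
  have loop: "runs ?w \<sigma>' (acost hi + 2 + nat (h - i) * (b + acost hi + 6)) (I h)"
    if "a \<le> i" "i \<le> h" "reg \<sigma>' x = i" "F \<sigma> \<sigma>'" "I i \<sigma>'" for i \<sigma>'
    using that
  proof (induction "nat (h - i)" arbitrary: i \<sigma>' rule: less_induct)
    case less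
    have hi': "aval hi \<sigma>' = h" using hi less.prems by blast
    show ?case
    proof (cases "i < h")
      case False
      then have "i = h" using less.prems by simp
      moreover have "exec ?w \<sigma>' (bcost (Less (Reg x) hi)) \<sigma>'"
        using hi' less.prems False by (intro exec.WhileFalse) simp
      ultimately show ?thesis using less.prems unfolding runs_def by fastforce
    next
      case True
      obtain T1 \<sigma>1 where 1: "exec c \<sigma>' T1 \<sigma>1" "T1 \<le> b" "I (i + 1) \<sigma>1"
        using body[OF _ True] less.prems unfolding runs_def by blast
      define \<sigma>2 where "\<sigma>2 = \<sigma>1\<lparr>reg := (reg \<sigma>1)(x := i + 1)\<rparr>"
      have ag: "framed c \<sigma>' \<sigma>1" using exec_agree 1 by blast
      have x1: "reg \<sigma>1 x = i" using agreeD(1)[OF ag x] less.prems by simp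
      then have "exec (Assign x (Plus (Reg x) (Const 1))) \<sigma>1 4 \<sigma>2"
        using exec.Assign[of x "Plus (Reg x) (Const 1)" \<sigma>1] by (simp add: \<sigma>2_def eval_nat_numeral)
      then have body': "exec (c ;; Assign x (Plus (Reg x) (Const 1))) \<sigma>' (T1 + 4) \<sigma>2"
        using 1 exec.Seq by blast
      have I2: "I (i + 1) \<sigma>2" using indep[OF 1(3)] by (simp add: \<sigma>2_def)
      have "F \<sigma> \<sigma>2" using less.prems(4) ag unfolding F_def agree_def \<sigma>2_def by auto
      then obtain T2 \<sigma>3 where 2: "exec ?w \<sigma>2 T2 \<sigma>3" "I h \<sigma>3"
        "T2 \<le> acost hi + 2 + nat (h - (i + 1)) * (b + acost hi + 6)"
        using less.hyps[of "i + 1" \<sigma>2] less.prems True I2 unfolding runs_def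
        by (auto simp: \<sigma>2_def)
      have "exec ?w \<sigma>' (bcost (Less (Reg x) hi) + (T1 + 4) + T2) \<sigma>3"
        using hi' less.prems True body' 2 by (intro exec.WhileTrue) auto
      moreover have "nat (h - i) = Suc (nat (h - (i + 1)))" using True by simp
      ultimately show ?thesis using 1 2 unfolding runs_def by fastforce
    qed
  qed
  define \<sigma>0 where "\<sigma>0 = \<sigma>\<lparr>reg := (reg \<sigma>)(x := a)\<rparr>"
  have "F \<sigma> \<sigma>0" by (auto simp: F_def \<sigma>0_def agree_def)
  moreover have "I a \<sigma>0" using indep[OF init] lo by (simp add: \<sigma>0_def)
  ultimately obtain T \<sigma>' where "exec ?w \<sigma>0 T \<sigma>'" "I h \<sigma>'"
    "T \<le> acost hi + 2 + nat (h - a) * (b + acost hi + 6)"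
    using loop[of a \<sigma>0] le unfolding runs_def by (auto simp: \<sigma>0_def)
  moreover have "exec (Assign x lo) \<sigma> (acost lo + 1) \<sigma>0" using exec.Assign lo by (simp add: \<sigma>0_def)
  ultimately show ?thesis unfolding runs_def For_def
    using exec.Seq by (intro exI[of _ "acost lo + 1 + T"] exI[of _ \<sigma>']) force
qed

section \<open>Maximum flows by repeated search\<close>

text \<open>Capacities are one, so each arc has exactly one residual arc: forwards if it is empty,
  backwards if it carries flow. It runs from \<open>rfrom\<close> to \<open>rto\<close>.\<close>

definition rfrom :: "(int \<Rightarrow> int) \<Rightarrow> (int \<Rightarrow> int) \<Rightarrow> int \<Rightarrow> int" where
  "rfrom f h q = (if f q = 0 then \<bar>q\<bar> else h q)"

definition rto :: "(int \<Rightarrow> int) \<Rightarrow> (int \<Rightarrow> int) \<Rightarrow> int \<Rightarrow> int" where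
  "rto f h q = (if f q = 0 then h q else \<bar>q\<bar>)"

text \<open>Registers: 7 holds the number \<open>M\<close> of nodes apart from source and sink. Arrays: 11 and 12
  hold tails and heads, 13 the flow, 14 the source set, 15 the distance to the sink plus one for
  the nodes that the search has found, and 16 their first arcs on a path to the sink.\<close>

definition holds_network :: "int \<Rightarrow> (int \<Rightarrow> int) \<Rightarrow> store \<Rightarrow> bool" where
  "holds_network M h \<sigma> \<longleftrightarrow> 0 \<le> M \<and> reg \<sigma> 7 = M \<and>
     (\<forall>q\<in>{- M..M}. arr \<sigma> 11 q = \<bar>q\<bar> \<and> arr \<sigma> 12 q = h q \<and> -1 \<le> h q \<and> h q \<le> M)"

lemma holds_network_agree:
  "holds_network M h \<sigma> \<Longrightarrow> agree R A \<sigma> \<sigma>' \<Longrightarrow> 7 \<notin> R \<Longrightarrow> 11 \<notin> A \<Longrightarrow> 12 \<notin> A \<Longrightarrow>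
    holds_network M h \<sigma>'"
  by (simp add: holds_network_def agree_def)

definition scan_arc :: com where
  "scan_arc =
     Cond (Less (Const 0) (Get 13 (Reg 20)))
       (Assign 21 (Get 12 (Reg 20)) ;; Assign 22 (Get 11 (Reg 20)))
       (Assign 21 (Get 11 (Reg 20)) ;; Assign 22 (Get 12 (Reg 20))) ;;
     Cond (Conj (Less (Get 15 (Reg 21)) (Const 1)) (Less (Const 0) (Get 15 (Reg 22))))
       (Put 15 (Reg 21) (Plus (Get 15 (Reg 22)) (Const 1)) ;; Put 16 (Reg 21) (Reg 20))
       Skip"

definition for_arcs :: "com \<Rightarrow> com" where
  "for_arcs c = For 20 (Minus (Const 0) (Reg 7)) (Plus (Reg 7) (Const 1)) c"

text \<open>There is no queue. A sweep over all arcs that marks nothing proves that the marked set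
  is closed, and with the \<open>M + 2\<close> nodes from \<open>-1\<close> to \<open>M\<close>
  there can be at most \<open>M + 2\<close> sweeps before this happens.\<close>

definition search :: com where
  "search =
     For 21 (Const (-1)) (Plus (Reg 7) (Const 1)) (Put 15 (Reg 21) (Const 0)) ;;
     Put 15 (Const (-1)) (Const 1) ;;
     For 19 (Const 0) (Plus (Reg 7) (Const 2)) (for_arcs scan_arc)"

context
  fixes M :: int and h :: "int \<Rightarrow> int" and f :: "int \<Rightarrow> int"
begin

definition marked :: "(int \<Rightarrow> int) \<Rightarrow> int set" where
  "marked B = {v \<in> {-1..M}. B v \<noteq> 0}"

definition closed_marks :: "(int \<Rightarrow> int) \<Rightarrow> int set \<Rightarrow> bool" where
  "closed_marks B E \<longleftrightarrow> (\<forall>q\<in>E. B (rto f h q) \<noteq> 0 \<longrightarrow> B (rfrom f h q) \<noteq> 0)"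

text \<open>The labels are lengths of particular paths and need not be shortest. What matters is
  that they drop by one along \<open>NX\<close>, which makes them ranks, and that they are at most
  the number of marked nodes, which bounds the length of an augmenting path.\<close>

definition sound_marks :: "(int \<Rightarrow> int) \<Rightarrow> (int \<Rightarrow> int) \<Rightarrow> bool" where
  "sound_marks B NX \<longleftrightarrow> B (-1) = 1 \<and> (\<forall>v\<in>{-1..M}. 0 \<le> B v \<and> B v \<le> int (card (marked B))) \<and>
     (\<forall>v\<in>{0..M}. B v \<noteq> 0 \<longrightarrow> NX v \<in> {- M..M} \<and> rfrom f h (NX v) = v \<and>
        0 < B (rto f h (NX v)) \<and> B v = B (rto f h (NX v)) + 1)"

lemma finite_marked [simp]: "finite (marked B)"
  by (rule finite_subset[of _ "{-1..M}"]) (auto simp: marked_def)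

lemma card_marked: "0 \<le> M \<Longrightarrow> int (card (marked B)) \<le> M + 2"
proof -
  assume "0 \<le> M"
  have "card (marked B) \<le> card {-1..M}" by (intro card_mono) (auto simp: marked_def)
  then show ?thesis using \<open>0 \<le> M\<close> by simp
qed

lemma sound_marks_extend:
  assumes s: "sound_marks B NX" and q: "q \<in> {- M..M}" and f0: "B (rfrom f h q) = 0"
    and t0: "0 < B (rto f h q)" and h: "-1 \<le> h q" "h q \<le> M"
  defines "B' \<equiv> B(rfrom f h q := B (rto f h q) + 1)"
  shows "sound_marks B' (NX(rfrom f h q := q))" "card (marked B') = Suc (card (marked B))"
proof -
  let ?x = "rfrom f h q" and ?y = "rto f h q"
  have range: "?x \<in> {-1..M}" "?y \<in> {-1..M}" using q h by (auto simp: rfrom_def rto_def)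
  have xs: "?x \<noteq> -1" "?x \<noteq> ?y" using s f0 t0 by (auto simp: sound_marks_def)
  have "marked B' = insert ?x (marked B)" "?x \<notin> marked B"
    using range f0 t0 by (auto simp: marked_def B'_def)
  then show c: "card (marked B') = Suc (card (marked B))" by simp
  have "B ?y \<le> int (card (marked B))" using s range by (auto simp: sound_marks_def)
  then have bd: "0 \<le> B' v \<and> B' v \<le> int (card (marked B'))" if "v \<in> {-1..M}" for v
    using s that t0 c by (auto simp: sound_marks_def B'_def dest!: bspec[of _ _ v])
  have "(NX(?x := q)) v \<in> {- M..M} \<and> rfrom f h ((NX(?x := q)) v) = v \<and>
        0 < B' (rto f h ((NX(?x := q)) v)) \<and> B' v = B' (rto f h ((NX(?x := q)) v)) + 1"
    if v: "v \<in> {0..M}" "B' v \<noteq> 0" for v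
  proof (cases "v = ?x")
    case True
    then show ?thesis using q t0 xs by (auto simp: B'_def)
  next
    case False
    then have "B v \<noteq> 0" using v by (simp add: B'_def)
    then have "NX v \<in> {- M..M} \<and> rfrom f h (NX v) = v \<and>
        0 < B (rto f h (NX v)) \<and> B v = B (rto f h (NX v)) + 1"
      using s v by (auto simp: sound_marks_def)
    \<comment> \<open>The node that an older pointer leads to is already marked, whereas
      \<open>?x\<close> was unmarked; so no old label is disturbed.\<close>
    moreover from this have "rto f h (NX v) \<noteq> ?x" using f0 by auto
    ultimately show ?thesis using False by (simp add: B'_def)
  qed
  then show "sound_marks B' (NX(?x := q))"
    using bd s xs by (simp add: sound_marks_def B'_def)
qed

lemma runs_scan_arcs:
  assumes net: "holds_network M h \<sigma>" and f: "f = arr \<sigma> 13" "\<And>q. q \<in> {- M..M} \<Longrightarrow> f q = 0 \<or> f q = 1"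
    and s: "sound_marks (arr \<sigma> 15) (arr \<sigma> 16)"
    and pre: "closed_marks (arr \<sigma> 15) {- M..M} \<or> i < card (marked (arr \<sigma> 15))"
  shows "runs (for_arcs scan_arc) \<sigma> (100 * nat (M + 1)) (\<lambda>\<sigma>'.
    sound_marks (arr \<sigma>' 15) (arr \<sigma>' 16) \<and>
    (closed_marks (arr \<sigma>' 15) {- M..M} \<or> Suc i < card (marked (arr \<sigma>' 15))))"
proof -
  \<comment> \<open>Within a sweep there are three situations: the set was closed from the start,
    the sweep has already marked a new node, or it has marked none and the arcs scanned so far obey
    closedness.\<close>
  let ?I = "\<lambda>q \<sigma>'. sound_marks (arr \<sigma>' 15) (arr \<sigma>' 16) \<and>
    (closed_marks (arr \<sigma>' 15) {- M..M} \<or> Suc i < card (marked (arr \<sigma>' 15)) \<or>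
     i < card (marked (arr \<sigma>' 15)) \<and> closed_marks (arr \<sigma>' 15) {- M..<q})"
  have M: "0 \<le> M" "reg \<sigma> 7 = M" using net by (auto simp: holds_network_def)
  have "runs (for_arcs scan_arc) \<sigma> (for_cost (Minus (Const 0) (Reg 7)) (Plus (Reg 7) (Const 1)) (M + 1 - (- M)) 30) (?I (M + 1))"
    unfolding for_arcs_def
  proof (rule runs_For)
    show "?I (aval (Minus (Const 0) (Reg 7)) \<sigma>) \<sigma>"
      using s pre M by (auto simp: closed_marks_def)
    show "- M = aval (Minus (Const 0) (Reg 7)) \<sigma>" using M by simp
    show "- M \<le> M + 1" using M by simp
  next
    fix \<sigma>' assume "loop_framed 20 scan_arc \<sigma> \<sigma>'"
    then show "aval (Plus (Reg 7) (Const 1)) \<sigma>' = M + 1"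
      using M by (simp add: agree_def scan_arc_def)
  next
    fix q \<sigma>'
    assume q: "- M \<le> q" "q < M + 1" "reg \<sigma>' 20 = q"
      and ag: "loop_framed 20 scan_arc \<sigma> \<sigma>'"
      and I: "?I q \<sigma>'"
    have "holds_network M h \<sigma>'"
      using holds_network_agree[OF net ag] by (simp add: scan_arc_def)
    then have n: "arr \<sigma>' 11 q = \<bar>q\<bar>" "arr \<sigma>' 12 q = h q" "-1 \<le> h q" "h q \<le> M"
      using q by (auto simp: holds_network_def)
    have f': "arr \<sigma>' 13 = f" using ag f by (simp add: agree_def scan_arc_def)
    define B NX where "B = arr \<sigma>' 15" and "NX = arr \<sigma>' 16"
    let ?x = "rfrom f h q" and ?y = "rto f h q"
    have qE: "q \<in> {- M..M}" using q by simp
    have range: "?x \<in> {-1..M}" "?y \<in> {-1..M}" using qE n by (auto simp: rfrom_def rto_def)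
    have nn: "0 \<le> B ?x" "0 \<le> B ?y" using I range unfolding sound_marks_def B_def by blast+
    have split: "{- M..<q + 1} = insert q {- M..<q}" using q by auto
    have mark: "?I (q + 1) (\<sigma>'\<lparr>reg := r, arr := (arr \<sigma>')(15 := B(?x := B ?y + 1), 16 := NX(?x := q))\<rparr>)"
      if "B ?x = 0" "0 < B ?y" for r
    proof -
      \<comment> \<open>The arc \<open>q\<close> about to be used is itself a violation of
        closedness, so only the other two situations remain, and both provide the count.\<close>
      have "\<not> closed_marks B {- M..M}" using that qE unfolding closed_marks_def by force
      then have "i < card (marked B)" using I by (auto simp: B_def)
      then show ?thesis
        using sound_marks_extend[of B NX q] I that qE n by (simp add: B_def NX_def)
    qed
    have skip: "?I (q + 1) (\<sigma>'\<lparr>reg := r\<rparr>)" if "\<not> (B ?x < 1 \<and> 0 < B ?y)" for r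
    proof -
      have "B ?y \<noteq> 0 \<longrightarrow> B ?x \<noteq> 0" using that nn by auto
      then show ?thesis using I unfolding split by (auto simp: B_def closed_marks_def)
    qed
    have xy: "f q = 0 \<and> ?x = \<bar>q\<bar> \<and> ?y = h q \<or> f q = 1 \<and> ?x = h q \<and> ?y = \<bar>q\<bar>"
      using f(2)[OF qE] by (auto simp: rfrom_def rto_def)
    note run = runs_wp scan_arc_def wp_simps
    show "runs scan_arc \<sigma>' 30 (?I (q + 1))"
    proof (cases "B ?x < 1 \<and> 0 < B ?y")
      case True
      then have "B ?x = 0" "0 < B ?y" using nn by auto
      note mark' = mark[OF this]
      from xy show ?thesis
      proof (elim disjE conjE)
        assume c: "f q = 0" "?x = \<bar>q\<bar>" "?y = h q"
        show ?thesis using mark' True n f' q unfolding c(2,3)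
          by (simp add: run c B_def[symmetric] NX_def[symmetric])
      next
        assume c: "f q = 1" "?x = h q" "?y = \<bar>q\<bar>"
        show ?thesis using mark' True n f' q unfolding c(2,3)
          by (simp add: run c B_def[symmetric] NX_def[symmetric])
      qed
    next
      case False
      note skip' = skip[OF False]
      from xy show ?thesis
      proof (elim disjE conjE)
        assume c: "f q = 0" "?x = \<bar>q\<bar>" "?y = h q"
        show ?thesis using skip' False n f' q unfolding c(2,3)
          by (simp add: run c B_def[symmetric] NX_def[symmetric]) blast
      next
        assume c: "f q = 1" "?x = h q" "?y = \<bar>q\<bar>"
        show ?thesis using skip' False n f' q unfolding c(2,3)
          by (simp add: run c B_def[symmetric] NX_def[symmetric]) blast
      qed
    qed
  qed (auto simp: scan_arc_def)
  then show ?thesis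
  proof (rule runs_mono)
    show "for_cost (Minus (Const 0) (Reg 7)) (Plus (Reg 7) (Const 1)) (M + 1 - (- M)) 30 \<le> 100 * nat (M + 1)"
      using M by simp
  qed (auto simp: closed_marks_def)
qed

definition searched :: "store \<Rightarrow> bool" where
  "searched \<sigma> \<longleftrightarrow> sound_marks (arr \<sigma> 15) (arr \<sigma> 16) \<and> closed_marks (arr \<sigma> 15) {- M..M}"

lemma runs_search:
  assumes net: "holds_network M h \<sigma>" and f: "f = arr \<sigma> 13" "\<And>q. q \<in> {- M..M} \<Longrightarrow> f q = 0 \<or> f q = 1"
  shows "runs search \<sigma> (250 * nat (M + 1) * nat (M + 2)) searched"
proof -
  have M: "0 \<le> M" "reg \<sigma> 7 = M" using net by (auto simp: holds_network_def)
  let ?b1 = "for_cost (Const (-1)) (Plus (Reg 7) (Const 1)) (M + 1 - (-1)) 3"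
  have 1: "runs (For 21 (Const (-1)) (Plus (Reg 7) (Const 1)) (Put 15 (Reg 21) (Const 0))) \<sigma> ?b1
    (\<lambda>\<sigma>'. \<forall>v\<in>{-1..<M + 1}. arr \<sigma>' 15 v = 0)"
    by (rule runs_For) (use M in \<open>auto simp: agree_def runs_wp wp_simps\<close>)
  let ?b3 = "for_cost (Const 0) (Plus (Reg 7) (Const 2)) (M + 2 - 0) (100 * nat (M + 1))"
  have "runs search \<sigma> (?b1 + (3 + ?b3)) searched"
    unfolding search_def
  proof (rule runs_Seq[OF runs_agree[OF 1]], elim conjE)
    fix \<sigma>1 assume z: "\<forall>v\<in>{-1..<M + 1}. arr \<sigma>1 15 v = 0"
      and a1: "framed (For 21 (Const (-1)) (Plus (Reg 7) (Const 1)) (Put 15 (Reg 21) (Const 0))) \<sigma> \<sigma>1"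
    let ?\<sigma>2 = "\<sigma>1\<lparr>arr := (arr \<sigma>1)(15 := (arr \<sigma>1 15)(-1 := 1))\<rparr>"
    have a2: "agree {21} {15} \<sigma> ?\<sigma>2" using a1 by (simp add: agree_def)
    have "marked (arr ?\<sigma>2 15) = {-1}" using z M by (auto simp: marked_def)
    then have init: "sound_marks (arr ?\<sigma>2 15) (arr ?\<sigma>2 16)" "0 < card (marked (arr ?\<sigma>2 15))"
      using z by (auto simp: sound_marks_def)
    let ?I = "\<lambda>i \<sigma>'. sound_marks (arr \<sigma>' 15) (arr \<sigma>' 16) \<and>
      (closed_marks (arr \<sigma>' 15) {- M..M} \<or> i < int (card (marked (arr \<sigma>' 15))))"
    have 3: "runs (For 19 (Const 0) (Plus (Reg 7) (Const 2)) (for_arcs scan_arc)) ?\<sigma>2 ?b3 (?I (M + 2))"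
    proof (rule runs_For)
      show "?I (aval (Const 0) ?\<sigma>2) ?\<sigma>2" using init by simp
      fix i \<sigma>'
      assume i: "0 \<le> i" and I: "?I i \<sigma>'"
        and ag: "loop_framed 19 (for_arcs scan_arc) ?\<sigma>2 \<sigma>'"
      have ag': "agree {19,20,21,22} {15,16} \<sigma> \<sigma>'"
        by (rule agree_trans[OF agree_mono[OF a2] agree_mono[OF ag]])
          (auto simp: for_arcs_def scan_arc_def)
      have "runs (for_arcs scan_arc) \<sigma>' (100 * nat (M + 1)) (\<lambda>\<sigma>'.
          sound_marks (arr \<sigma>' 15) (arr \<sigma>' 16) \<and>
          (closed_marks (arr \<sigma>' 15) {- M..M} \<or> Suc (nat i) < card (marked (arr \<sigma>' 15))))"
        using holds_network_agree[OF net ag'] f agreeD(2)[OF ag', of 13] I i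
        by (intro runs_scan_arcs) auto
      then show "runs (for_arcs scan_arc) \<sigma>' (100 * nat (M + 1)) (?I (i + 1))"
        by (rule runs_mono) (use i in auto)
    next
      fix \<sigma>'
      assume "loop_framed 19 (for_arcs scan_arc) ?\<sigma>2 \<sigma>'"
      then show "aval (Plus (Reg 7) (Const 2)) \<sigma>' = M + 2"
        using M a2 by (simp add: agree_def for_arcs_def scan_arc_def)
    qed (use M in \<open>auto simp: for_arcs_def scan_arc_def\<close>)
    \<comment> \<open>More marked nodes than nodes is absurd, so after the last sweep only
      closedness is left of the invariant.\<close>
    have "\<not> M + 2 < int (card (marked B))" for B using card_marked[OF M(1), of B] by simp
    then have r3: "runs (For 19 (Const 0) (Plus (Reg 7) (Const 2)) (for_arcs scan_arc)) ?\<sigma>2 ?b3 searched"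
      by (intro runs_mono[OF 3]) (auto simp: searched_def)
    have 2: "runs (Put 15 (Const (-1)) (Const 1)) \<sigma>1 3 (\<lambda>\<sigma>'. \<sigma>' = ?\<sigma>2)"
      by (simp add: runs_wp wp_simps)
    show "runs (Put 15 (Const (-1)) (Const 1) ;;
        For 19 (Const 0) (Plus (Reg 7) (Const 2)) (for_arcs scan_arc)) \<sigma>1 (3 + ?b3) searched"
      by (rule runs_Seq[OF 2]) (use r3 in simp)
  qed
  then show ?thesis
  proof (rule runs_mono)
    obtain a where a: "M = int a" using M nonneg_int_cases by blast
    have "?b1 + (3 + ?b3) = 17 + (a + 2) * 12 + (a + 2) * (100 * (a + 1) + 9)"
      by (simp add: a nat_add_distrib)
    also have "\<dots> \<le> 250 * (a + 1) * (a + 2)" by (simp add: algebra_simps)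
    finally show "?b1 + (3 + ?b3) \<le> 250 * nat (M + 1) * nat (M + 2)"
      by (simp add: a nat_add_distrib)
  qed
qed

end

text \<open>If no source is marked, register 23 keeps the value \<open>-1\<close>. This is the sink,
  where every augmenting path ends, so the following \<open>push\<close> leaves the flow as it
  is.\<close>

definition find_node :: com where
  "find_node =
     Assign 23 (Const (-1)) ;;
     For 21 (Const 0) (Plus (Reg 7) (Const 1))
       (Cond (Conj (Less (Const 0) (Get 14 (Reg 21))) (Less (Const 0) (Get 15 (Reg 21))))
         (Assign 23 (Reg 21)) Skip)"

definition push_step :: com where
  "push_step =
     Cond (Less (Const (-1)) (Reg 23))
       (Assign 20 (Get 16 (Reg 23)) ;;
        Cond (Less (Const 0) (Get 13 (Reg 20)))
          (Assign 23 (Get 11 (Reg 20)) ;; Put 13 (Reg 20) (Const 0))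
          (Assign 23 (Get 12 (Reg 20)) ;; Put 13 (Reg 20) (Const 1)))
       Skip"

text \<open>The number of steps is fixed in advance: labels are at most \<open>M + 2\<close>, and
  once the sink is reached the remaining steps are idle.\<close>

definition push :: com where
  "push = For 21 (Const 0) (Plus (Reg 7) (Const 2)) push_step"

definition augment :: com where
  "augment = search ;; find_node ;; push"

text \<open>Integers that are not nodes are counted among the sources; they are isolated.\<close>

definition sources :: "int \<Rightarrow> store \<Rightarrow> int set" where
  "sources M \<sigma> = {v. v \<noteq> -1 \<and> (v \<in> {0..M} \<longrightarrow> 0 < arr \<sigma> 14 v)}"

lemma runs_find_node:
  assumes M: "0 \<le> M" "reg \<sigma> 7 = M"
  shows "runs find_node \<sigma> (40 * nat (M + 1)) (\<lambda>\<sigma>'.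
    reg \<sigma>' 23 = -1 \<and> (\<forall>v\<in>{0..M}. arr \<sigma> 15 v \<le> 0 \<or> v \<notin> sources M \<sigma>) \<or>
    reg \<sigma>' 23 \<in> {0..M} \<inter> sources M \<sigma> \<and> 0 < arr \<sigma> 15 (reg \<sigma>' 23))"
proof -
  let ?I = "\<lambda>i \<sigma>'. reg \<sigma>' 23 = -1 \<and> (\<forall>v\<in>{0..<i}. arr \<sigma> 15 v \<le> 0 \<or> v \<notin> sources M \<sigma>) \<or>
    reg \<sigma>' 23 \<in> {0..M} \<inter> sources M \<sigma> \<and> 0 < arr \<sigma> 15 (reg \<sigma>' 23)"
  let ?c = "Cond (Conj (Less (Const 0) (Get 14 (Reg 21))) (Less (Const 0) (Get 15 (Reg 21))))
         (Assign 23 (Reg 21)) Skip"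
  let ?\<sigma> = "\<sigma>\<lparr>reg := (reg \<sigma>)(23 := -1)\<rparr>"
  have 1: "runs (Assign 23 (Const (-1))) \<sigma> 2 (\<lambda>\<sigma>'. \<sigma>' = ?\<sigma>)"
    by (simp add: runs_wp wp_simps)
  have 2: "runs (For 21 (Const 0) (Plus (Reg 7) (Const 1)) ?c) ?\<sigma>
    (for_cost (Const 0) (Plus (Reg 7) (Const 1)) (M + 1 - 0) 11) (?I (M + 1))"
  proof (rule runs_For[where I = ?I])
    fix i \<sigma>'
    assume i: "0 \<le> i" "i < M + 1" "reg \<sigma>' 21 = i" and I: "?I i \<sigma>'"
      and ag: "loop_framed 21 ?c ?\<sigma> \<sigma>'"
    have a: "arr \<sigma>' 14 i = arr \<sigma> 14 i" "arr \<sigma>' 15 i = arr \<sigma> 15 i" using ag by (simp_all add: agree_def)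
    have src: "i \<in> sources M \<sigma> \<longleftrightarrow> 0 < arr \<sigma> 14 i" using i by (simp add: sources_def)
    have s: "{0..<i + 1} = insert i {0..<i}" using i by auto
    show "runs ?c \<sigma>' 11 (?I (i + 1))"
      using I i unfolding s runs_wp by (auto simp: wp_simps a src)
  next
    fix \<sigma>' assume "loop_framed 21 ?c ?\<sigma> \<sigma>'"
    then show "aval (Plus (Reg 7) (Const 1)) \<sigma>' = M + 1" using M by (simp add: agree_def)
  qed (use M in auto)
  have b: "2 + (for_cost (Const 0) (Plus (Reg 7) (Const 1)) (M + 1 - 0) 11) \<le> 40 * nat (M + 1)"
    using M by simp
  have s: "{0..<M + 1} = {0..M}" by auto
  show ?thesis unfolding find_node_def
    by (rule runs_mono[OF runs_Seq[OF 1] b]) (use 2 s in auto)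
qed

section \<open>Changing the flow along a labelled path\<close>

context
  fixes M :: int and h :: "int \<Rightarrow> int"
begin

interpretation network "{- M..M}" abs h "-1"
  by unfold_locales auto

lemma runs_push:
  assumes net: "holds_network M h \<sigma>" and f: "f = arr \<sigma> 13" "\<And>q. q \<in> {- M..M} \<Longrightarrow> f q = 0 \<or> f q = 1"
    and s: "searched M h f \<sigma>"
    and x: "reg \<sigma> 23 = x" "x = -1 \<or> x \<in> {0..M} \<and> 0 < arr \<sigma> 15 x"
  shows "runs push \<sigma> (40 * nat (M + 2)) (\<lambda>\<sigma>'. (x = -1 \<longrightarrow> arr \<sigma>' 13 = f) \<and>
    (\<forall>q\<in>{- M..M}. arr \<sigma>' 13 q = 0 \<or> arr \<sigma>' 13 q = 1) \<and>
    (\<forall>y. net_out (arr \<sigma>' 13) y = net_out f y + of_bool (y = x) - of_bool (y = -1)))"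
proof -
  have M: "0 \<le> M" "reg \<sigma> 7 = M" using net by (auto simp: holds_network_def)
  define B where "B = arr \<sigma> 15"
  define NX where "NX = arr \<sigma> 16"
  have sound: "sound_marks M h f B NX" using s by (simp add: searched_def B_def NX_def)
  have ptr: "NX v \<in> {- M..M} \<and> rfrom f h (NX v) = v \<and>
        0 < B (rto f h (NX v)) \<and> B v = B (rto f h (NX v)) + 1" if "v \<in> {0..M}" "0 < B v" for v
    using sound that by (auto simp: sound_marks_def)
  \<comment> \<open>Midway, one unit has been moved from \<open>x\<close> to the current node in
    register 23. The arcs ahead, those of nodes with labels no larger than the current one, still
    carry their old flow, so the search labels remain valid for them.\<close>
  let ?I = "\<lambda>i \<sigma>'. reg \<sigma>' 23 \<in> {-1..M} \<and> 0 < B (reg \<sigma>' 23) \<and>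
    (reg \<sigma>' 23 \<noteq> -1 \<longrightarrow> B (reg \<sigma>' 23) + i \<le> M + 2) \<and>
    (\<forall>q\<in>{- M..M}. arr \<sigma>' 13 q = 0 \<or> arr \<sigma>' 13 q = 1) \<and>
    (\<forall>y. net_out (arr \<sigma>' 13) y = net_out f y + of_bool (y = x) - of_bool (y = reg \<sigma>' 23)) \<and>
    (\<forall>v\<in>{0..M}. 0 < B v \<longrightarrow> B v \<le> B (reg \<sigma>' 23) \<longrightarrow> arr \<sigma>' 13 (NX v) = f (NX v)) \<and>
    (x = -1 \<longrightarrow> reg \<sigma>' 23 = -1 \<and> arr \<sigma>' 13 = f)"
  have "runs push \<sigma> (for_cost (Const 0) (Plus (Reg 7) (Const 2)) (M + 2 - 0) 20) (?I (M + 2))"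
    unfolding push_def
  proof (rule runs_For[where I = ?I])
    have "B v \<le> M + 2" if "v \<in> {-1..M}" for v
      using sound that card_marked[OF M(1), of B] by (force simp: sound_marks_def)
    then show "?I (aval (Const 0) \<sigma>) \<sigma>"
      using x f sound M by (auto simp: sound_marks_def B_def)
  next
    fix \<sigma>' assume "loop_framed 21 push_step \<sigma> \<sigma>'"
    then show "aval (Plus (Reg 7) (Const 2)) \<sigma>' = M + 2"
      using M by (simp add: agree_def push_step_def)
  next
    fix i \<sigma>'
    assume i: "0 \<le> i" and I: "?I i \<sigma>'"
      and ag: "loop_framed 21 push_step \<sigma> \<sigma>'"
    define y where "y = reg \<sigma>' 23"
    define f' where "f' = arr \<sigma>' 13"
    have arrs: "arr \<sigma>' 16 = NX" using ag by (simp add: agree_def push_step_def NX_def)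
    show "runs push_step \<sigma>' 20 (?I (i + 1))"
    proof (cases "y = -1")
      case True
      then show ?thesis using I unfolding runs_wp push_step_def by (simp add: wp_simps y_def)
    next
      case False
      then have y: "y \<in> {0..M}" "0 < B y" using I by (auto simp: y_def)
      define q where "q = NX y"
      define z where "z = rto f h q"
      have q: "q \<in> {- M..M}" "rfrom f h q = y" "0 < B z" "B y = B z + 1"
        using ptr[OF y] by (auto simp: q_def z_def)
      have fq: "f' q = f q" using I y unfolding q_def f'_def y_def by blast
      have n: "arr \<sigma>' 11 q = \<bar>q\<bar>" "arr \<sigma>' 12 q = h q" "-1 \<le> h q" "h q \<le> M"
        using holds_network_agree[OF net ag] q(1) by (auto simp: push_step_def holds_network_def)
      define b where "b = 1 - f q"
      have b: "f q = 0 \<and> b = 1 \<or> f q = 1 \<and> b = 0" using f(2)[OF q(1)] by (auto simp: b_def)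
      have zr: "z \<in> {-1..M}" using q(1) n by (auto simp: z_def rto_def)
      have flow: "net_out (f'(q := b)) v = net_out f v + of_bool (v = x) - of_bool (v = z)" for v
      proof -
        have "net_out (f'(q := b)) v = net_out f' v + (b - f q) * (of_bool (\<bar>q\<bar> = v) - of_bool (h q = v))"
          using net_out_update[OF q(1), of f' b v] fq by simp
        also have "(b - f q) * (of_bool (\<bar>q\<bar> = v) - of_bool (h q = v)) = of_bool (v = y) - of_bool (v = z)"
          using b q(2) by (auto simp: z_def rto_def rfrom_def)
        finally have "net_out (f'(q := b)) v = net_out f' v + (of_bool (v = y) - of_bool (v = z))" .
        moreover have "net_out f' v = net_out f v + of_bool (v = x) - of_bool (v = y)"
          using I unfolding f'_def y_def by blast
        ultimately show ?thesis by linarith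
      qed
      have keep: "(f'(q := b)) (NX v) = f (NX v)" if "v \<in> {0..M}" "0 < B v" "B v \<le> B z" for v
      proof -
        \<comment> \<open>Otherwise \<open>v\<close> would be the node just left, whose label is
          larger than that of \<open>z\<close>. So no arc is changed twice.\<close>
        have "NX v \<noteq> q" using ptr[OF that(1,2)] q that(3) by auto
        moreover have "f' (NX v) = f (NX v)"
          using I that q(4) unfolding f'_def y_def by simp
        ultimately show ?thesis by simp
      qed
      have unit: "\<forall>p\<in>{- M..M}. (f'(q := b)) p = 0 \<or> (f'(q := b)) p = 1" using I b by (auto simp: f'_def)
      have xn: "x \<noteq> -1" using I False by (auto simp: y_def)
      have "?I (i + 1) (\<sigma>'\<lparr>reg := r(23 := z), arr := (arr \<sigma>')(13 := f'(q := b))\<rparr>)" for r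
        using zr q(3,4) I False flow keep unit xn unfolding y_def by simp
      moreover have "-1 < y" using y by simp
      ultimately show ?thesis
        using b n arrs unfolding runs_wp push_step_def z_def rto_def
        by (elim disjE) (simp_all add: wp_simps y_def[symmetric] q_def[symmetric] f'_def[symmetric] fq)
    qed
  qed (use M in \<open>auto simp: push_step_def\<close>)
  then show ?thesis
  proof (rule runs_mono)
    show "for_cost (Const 0) (Plus (Reg 7) (Const 2)) (M + 2 - 0) 20 \<le> 40 * nat (M + 2)"
      using M by simp
    fix \<sigma>' assume I: "?I (M + 2) \<sigma>'"
    \<comment> \<open>After \<open>M + 2\<close> steps a positive label would exceed the budget for
      any node other than the sink.\<close>
    then have "reg \<sigma>' 23 = -1" by (metis add_le_same_cancel2 linorder_not_less)
    then show "(x = -1 \<longrightarrow> arr \<sigma>' 13 = f) \<and>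
      (\<forall>q\<in>{- M..M}. arr \<sigma>' 13 q = 0 \<or> arr \<sigma>' 13 q = 1) \<and>
      (\<forall>y. net_out (arr \<sigma>' 13) y = net_out f y + of_bool (y = x) - of_bool (y = -1))"
      using I by simp
  qed
qed

end

text \<open>Register 4 holds \<open>2 ^ k + 1\<close>, one more than any cut of the sources that
  occurs, hence more than the number of augmentations that can succeed.\<close>

definition maximize :: com where
  "maximize = For 18 (Const 0) (Reg 4) augment"

definition advance_sources :: com where
  "advance_sources =
     For 21 (Const 0) (Plus (Reg 7) (Const 1))
       (Cond (Less (Get 15 (Reg 21)) (Const 1)) (Put 14 (Reg 21) (Const 1)) Skip) ;;
     for_arcs
       (Cond (Conj (Less (Get 15 (Get 11 (Reg 20))) (Const 1)) (Less (Const (-1)) (Get 12 (Reg 20))))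
         (Put 14 (Get 12 (Reg 20)) (Const 1)) Skip)"

text \<open>The flow is carried over from round to round. It remains a flow because sources are only
  added.\<close>

definition find_flow :: com where
  "find_flow =
     for_arcs (Put 13 (Reg 20) (Const 0)) ;;
     For 21 (Const 0) (Plus (Reg 7) (Const 1)) (Put 14 (Reg 21) (Const 0)) ;;
     Put 14 (Const 0) (Const 1) ;;
     For 17 (Const 0) (Reg 0) (maximize ;; advance_sources) ;;
     maximize"

lemma written_simps:
  "regs_written scan_arc = {21, 22}" "arrs_written scan_arc = {15, 16}"
  "regs_written search = {19, 20, 21, 22}" "arrs_written search = {15, 16}"
  "regs_written find_node = {21, 23}" "arrs_written find_node = {}"
  "regs_written push = {20, 21, 23}" "arrs_written push = {13}"
  "regs_written augment = {19, 20, 21, 22, 23}" "arrs_written augment = {13, 15, 16}"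
  "regs_written maximize = {18, 19, 20, 21, 22, 23}" "arrs_written maximize = {13, 15, 16}"
  "regs_written advance_sources = {20, 21}" "arrs_written advance_sources = {14}"
  "regs_written find_flow = {17, 18, 19, 20, 21, 22, 23}" "arrs_written find_flow = {13, 14, 15, 16}"
  by (auto simp: scan_arc_def search_def for_arcs_def find_node_def push_def push_step_def
      augment_def maximize_def advance_sources_def find_flow_def)

section \<open>Correctness of maximizing and of advancing\<close>

context
  fixes M :: int and h :: "int \<Rightarrow> int"
begin

interpretation network "{- M..M}" abs h "-1"
  by unfold_locales auto

abbreviation maximal :: "(int \<Rightarrow> int) \<Rightarrow> int set \<Rightarrow> store \<Rightarrow> bool" where
  "maximal f S \<sigma> \<equiv>
     max_flow {- M..M} abs h (-1) f S (marked M (arr \<sigma> 15)) (\<lambda>v. nat (arr \<sigma> 15 v)) \<and>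
     (\<forall>v\<in>{-1..M}. 0 \<le> arr \<sigma> 15 v)"

lemma searched_residual:
  assumes net: "holds_network M h \<sigma>" and s: "searched M h f \<sigma>"
  shows "residual_closed f (marked M (arr \<sigma> 15))"
    "residual_ranked f (marked M (arr \<sigma> 15)) (\<lambda>v. nat (arr \<sigma> 15 v))"
    "-1 \<in> marked M (arr \<sigma> 15)"
proof -
  let ?B = "arr \<sigma> 15" and ?NX = "arr \<sigma> 16"
  have M: "0 \<le> M" and h: "\<And>q. q \<in> {- M..M} \<Longrightarrow> -1 \<le> h q \<and> h q \<le> M"
    using net by (auto simp: holds_network_def)
  have sound: "sound_marks M h f ?B ?NX" and closed: "closed_marks h f ?B {- M..M}"
    using s by (auto simp: searched_def)
  show "-1 \<in> marked M ?B" using sound M by (simp add: sound_marks_def marked_def)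
  show "residual_closed f (marked M ?B)"
    unfolding residual_closed_def
  proof (intro ballI)
    fix q assume q: "q \<in> {- M..M}"
    then have "\<bar>q\<bar> \<in> {-1..M}" "h q \<in> {-1..M}" using h by auto
    then show "(f q = 0 \<and> h q \<in> marked M ?B \<longrightarrow> \<bar>q\<bar> \<in> marked M ?B) \<and>
        (f q \<noteq> 0 \<and> \<bar>q\<bar> \<in> marked M ?B \<longrightarrow> h q \<in> marked M ?B)"
      using closed q unfolding closed_marks_def marked_def rto_def rfrom_def
      by (cases "f q = 0") force+
  qed
  show "residual_ranked f (marked M ?B) (\<lambda>v. nat (?B v))"
    unfolding residual_ranked_def
  proof (intro ballI impI)
    fix b assume b: "b \<in> marked M ?B" "b \<noteq> -1"
    define q where "q = ?NX b"
    have "b \<in> {0..M}" "?B b \<noteq> 0" using b by (auto simp: marked_def)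
    then have q: "q \<in> {- M..M}" "rfrom f h q = b" "0 < ?B (rto f h q)" "?B b = ?B (rto f h q) + 1"
      using sound by (auto simp: sound_marks_def q_def)
    have "\<bar>q\<bar> \<in> {-1..M}" "h q \<in> {-1..M}" using q(1) h by auto
    then show "\<exists>q\<in>{- M..M}. f q = 0 \<and> \<bar>q\<bar> = b \<and> h q \<in> marked M ?B \<and> nat (?B (h q)) < nat (?B b) \<or>
        f q \<noteq> 0 \<and> h q = b \<and> \<bar>q\<bar> \<in> marked M ?B \<and> nat (?B \<bar>q\<bar>) < nat (?B b)"
      using q by (intro bexI[of _ q]) (auto simp: rfrom_def rto_def marked_def split: if_splits)
  qed
qed

text \<open>The second outcome also excludes every certificate of maximality. This makes maximality
  stable: a call that starts from a certified flow must end in the first outcome.\<close>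

lemma runs_augment:
  assumes net: "holds_network M h \<sigma>" and S: "S = sources M \<sigma>" and f: "f = arr \<sigma> 13" "flow f S"
  shows "runs augment \<sigma> (350 * nat (M + 1) * nat (M + 2)) (\<lambda>\<sigma>'.
    arr \<sigma>' 13 = f \<and> maximal f S \<sigma>' \<or>
    flow (arr \<sigma>' 13) S \<and> flow_value (arr \<sigma>' 13) = flow_value f + 1 \<and>
      (\<forall>B rk. \<not> max_flow {- M..M} abs h (-1) f S B rk))"
    (is "runs _ _ _ ?R")
proof -
  have M: "0 \<le> M" "reg \<sigma> 7 = M" using net by (auto simp: holds_network_def)
  have unit: "\<And>q. q \<in> {- M..M} \<Longrightarrow> f q = 0 \<or> f q = 1" using f(2) by (simp add: flow_def)
  have 1: "runs search \<sigma> (250 * nat (M + 1) * nat (M + 2)) (searched M h f)"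
    using net f(1) unit by (rule runs_search)
  have "runs augment \<sigma> (250 * nat (M + 1) * nat (M + 2) + (40 * nat (M + 1) + 40 * nat (M + 2))) ?R"
    unfolding augment_def
  proof (rule runs_Seq[OF runs_agree[OF 1]], elim conjE)
    fix \<sigma>1 assume s: "searched M h f \<sigma>1"
      and "framed search \<sigma> \<sigma>1"
    then have a1: "agree {19, 20, 21, 22} {15, 16} \<sigma> \<sigma>1" by (simp add: written_simps)
    have net1: "holds_network M h \<sigma>1" using holds_network_agree[OF net a1] by simp
    have S1: "sources M \<sigma>1 = S" using a1 by (simp add: sources_def agree_def S)
    let ?B = "arr \<sigma>1 15"
    note res = searched_residual[OF net1 s]
    have nn: "\<And>v. v \<in> {-1..M} \<Longrightarrow> 0 \<le> ?B v" using s by (auto simp: searched_def sound_marks_def)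
    have M1: "reg \<sigma>1 7 = M" using a1 M by (simp add: agree_def)
    show "runs (find_node ;; push) \<sigma>1 (40 * nat (M + 1) + 40 * nat (M + 2)) ?R"
    proof (rule runs_Seq[OF runs_agree[OF runs_find_node[OF M(1) M1]]], elim conjE)
      fix \<sigma>2 assume x: "reg \<sigma>2 23 = -1 \<and> (\<forall>v\<in>{0..M}. ?B v \<le> 0 \<or> v \<notin> sources M \<sigma>1) \<or>
          reg \<sigma>2 23 \<in> {0..M} \<inter> sources M \<sigma>1 \<and> 0 < ?B (reg \<sigma>2 23)"
        and "framed find_node \<sigma>1 \<sigma>2"
      then have a2: "agree {21, 23} {} \<sigma>1 \<sigma>2" by (simp add: written_simps)
      have a: "agree {19, 20, 21, 22, 23} {15, 16} \<sigma> \<sigma>2"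
        by (rule agree_trans[OF agree_mono[OF a1] agree_mono[OF a2]]) auto
      have net2: "holds_network M h \<sigma>2" using holds_network_agree[OF net a] by simp
      have arrs: "arr \<sigma>2 = arr \<sigma>1" using a2 by (auto simp: agree_def)
      have s2: "searched M h f \<sigma>2" using s by (simp add: searched_def arrs)
      have f2: "f = arr \<sigma>2 13" using f a by (simp add: agree_def)
      have x': "reg \<sigma>2 23 = -1 \<or> reg \<sigma>2 23 \<in> {0..M} \<and> 0 < arr \<sigma>2 15 (reg \<sigma>2 23)"
        using x arrs by auto
      note 3 = runs_agree[OF runs_push[where f = f and \<sigma> = \<sigma>2, OF net2 f2 _ s2 refl x'], OF unit]
      show "runs push \<sigma>2 (40 * nat (M + 2)) ?R"
      proof (rule runs_mono[OF 3], simp, simp, elim conjE)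
        fix \<sigma>3
        assume same: "reg \<sigma>2 23 = -1 \<longrightarrow> arr \<sigma>3 13 = f"
          and unit3: "\<forall>q\<in>{- M..M}. arr \<sigma>3 13 q = 0 \<or> arr \<sigma>3 13 q = 1"
          and bal: "\<forall>y. net_out (arr \<sigma>3 13) y =
            net_out f y + of_bool (y = reg \<sigma>2 23) - of_bool (y = -1)"
          and "framed push \<sigma>2 \<sigma>3"
        then have B3: "arr \<sigma>3 15 = ?B" using arrs by (simp add: written_simps agree_def)
        show "?R \<sigma>3"
        proof (cases "reg \<sigma>2 23 = -1")
          case True
          have "v \<notin> marked M ?B" if v: "v \<in> S" for v
          proof (cases "v \<in> {0..M}")
            case True
            then have "?B v \<le> 0" using x \<open>reg \<sigma>2 23 = -1\<close> S1 v by auto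
            then show ?thesis using nn[of v] True by (simp add: marked_def)
          next
            case False
            moreover have "v \<noteq> -1" using v by (simp add: S sources_def)
            ultimately show ?thesis by (auto simp: marked_def)
          qed
          then have "S \<inter> marked M ?B = {}" by blast
          then have "max_flow {- M..M} abs h (-1) f S (marked M ?B) (\<lambda>v. nat (?B v))"
            using f(2) res by unfold_locales
          then show ?thesis using same True B3 nn by simp
        next
          case False
          then have xS: "reg \<sigma>2 23 \<in> S" "reg \<sigma>2 23 \<in> marked M ?B"
            using x S1 by (auto simp: marked_def)
          have "flow (arr \<sigma>3 13) S"
            using f(2) unit3 bal xS by (auto simp: flow_def)
          moreover have "flow_value (arr \<sigma>3 13) = flow_value f + 1"
            using bal False by (simp add: flow_value_def)
          moreover have False if m: "max_flow {- M..M} abs h (-1) f S B rk" for B rk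
          proof -
            interpret mf: max_flow "{- M..M}" abs h "-1" f S B rk by fact
            show False using residual_ranked_subset[OF res(2) mf.closed mf.sink] mf.disjoint xS by blast
          qed
          ultimately show ?thesis by blast
        qed
      qed
    qed
  qed
  then show ?thesis
  proof (rule runs_mono)
    obtain a where a: "M = int a" using M nonneg_int_cases by blast
    show "250 * nat (M + 1) * nat (M + 2) + (40 * nat (M + 1) + 40 * nat (M + 2))
        \<le> 350 * nat (M + 1) * nat (M + 2)"
      by (simp add: a nat_add_distrib algebra_simps)
  qed
qed

lemma runs_maximize:
  assumes net: "holds_network M h \<sigma>" and S: "S = sources M \<sigma>" and f: "flow (arr \<sigma> 13) S"
    and p: "reg \<sigma> 4 = int p" "card (cut S) < p"
  shows "runs maximize \<sigma> (370 * p * (nat (M + 1) * nat (M + 2))) (\<lambda>\<sigma>'. maximal (arr \<sigma>' 13) S \<sigma>')"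
proof -
  have M: "0 \<le> M" "reg \<sigma> 7 = M" using net by (auto simp: holds_network_def)
  let ?I = "\<lambda>i \<sigma>'. flow (arr \<sigma>' 13) S \<and>
    (i \<le> flow_value (arr \<sigma>' 13) \<or> maximal (arr \<sigma>' 13) S \<sigma>')"
  have "runs maximize \<sigma> (for_cost (Const 0) (Reg 4) (int p - 0) (350 * nat (M + 1) * nat (M + 2))) (?I (int p))"
    unfolding maximize_def
  proof (rule runs_For[where I = ?I])
    have "0 \<le> flow_value (arr \<sigma> 13)" using flow_value_sink[OF f] by (simp add: S sources_def)
    then show "?I (aval (Const 0) \<sigma>) \<sigma>" using f by simp
  next
    fix i \<sigma>' assume i: "0 \<le> i" and I: "?I i \<sigma>'"
      and ag: "loop_framed 18 augment \<sigma> \<sigma>'"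
    have net': "holds_network M h \<sigma>'" and S': "S = sources M \<sigma>'"
      using holds_network_agree[OF net ag] S ag by (simp_all add: written_simps agree_def sources_def)
    show "runs augment \<sigma>' (350 * nat (M + 1) * nat (M + 2)) (?I (i + 1))"
      by (rule runs_mono[OF runs_augment[OF net' S' refl]]) (use I in auto)
  next
    fix \<sigma>' assume "loop_framed 18 augment \<sigma> \<sigma>'"
    then show "aval (Reg 4) \<sigma>' = int p" using p by (simp add: written_simps agree_def)
  qed (auto simp: written_simps)
  then show ?thesis
  proof (rule runs_mono)
    define Y where "Y = nat (M + 1) * nat (M + 2)"
    have "0 < nat (M + 1)" "0 < nat (M + 2)" using M by auto
    then have Y: "1 \<le> Y" by (simp add: Y_def Suc_le_eq)
    have "p * 1 \<le> p * Y" using Y by (rule mult_le_mono2)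
    then have "5 + p * 7 \<le> 20 * (p * Y)" using p by linarith
    then have "5 + p * (350 * Y + 7) \<le> 370 * p * Y" by (simp add: algebra_simps)
    then show "for_cost (Const 0) (Reg 4) (int p - 0) (350 * nat (M + 1) * nat (M + 2))
        \<le> 370 * p * (nat (M + 1) * nat (M + 2))"
      by (simp add: Y_def ac_simps)
    fix \<sigma>' assume I: "?I (int p) \<sigma>'"
    \<comment> \<open>The value after \<open>p\<close> successful augmentations would be at least
      \<open>p\<close>, more than the cut of the sources admits.\<close>
    have "flow_value (arr \<sigma>' 13) \<le> int (card {q \<in> cut S. arr \<sigma>' 13 q = 1})"
      using I by (intro flow_value_le_cut) (auto simp: S sources_def)
    also have "card {q \<in> cut S. arr \<sigma>' 13 q = 1} \<le> card (cut S)" by (intro card_mono) auto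
    finally show "maximal (arr \<sigma>' 13) S \<sigma>'" using I p by auto
  qed
qed

lemma runs_advance_sources:
  assumes net: "holds_network M h \<sigma>" and mx: "maximal f (sources M \<sigma>) \<sigma>"
  shows "runs advance_sources \<sigma> (200 * nat (M + 1))
    (\<lambda>\<sigma>'. sources M \<sigma>' = advance (- marked M (arr \<sigma> 15)))"
proof -
  interpret mf: max_flow "{- M..M}" abs h "-1" f "sources M \<sigma>" "marked M (arr \<sigma> 15)"
    "\<lambda>v. nat (arr \<sigma> 15 v)" using mx by blast
  have nn: "\<And>v. v \<in> {-1..M} \<Longrightarrow> 0 \<le> arr \<sigma> 15 v" using mx by blast
  let ?B = "arr \<sigma> 15"
  have M: "0 \<le> M" "reg \<sigma> 7 = M" using net by (auto simp: holds_network_def)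
  \<comment> \<open>The sources are disjoint from the marked nodes, so overwriting array 14 at
    unmarked nodes loses no source.\<close>
  have zero: "?B v = 0" if "v \<in> {0..M}" "0 < arr \<sigma> 14 v" for v
    using disjoint_iff[THEN iffD1, OF mf.disjoint, rule_format, of v] that
    by (auto simp: sources_def marked_def)
  let ?c1 = "Cond (Less (Get 15 (Reg 21)) (Const 1)) (Put 14 (Reg 21) (Const 1)) Skip"
  let ?c2 = "Cond (Conj (Less (Get 15 (Get 11 (Reg 20))) (Const 1)) (Less (Const (-1)) (Get 12 (Reg 20))))
         (Put 14 (Get 12 (Reg 20)) (Const 1)) Skip"
  let ?I1 = "\<lambda>i \<sigma>'. \<forall>v\<in>{0..M}. 0 < arr \<sigma>' 14 v \<longleftrightarrow> ?B v = 0 \<and> (v < i \<or> 0 < arr \<sigma> 14 v)"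
  have 1: "runs (For 21 (Const 0) (Plus (Reg 7) (Const 1)) ?c1) \<sigma>
      (for_cost (Const 0) (Plus (Reg 7) (Const 1)) (M + 1 - 0) 10) (?I1 (M + 1))"
  proof (rule runs_For[where I = ?I1])
    fix i \<sigma>' assume i: "0 \<le> i" "i < M + 1" "reg \<sigma>' 21 = i" and I: "?I1 i \<sigma>'"
      and ag: "loop_framed 21 ?c1 \<sigma> \<sigma>'"
    have B: "arr \<sigma>' 15 = ?B" using ag by (simp add: agree_def)
    have step: "v < i + 1 \<longleftrightarrow> v < i \<or> v = i" for v by auto
    have "0 \<le> ?B i" using nn i by simp
    then consider "?B i = 0" | "1 \<le> ?B i" by linarith
    then show "runs ?c1 \<sigma>' 10 (?I1 (i + 1))"
    proof cases
      case 1
      then have "?I1 (i + 1) (\<sigma>'\<lparr>arr := (arr \<sigma>')(14 := (arr \<sigma>' 14)(i := 1))\<rparr>)"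
        using I unfolding step by simp
      then show ?thesis using i B 1 by (simp add: runs_wp wp_simps)
    next
      case 2
      then have "?I1 (i + 1) \<sigma>'" using I unfolding step by force
      then show ?thesis using i B 2 by (simp add: runs_wp wp_simps)
    qed
  next
    fix \<sigma>' assume "loop_framed 21 ?c1 \<sigma> \<sigma>'"
    then show "aval (Plus (Reg 7) (Const 1)) \<sigma>' = M + 1" using M by (simp add: agree_def)
  qed (use M zero in auto)
  let ?I2 = "\<lambda>i \<sigma>'. \<forall>v\<in>{0..M}. 0 < arr \<sigma>' 14 v \<longleftrightarrow>
      ?B v = 0 \<or> (\<exists>p\<in>{- M..<i}. ?B \<bar>p\<bar> = 0 \<and> h p = v)"
  let ?t2 = "for_cost (Minus (Const 0) (Reg 7)) (Plus (Reg 7) (Const 1)) (M + 1 - (- M)) 20"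
  have "runs advance_sources \<sigma> ((for_cost (Const 0) (Plus (Reg 7) (Const 1)) (M + 1 - 0) 10) + ?t2) (?I2 (M + 1))"
    unfolding advance_sources_def
  proof (rule runs_Seq[OF runs_agree[OF 1]], elim conjE)
    fix \<sigma>1 assume I1: "?I1 (M + 1) \<sigma>1"
      and a: "framed (For 21 (Const 0) (Plus (Reg 7) (Const 1)) ?c1) \<sigma> \<sigma>1"
    have M1: "reg \<sigma>1 7 = M" using a M by (simp add: agree_def)
    show "runs (for_arcs ?c2) \<sigma>1 ?t2 (?I2 (M + 1))"
      unfolding for_arcs_def
    proof (rule runs_For[where I = ?I2])
      show "?I2 (aval (Minus (Const 0) (Reg 7)) \<sigma>1) \<sigma>1" using I1 M1 by simp
    next
      fix q \<sigma>' assume q: "- M \<le> q" "q < M + 1" "reg \<sigma>' 20 = q" and I: "?I2 q \<sigma>'"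
        and "loop_framed 20 ?c2 \<sigma>1 \<sigma>'"
      then have ag: "agree {20, 21} {14} \<sigma> \<sigma>'" using a by (auto simp: agree_def)
      have B: "arr \<sigma>' 15 = ?B" using ag by (simp add: agree_def)
      have n: "arr \<sigma>' 11 q = \<bar>q\<bar>" "arr \<sigma>' 12 q = h q" "-1 \<le> h q" "h q \<le> M"
        using holds_network_agree[OF net ag] q by (auto simp: holds_network_def)
      have s: "{- M..<q + 1} = insert q {- M..<q}" using q by auto
      have nq: "0 \<le> ?B \<bar>q\<bar>" using q(1,2) by (intro nn) auto
      show "runs ?c2 \<sigma>' 20 (?I2 (q + 1))"
      proof (cases "?B \<bar>q\<bar> < 1 \<and> -1 < h q")
        case True
        then have "?B \<bar>q\<bar> = 0" using nq by simp
        then have "?I2 (q + 1) (\<sigma>'\<lparr>arr := (arr \<sigma>')(14 := (arr \<sigma>' 14)(h q := 1))\<rparr>)"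
          using I unfolding s by auto
        then show ?thesis using q B n True by (simp add: runs_wp wp_simps)
      next
        case False
        then have "\<not> (?B \<bar>q\<bar> = 0 \<and> h q \<in> {0..M})" by auto
        then have I': "?I2 (q + 1) \<sigma>'" using I unfolding s by blast
        consider "1 \<le> ?B \<bar>q\<bar>" | "h q = -1" using False n by linarith
        then show ?thesis by cases (use I' q B n in \<open>simp_all add: runs_wp wp_simps\<close>)
      qed
    next
      fix \<sigma>' assume "loop_framed 20 ?c2 \<sigma>1 \<sigma>'"
      then show "aval (Plus (Reg 7) (Const 1)) \<sigma>' = M + 1" using M1 by (simp add: agree_def)
    qed (use M M1 in auto)
  qed
  then show ?thesis
  proof (rule runs_mono)
    show "(for_cost (Const 0) (Plus (Reg 7) (Const 1)) (M + 1 - 0) 10) + ?t2 \<le> 200 * nat (M + 1)"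
      using M by simp
    fix \<sigma>' :: store assume I: "?I2 (M + 1) \<sigma>'"
    have s: "{- M..<M + 1} = {- M..M}" by auto
    have mk: "v \<in> marked M ?B \<longleftrightarrow> v = -1 \<or> v \<in> {0..M} \<and> ?B v \<noteq> 0" for v
      using mf.sink by (auto simp: marked_def)
    have h: "h q \<noteq> -1 \<Longrightarrow> q \<in> {- M..M} \<Longrightarrow> h q \<in> {0..M}" for q
      using net by (force simp: holds_network_def)
    have nm: "\<bar>q\<bar> \<notin> marked M ?B \<longleftrightarrow> ?B \<bar>q\<bar> = 0" if "q \<in> {- M..M}" for q
      using that by (auto simp: mk)
    show "sources M \<sigma>' = advance (- marked M ?B)"
    proof (intro set_eqI)
      fix v
      show "v \<in> sources M \<sigma>' \<longleftrightarrow> v \<in> advance (- marked M ?B)"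
      proof (cases "v \<in> {0..M}")
        case True
        then have "v \<in> sources M \<sigma>' \<longleftrightarrow> ?B v = 0 \<or> (\<exists>p\<in>{- M..M}. ?B \<bar>p\<bar> = 0 \<and> h p = v)"
          using I unfolding s by (simp add: sources_def)
        also have "\<dots> \<longleftrightarrow> v \<in> advance (- marked M ?B)"
          using True nm by (auto simp: advance_def mk)
        finally show ?thesis .
      next
        case False
        then show ?thesis using h by (auto simp: sources_def advance_def mk)
      qed
    qed
  qed
qed

end

section \<open>All rounds of the flow computation\<close>

context
  fixes M :: int and h :: "int \<Rightarrow> int"
begin

interpretation network "{- M..M}" abs h "-1"
  by unfold_locales auto

lemma out_degree: "card {q \<in> {- M..M}. \<bar>q\<bar> = x} \<le> 2"
proof -
  have "{q \<in> {- M..M}. \<bar>q\<bar> = x} \<subseteq> {x, - x}" by auto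
  then have "card {q \<in> {- M..M}. \<bar>q\<bar> = x} \<le> card {x, - x}" by (intro card_mono) auto
  also have "\<dots> \<le> 2" by (simp add: card_insert_if)
  finally show ?thesis .
qed

lemma runs_find_flow:
  assumes net: "holds_network M h \<sigma>" and k: "reg \<sigma> 0 = int k" and p: "reg \<sigma> 4 = 2 ^ k + 1"
  shows "runs find_flow \<sigma> (1000 * (k + 1) * (2 ^ k + 1) * (nat (M + 1) * nat (M + 2)))
    (\<lambda>\<sigma>'. tolerant_flow M h k (arr \<sigma>' 13))"
proof -
  have M: "0 \<le> M" "reg \<sigma> 7 = M" and h: "\<And>q. q \<in> {- M..M} \<Longrightarrow> -1 \<le> h q \<and> h q \<le> M"
    using net by (auto simp: holds_network_def)
  define p' :: nat where "p' = 2 ^ k + 1"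
  define Y where "Y = nat (M + 1) * nat (M + 2)"
  let ?t1 = "for_cost (Minus (Const 0) (Reg 7)) (Plus (Reg 7) (Const 1)) (M + 1 - (- M)) 3"
  let ?t2 = "for_cost (Const 0) (Plus (Reg 7) (Const 1)) (M + 1 - 0) 3"
  let ?t4 = "for_cost (Const 0) (Reg 0) (int k - 0) (370 * p' * Y + 200 * nat (M + 1))"
  let ?c1 = "for_arcs (Put 13 (Reg 20) (Const 0))"
  let ?c2 = "For 21 (Const 0) (Plus (Reg 7) (Const 1)) (Put 14 (Reg 21) (Const 0))"
  \<comment> \<open>The two bounds grow together: each round raises the expansion by one, by
    \<open>expanding_advance\<close>, and at most doubles the cut, by
    \<open>card_cut_advance\<close>.\<close>
  let ?J = "\<lambda>r \<sigma>'. holds_network M h \<sigma>' \<and> framed find_flow \<sigma> \<sigma>' \<and>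
      flow (arr \<sigma>' 13) (sources M \<sigma>') \<and> 0 \<in> sources M \<sigma>' \<and> -1 \<notin> sources M \<sigma>' \<and>
      card (cut (sources M \<sigma>')) \<le> 2 ^ nat r \<and>
      (linked 0 UNIV (-1) \<longrightarrow> expanding 0 (nat r) (sources M \<sigma>'))"
  have 1: "runs ?c1 \<sigma> ?t1 (\<lambda>\<sigma>'. \<forall>q\<in>{- M..<M + 1}. arr \<sigma>' 13 q = 0)"
    unfolding for_arcs_def
    by (rule runs_For[where I = "\<lambda>i \<sigma>'. \<forall>q\<in>{- M..<i}. arr \<sigma>' 13 q = 0"])
      (use M in \<open>auto simp: agree_def runs_wp wp_simps\<close>)
  have phase: "runs maximize \<sigma>' (370 * p' * Y)
      (\<lambda>\<sigma>''. maximal M h (arr \<sigma>'' 13) (sources M \<sigma>') \<sigma>'' \<and> sources M \<sigma>'' = sources M \<sigma>' \<and>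
        holds_network M h \<sigma>'' \<and> framed find_flow \<sigma> \<sigma>'')"
    if J: "?J r \<sigma>'" and r: "0 \<le> r" "r \<le> int k" for r \<sigma>'
  proof -
    have "card (cut (sources M \<sigma>')) \<le> 2 ^ nat r" using J by blast
    also have "(2::nat) ^ nat r \<le> 2 ^ k" using r by (intro power_increasing) auto
    also have "\<dots> < p'" by (simp add: p'_def)
    finally have "card (cut (sources M \<sigma>')) < p'" .
    moreover have "reg \<sigma>' 4 = int p'" using J p by (simp add: agree_def written_simps p'_def)
    ultimately have "runs maximize \<sigma>' (370 * p' * Y)
      (\<lambda>\<sigma>''. maximal M h (arr \<sigma>'' 13) (sources M \<sigma>') \<sigma>'')"
      unfolding Y_def using J by (intro runs_maximize) auto
    from runs_agree[OF this] show ?thesis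
    proof (rule runs_mono)
      fix \<sigma>'' assume a: "maximal M h (arr \<sigma>'' 13) (sources M \<sigma>') \<sigma>'' \<and>
        framed maximize \<sigma>' \<sigma>''"
      then have ag: "framed maximize \<sigma>' \<sigma>''" by blast
      have "sources M \<sigma>'' = sources M \<sigma>'" using ag by (simp add: sources_def agree_def written_simps)
      moreover have "holds_network M h \<sigma>''"
        using holds_network_agree[of M h \<sigma>', OF _ ag] J by (simp add: written_simps)
      moreover have "framed find_flow \<sigma> \<sigma>''"
        by (rule agree_trans[OF _ agree_mono[OF ag]]) (use J in \<open>auto simp: written_simps\<close>)
      ultimately show "maximal M h (arr \<sigma>'' 13) (sources M \<sigma>') \<sigma>'' \<and> sources M \<sigma>'' = sources M \<sigma>' \<and>
        holds_network M h \<sigma>'' \<and> framed find_flow \<sigma> \<sigma>''"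
        using a by blast
    qed simp
  qed
  have rounds: "runs (For 17 (Const 0) (Reg 0) (maximize ;; advance_sources)) \<sigma>' ?t4 (?J (int k))"
    if J: "?J 0 \<sigma>'" for \<sigma>'
  proof (rule runs_For[where I = ?J])
    show "?J (aval (Const 0) \<sigma>') \<sigma>'" using J by simp
  next
    fix i v and \<sigma>'' :: store assume J: "?J i \<sigma>''"
    let ?\<sigma> = "\<sigma>''\<lparr>reg := (reg \<sigma>'')(17 := v)\<rparr>"
    have "sources M ?\<sigma> = sources M \<sigma>''" by (simp add: sources_def)
    moreover have "holds_network M h ?\<sigma>" using J by (simp add: holds_network_def)
    moreover have "framed find_flow \<sigma> ?\<sigma>"
      using J by (simp add: agree_def written_simps)
    ultimately show "?J i ?\<sigma>" using J by simp
  next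
    fix \<sigma>'' assume "loop_framed 17 (maximize ;; advance_sources) \<sigma>' \<sigma>''"
    then show "aval (Reg 0) \<sigma>'' = int k"
      using J k by (simp add: agree_def written_simps)
  next
    fix i \<sigma>1 assume i: "0 \<le> i" "i < int k" and J1: "?J i \<sigma>1"
    have "i \<le> int k" using i by simp
    from phase[OF J1 i(1) this]
    show "runs (maximize ;; advance_sources) \<sigma>1 (370 * p' * Y + 200 * nat (M + 1)) (?J (i + 1))"
    proof (rule runs_Seq, elim conjE)
      fix \<sigma>2 assume mx: "max_flow {- M..M} abs h (-1) (arr \<sigma>2 13) (sources M \<sigma>1)
          (marked M (arr \<sigma>2 15)) (\<lambda>v. nat (arr \<sigma>2 15 v))"
          "\<forall>v\<in>{-1..M}. 0 \<le> arr \<sigma>2 15 v"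
        and src: "sources M \<sigma>2 = sources M \<sigma>1" and net2: "holds_network M h \<sigma>2"
        and ag2: "framed find_flow \<sigma> \<sigma>2"
      interpret mf: max_flow "{- M..M}" abs h "-1" "arr \<sigma>2 13" "sources M \<sigma>1"
        "marked M (arr \<sigma>2 15)" "\<lambda>v. nat (arr \<sigma>2 15 v)" by (rule mx(1))
      let ?A = "- marked M (arr \<sigma>2 15)"
      have SA: "sources M \<sigma>1 \<subseteq> ?A" "?A \<subseteq> advance ?A" using mf.disjoint by (auto simp: advance_def)
      have zA: "-1 \<notin> ?A" using mf.sink by simp
      \<comment> \<open>Passing to the minimum cut does not enlarge the cut of the sources; only the
        advance that follows may double it.\<close>
      have "int (card (cut ?A)) \<le> int (card {q \<in> cut (sources M \<sigma>1). arr \<sigma>2 13 q = 1})"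
        unfolding mf.value_eq_cut[symmetric] using mf.flow J1 by (intro flow_value_le_cut) auto
      also have "card {q \<in> cut (sources M \<sigma>1). arr \<sigma>2 13 q = 1} \<le> card (cut (sources M \<sigma>1))"
        by (intro card_mono) auto
      finally have "card (cut ?A) \<le> 2 ^ nat i" using J1 by simp
      then have "card (cut (advance ?A)) \<le> 2 * 2 ^ nat i"
        using card_cut_advance[OF out_degree zA] by simp
      then have card: "card (cut (advance ?A)) \<le> 2 ^ nat (i + 1)"
        using i by (simp add: nat_add_distrib)
      have ex: "linked 0 UNIV (-1) \<longrightarrow> expanding 0 (nat (i + 1)) (advance ?A)"
        using expanding_advance[OF _ mx(1)] J1 i by (simp add: nat_add_distrib)
      have "runs advance_sources \<sigma>2 (200 * nat (M + 1)) (\<lambda>\<sigma>'. sources M \<sigma>' = advance ?A)"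
        using net2 mx src by (intro runs_advance_sources[where f = "arr \<sigma>2 13"]) auto
      from runs_agree[OF this] show "runs advance_sources \<sigma>2 (200 * nat (M + 1)) (?J (i + 1))"
      proof (rule runs_mono, simp, elim conjE)
        fix \<sigma>3 assume src3: "sources M \<sigma>3 = advance ?A"
          and ag3: "framed advance_sources \<sigma>2 \<sigma>3"
        have "holds_network M h \<sigma>3" using holds_network_agree[OF net2 ag3] by (simp add: written_simps)
        moreover have "framed find_flow \<sigma> \<sigma>3"
          by (rule agree_trans[OF ag2 agree_mono[OF ag3]]) (auto simp: written_simps)
        moreover have "arr \<sigma>3 13 = arr \<sigma>2 13" using ag3 by (simp add: agree_def written_simps)
        moreover have "flow (arr \<sigma>2 13) (advance ?A)" using flow_mono[OF mf.flow] SA by blast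
        moreover have "-1 \<notin> advance ?A" using zA by (auto simp: advance_def)
        ultimately show "?J (i + 1) \<sigma>3" using J1 SA card ex unfolding src3 by auto
      qed
    qed
  qed (auto simp: written_simps)
  have "runs find_flow \<sigma> (?t1 + (?t2 + (3 + (?t4 + 370 * p' * Y)))) (\<lambda>\<sigma>'. tolerant_flow M h k (arr \<sigma>' 13))"
    unfolding find_flow_def
  proof (rule runs_Seq[OF runs_agree[OF 1]], elim conjE)
    fix \<sigma>1 assume z1: "\<forall>q\<in>{- M..<M + 1}. arr \<sigma>1 13 q = 0"
      and "framed ?c1 \<sigma> \<sigma>1"
    then have a1: "agree {20} {13} \<sigma> \<sigma>1" by (simp add: for_arcs_def)
    have M1: "reg \<sigma>1 7 = M" using a1 M by (simp add: agree_def)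
    have 2: "runs ?c2 \<sigma>1 ?t2 (\<lambda>\<sigma>'. \<forall>q\<in>{0..<M + 1}. arr \<sigma>' 14 q = 0)"
      by (rule runs_For[where I = "\<lambda>i \<sigma>'. \<forall>q\<in>{0..<i}. arr \<sigma>' 14 q = 0"])
        (use M M1 in \<open>auto simp: agree_def runs_wp wp_simps\<close>)
    show "runs (?c2 ;; Put 14 (Const 0) (Const 1) ;;
        For 17 (Const 0) (Reg 0) (maximize ;; advance_sources) ;; maximize) \<sigma>1
        (?t2 + (3 + (?t4 + 370 * p' * Y))) (\<lambda>\<sigma>'. tolerant_flow M h k (arr \<sigma>' 13))"
    proof (rule runs_Seq[OF runs_agree[OF 2]], elim conjE)
      fix \<sigma>2 assume z2: "\<forall>q\<in>{0..<M + 1}. arr \<sigma>2 14 q = 0"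
        and "framed ?c2 \<sigma>1 \<sigma>2"
      then have a2: "agree {21} {14} \<sigma>1 \<sigma>2" by simp
      let ?\<sigma>3 = "\<sigma>2\<lparr>arr := (arr \<sigma>2)(14 := (arr \<sigma>2 14)(0 := 1))\<rparr>"
      have f3: "\<And>q. q \<in> {- M..M} \<Longrightarrow> arr ?\<sigma>3 13 q = 0" using z1 a2 by (simp add: agree_def)
      have src: "sources M ?\<sigma>3 = {v. v \<noteq> -1 \<and> (v \<in> {0..M} \<longrightarrow> v = 0)}"
        using z2 by (auto simp: sources_def)
      \<comment> \<open>Node \<open>0\<close> has a single outgoing arc, and the integers beyond the
        nodes have none. So the count starts at \<open>2 ^ 0\<close>.\<close>
      have "cut (sources M ?\<sigma>3) \<subseteq> {0}" unfolding src by (auto simp: cut_def)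
      then have "card (cut (sources M ?\<sigma>3)) \<le> card {0 :: int}" by (intro card_mono) auto
      moreover have ag: "framed find_flow \<sigma> ?\<sigma>3"
        using a1 a2 by (simp add: agree_def written_simps)
      moreover have "holds_network M h ?\<sigma>3" using holds_network_agree[OF net ag] by (simp add: written_simps)
      moreover have "flow (arr ?\<sigma>3 13) (sources M ?\<sigma>3)"
        using f3 by (simp add: flow_def net_out_def)
      moreover have "0 \<in> sources M ?\<sigma>3" "-1 \<notin> sources M ?\<sigma>3" unfolding src by auto
      ultimately have "?J 0 ?\<sigma>3" using expanding_source by auto
      note r = rounds[OF this]
      have p3: "runs (Put 14 (Const 0) (Const 1)) \<sigma>2 3 (\<lambda>\<sigma>'. \<sigma>' = ?\<sigma>3)"
        by (simp add: runs_wp wp_simps)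
      have last: "runs maximize \<sigma>4 (370 * p' * Y) (\<lambda>\<sigma>'. tolerant_flow M h k (arr \<sigma>' 13))"
        if J: "?J (int k) \<sigma>4" for \<sigma>4
      proof (rule runs_mono[OF phase[OF J]], simp, simp, simp, elim conjE)
        fix \<sigma>5 assume mx: "max_flow {- M..M} abs h (-1) (arr \<sigma>5 13) (sources M \<sigma>4)
            (marked M (arr \<sigma>5 15)) (\<lambda>v. nat (arr \<sigma>5 15 v))"
        interpret mf: max_flow "{- M..M}" abs h "-1" "arr \<sigma>5 13" "sources M \<sigma>4"
          "marked M (arr \<sigma>5 15)" "\<lambda>v. nat (arr \<sigma>5 15 v)" by (rule mx)
        \<comment> \<open>The arcs into the sink that carry flow are as many as the value of the
          flow, which the cut of the last sources bounds by \<open>2 ^ k\<close>.\<close>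
        have "int (card {q \<in> {- M..M}. h q = -1 \<and> arr \<sigma>5 13 q = 1})
            \<le> int (card {q \<in> cut (sources M \<sigma>4). arr \<sigma>5 13 q = 1})"
          using flow_value_le_cut[OF mf.flow subset_refl] flow_value_sink[OF mf.flow] J by simp
        also have "card {q \<in> cut (sources M \<sigma>4). arr \<sigma>5 13 q = 1} \<le> card (cut (sources M \<sigma>4))"
          by (intro card_mono) auto
        finally have "card {q \<in> {- M..M}. h q = -1 \<and> arr \<sigma>5 13 q = 1} \<le> 2 ^ k" using J by simp
        moreover have "\<forall>q\<in>{- M..M}. arr \<sigma>5 13 q = 0 \<or> arr \<sigma>5 13 q = 1"
          using mf.flow by (simp add: flow_def)
        moreover have "linked 0 UNIV (-1) \<longrightarrow> expanding 0 k (sources M \<sigma>4)" using J by simp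
        ultimately show "tolerant_flow M h k (arr \<sigma>5 13)"
          unfolding tolerant_flow_def using mx by blast
      qed
      show "runs (Put 14 (Const 0) (Const 1) ;;
          For 17 (Const 0) (Reg 0) (maximize ;; advance_sources) ;; maximize) \<sigma>2
          (3 + (?t4 + 370 * p' * Y)) (\<lambda>\<sigma>'. tolerant_flow M h k (arr \<sigma>' 13))"
        by (rule runs_Seq[OF p3]) (use runs_Seq[OF r last] in simp)
    qed
  qed
  then show ?thesis
  proof (rule runs_mono)
    obtain a where a: "M = int a" using M nonneg_int_cases by blast
    have Y: "Y = (a + 1) * (a + 2)" by (simp add: Y_def a nat_add_distrib)
    have n: "nat (M + 1 - (- M)) = 2 * a + 1" "nat (M + 1 - 0) = a + 1" "nat (M + 1) = a + 1"
      using a by linarith+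
    have "?t1 + (?t2 + (3 + (?t4 + 370 * p' * Y)))
      = 24 + (2 * a + 1) * 12 + (a + 1) * 12 + k * (370 * p' * Y + 200 * (a + 1) + 7) + 370 * p' * Y"
      unfolding n by simp
    also have "\<dots> \<le> 100 * Y + k * (370 * p' * Y + 300 * Y) + 370 * p' * Y"
      by (simp add: Y algebra_simps)
    also have "\<dots> \<le> 100 * (p' * Y) + k * (370 * p' * Y + 300 * (p' * Y)) + 370 * p' * Y"
      by (intro add_mono mult_le_mono order_refl) (simp_all add: p'_def)
    also have "\<dots> \<le> 1000 * (k + 1) * p' * Y" by (simp add: algebra_simps)
    finally show "?t1 + (?t2 + (3 + (?t4 + 370 * p' * Y)))
      \<le> 1000 * (k + 1) * (2 ^ k + 1) * (nat (M + 1) * nat (M + 2))"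
      by (simp only: p'_def Y_def)
  qed
qed

end

section \<open>Building the layered network\<close>

text \<open>Registers: 0 to 3 hold \<open>k\<close>, \<open>n\<close>, \<open>m\<close>, \<open>s\<close>, register 4 holds \<open>2 ^ k + 1\<close>, 5 the target,
  and 6 the cost bound. Arrays: 3 marks the remaining arcs, 4 holds the reduced weights, 7 and 8
  the adjacency lists, 9 the multiples of \<open>m\<close>, 10 marks the arcs into the target that are kept,
  and 17 holds the arcs that nodes stand for.\<close>

definition if_eq :: "aexp \<Rightarrow> aexp \<Rightarrow> com \<Rightarrow> com \<Rightarrow> com" where
  "if_eq a b c1 c2 = Cond (Conj (Neg (Less a b)) (Neg (Less b a))) c1 c2"

text \<open>Nodes are numbered consecutively in the order of the two loops, so register 11 just
  counts. Jumps to other levels take their multiple of \<open>m\<close> from array 9, as the machine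
  does not multiply. Writing the node itself into array 12 installs a loop as the default.\<close>

definition build_node :: com where
  "build_node =
     Assign 11 (Plus (Reg 11) (Const 1)) ;;
     Put 11 (Reg 11) (Reg 11) ;;
     Put 11 (Minus (Const 0) (Reg 11)) (Reg 11) ;;
     Put 17 (Reg 11) (Reg 8) ;;
     Put 12 (Reg 11) (Reg 11) ;;
     Cond (Less (Const 0) (Get 3 (Reg 8)))
       (Assign 12 (Plus (Reg 9) (Get 4 (Reg 8))) ;;
        Assign 13 (Get 1 (Reg 8)) ;;
        Cond (Less (Reg 6) (Reg 12)) Skip
          (if_eq (Reg 13) (Reg 5)
             (Put 12 (Reg 11) (Const (-1)))
             (Cond (Less (Const 0) (Get 7 (Reg 13)))
               (Put 12 (Reg 11) (Plus (Get 9 (Reg 12)) (Get 7 (Reg 13))))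
               Skip)))
       Skip ;;
     Cond (Less (Const 0) (Get 8 (Reg 8)))
       (Put 12 (Minus (Const 0) (Reg 11)) (Plus (Get 9 (Reg 9)) (Get 8 (Reg 8))))
       (Cond (Less (Reg 9) (Reg 6))
         (Put 12 (Minus (Const 0) (Reg 11))
           (Plus (Get 9 (Plus (Reg 9) (Const 1))) (Get 7 (Get 0 (Reg 8)))))
         (Put 12 (Minus (Const 0) (Reg 11)) (Reg 11)))"

definition build :: com where
  "build =
     Assign 11 (Const 0) ;;
     For 9 (Const 0) (Plus (Reg 6) (Const 1)) (For 8 (Const 0) (Reg 2) build_node) ;;
     Assign 7 (Reg 11) ;;
     Put 11 (Const 0) (Const 0) ;;
     Put 12 (Const 0) (Get 7 (Reg 3))"

lemma written_build [simp]:
  "regs_written build_node = {11, 12, 13}" "arrs_written build_node = {11, 12, 17}"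
  "regs_written build = {7, 8, 9, 11, 12, 13}" "arrs_written build = {11, 12, 17}"
  by (auto simp: build_node_def build_def if_eq_def)

section \<open>Correctness of the construction of a layered network\<close>

locale instance_data =
  fixes k n m s :: nat and ta he :: "nat \<Rightarrow> nat" and c :: "nat \<Rightarrow> int"
  assumes m_pos: "0 < m" and s_less: "s < n"
    and tail_less: "\<And>e. e < m \<Longrightarrow> ta e < n" and head_less: "\<And>e. e < m \<Longrightarrow> he e < n"
begin

sublocale arc_structure ta he s .

definition prepared :: "store \<Rightarrow> bool" where
  "prepared \<sigma> \<longleftrightarrow> reg \<sigma> 0 = int k \<and> reg \<sigma> 1 = int n \<and> reg \<sigma> 2 = int m \<and> reg \<sigma> 3 = int s \<and>
     reg \<sigma> 4 = 2 ^ k + 1 \<and>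
     (\<forall>e<m. arr \<sigma> 0 (int e) = int (ta e) \<and> arr \<sigma> 1 (int e) = int (he e) \<and> arr \<sigma> 4 (int e) = c e \<and>
        arr \<sigma> 8 (int e) = int (last_arc ta (ta e) e)) \<and>
     (\<forall>x<n. arr \<sigma> 7 (int x) = int (last_arc ta x m)) \<and>
     (\<forall>j\<in>{0..int k}. arr \<sigma> 9 j = j * int m)"

lemma prepared_agree:
  "prepared \<sigma> \<Longrightarrow> agree R A \<sigma> \<sigma>' \<Longrightarrow> R \<inter> {0, 1, 2, 3, 4} = {} \<Longrightarrow> A \<inter> {0, 1, 4, 7, 8, 9} = {} \<Longrightarrow>
    prepared \<sigma>'"
proof -
  assume p: "prepared \<sigma>" and a: "agree R A \<sigma> \<sigma>'"
    and d: "R \<inter> {0, 1, 2, 3, 4} = {}" "A \<inter> {0, 1, 4, 7, 8, 9} = {}"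
  note agree_disjoint(1)[OF a d(1)] agree_disjoint(2)[OF a d(2)]
  with p show ?thesis unfolding prepared_def by simp
qed

definition alive :: "store \<Rightarrow> nat set" where
  "alive \<sigma> = {e. e < m \<and> 0 < arr \<sigma> 3 (int e)}"

definition take_head :: "nat set \<Rightarrow> nat \<Rightarrow> int \<Rightarrow> nat \<Rightarrow> int \<Rightarrow> int" where
  "take_head H t D e j =
      (if e \<in> H \<and> j + c e \<le> D then
         if he e = t then -1
         else if last_arc ta (he e) m = 0 then node m e j
         else (j + c e) * int m + int (last_arc ta (he e) m)
       else node m e j)"

definition skip_head :: "int \<Rightarrow> nat \<Rightarrow> int \<Rightarrow> int" where
  "skip_head D e j =
      (if last_arc ta (ta e) e \<noteq> 0 then j * int m + int (last_arc ta (ta e) e)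
       else if j < D then (j + 1) * int m + int (last_arc ta (ta e) m)
       else node m e j)"

lemma runs_build_node:
  assumes p: "prepared \<sigma>" and r: "reg \<sigma> 5 = int t" "reg \<sigma> 6 = D" "reg \<sigma> 8 = int e" "reg \<sigma> 9 = j"
    and v: "reg \<sigma> 11 = node m e j - 1" and e: "e < m" and j: "0 \<le> j" "j \<le> D" "D < int k"
    and c: "\<And>e. e \<in> alive \<sigma> \<Longrightarrow> 0 \<le> c e"
  shows "runs build_node \<sigma> 100 (\<lambda>\<sigma>'. reg \<sigma>' 11 = node m e j \<and>
    arr \<sigma>' 11 = (arr \<sigma> 11)(node m e j := node m e j, - node m e j := node m e j) \<and>
    arr \<sigma>' 12 = (arr \<sigma> 12)(node m e j := take_head (alive \<sigma>) t D e j, - node m e j := skip_head D e j) \<and>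
    arr \<sigma>' 17 = (arr \<sigma> 17)(node m e j := int e))"
proof -
  define v where "v = node m e j"
  have v0: "0 < v" using j m_pos by (simp add: v_def node_def)
  have val: "arr \<sigma> 0 (int e) = int (ta e)" "arr \<sigma> 1 (int e) = int (he e)" "arr \<sigma> 4 (int e) = c e"
    "arr \<sigma> 8 (int e) = int (last_arc ta (ta e) e)"
    "arr \<sigma> 7 (int (ta e)) = int (last_arc ta (ta e) m)"
    "arr \<sigma> 7 (int (he e)) = int (last_arc ta (he e) m)"
    "arr \<sigma> 9 j = j * int m" "arr \<sigma> 9 (j + 1) = (j + 1) * int m"
    using p e j tail_less[OF e] head_less[OF e] by (auto simp: prepared_def)
  \<comment> \<open>The table of multiples covers the indices from \<open>0\<close> to
    \<open>k\<close>, and \<open>j + c e\<close> lies among them because reduced weights are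
    nonnegative and \<open>D < k\<close>.\<close>
  have row: "arr \<sigma> 9 (j + c e) = (j + c e) * int m" if "e \<in> alive \<sigma>" "j + c e \<le> D"
    using p c[OF that(1)] that j by (auto simp: prepared_def)
  have al: "0 < arr \<sigma> 3 (int e) \<longleftrightarrow> e \<in> alive \<sigma>" using e by (simp add: alive_def)
  define skip where "skip = (if 0 < last_arc ta (ta e) e then j * int m + int (last_arc ta (ta e) e)
       else if j < D then (j + 1) * int m + int (last_arc ta (ta e) m) else v)"
  have skip: "skip_head D e j = skip" by (simp add: skip_head_def skip_def v_def)
  have r11: "reg \<sigma> 11 = v - 1" using assms(6) by (simp add: v_def)
  note run = runs_wp wp_simps build_node_def if_eq_def v_def[symmetric] skip r r11 val[unfolded One_nat_def] al
  consider "e \<notin> alive \<sigma>" | "e \<in> alive \<sigma>" "D < j + c e" | "e \<in> alive \<sigma>" "j + c e \<le> D" "he e = t"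
    | "e \<in> alive \<sigma>" "j + c e \<le> D" "he e \<noteq> t" "last_arc ta (he e) m = 0"
    | "e \<in> alive \<sigma>" "j + c e \<le> D" "he e \<noteq> t" "0 < last_arc ta (he e) m" by fastforce
  then show ?thesis
  proof cases
    case 1
    then have "take_head (alive \<sigma>) t D e j = v" by (simp add: take_head_def v_def)
    then show ?thesis using 1 v0 by (simp add: run skip_def fun_upd_twist)
  next
    case 2
    then have "take_head (alive \<sigma>) t D e j = v" by (simp add: take_head_def v_def)
    then show ?thesis using 2 v0 by (simp add: run skip_def)
  next
    case 3
    then have "take_head (alive \<sigma>) t D e j = -1" by (simp add: take_head_def v_def)
    then show ?thesis using 3 v0 by (simp add: run skip_def)
  next
    case 4
    then have "take_head (alive \<sigma>) t D e j = v" by (simp add: take_head_def v_def)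
    moreover from 4 have "he e < t \<and> \<not> t < he e \<or> t < he e \<and> \<not> he e < t" by auto
    ultimately show ?thesis using 4 v0 by (elim disjE) (simp_all add: run skip_def)
  next
    case 5
    then have "take_head (alive \<sigma>) t D e j = (j + c e) * int m + int (last_arc ta (he e) m)"
      by (simp add: take_head_def v_def)
    moreover from 5 have "he e < t \<and> \<not> t < he e \<or> t < he e \<and> \<not> he e < t" by auto
    ultimately show ?thesis using 5 v0 by (elim disjE) (simp_all add: run skip_def row)
  qed
qed

definition built :: "nat set \<Rightarrow> nat \<Rightarrow> int \<Rightarrow> int \<Rightarrow> store \<Rightarrow> bool" where
  "built H t D V \<sigma> \<longleftrightarrow> (\<forall>e<m. \<forall>j. 0 \<le> j \<longrightarrow> j \<le> D \<longrightarrow> node m e j \<le> V \<longrightarrow>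
     (let v = node m e j in arr \<sigma> 11 v = v \<and> arr \<sigma> 11 (- v) = v \<and>
       arr \<sigma> 12 v = take_head H t D e j \<and> arr \<sigma> 12 (- v) = skip_head D e j \<and> arr \<sigma> 17 v = int e))"

text \<open>Ids are injective and positive, so the entries written at a new node and at its negative
  overwrite nothing that was built before.\<close>

lemma built_step:
  assumes b: "built H t D (node m e j - 1) \<sigma>" and e: "e < m" and j: "0 \<le> j" "j \<le> D"
    and u: "arr \<sigma>' 11 = (arr \<sigma> 11)(node m e j := node m e j, - node m e j := node m e j)"
      "arr \<sigma>' 12 = (arr \<sigma> 12)(node m e j := take_head H t D e j, - node m e j := skip_head D e j)"
      "arr \<sigma>' 17 = (arr \<sigma> 17)(node m e j := int e)"
  shows "built H t D (node m e j) \<sigma>'"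
proof -
  have pos: "0 < node m e' j'" if "0 \<le> j'" for e' j' using that by (simp add: node_def add_nonneg_pos)
  have "let v = node m e' j' in arr \<sigma>' 11 v = v \<and> arr \<sigma>' 11 (- v) = v \<and>
       arr \<sigma>' 12 v = take_head H t D e' j' \<and> arr \<sigma>' 12 (- v) = skip_head D e' j' \<and> arr \<sigma>' 17 v = int e'"
    if e': "e' < m" "0 \<le> j'" "j' \<le> D" "node m e' j' \<le> node m e j" for e' j'
  proof (cases "node m e' j' = node m e j")
    case True
    then have "e' = e" "j' = j" using node_inject e e' by blast+
    then show ?thesis using u pos[OF j(1), of e] by (simp add: Let_def)
  next
    case False
    then have "node m e' j' \<le> node m e j - 1" using e' by simp
    then have "let v = node m e' j' in arr \<sigma> 11 v = v \<and> arr \<sigma> 11 (- v) = v \<and>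
       arr \<sigma> 12 v = take_head H t D e' j' \<and> arr \<sigma> 12 (- v) = skip_head D e' j' \<and> arr \<sigma> 17 v = int e'"
      using b e' unfolding built_def by blast
    then show ?thesis using u False pos[OF j(1), of e] pos[OF e'(2), of e'] by (simp add: Let_def)
  qed
  then show ?thesis unfolding built_def by blast
qed

lemma runs_build:
  assumes p: "prepared \<sigma>" and r: "reg \<sigma> 5 = int t" "reg \<sigma> 6 = D" and D: "0 \<le> D" "D < int k"
    and c: "\<And>e. e \<in> alive \<sigma> \<Longrightarrow> 0 \<le> c e"
  defines "H \<equiv> alive \<sigma>"
  shows "runs build \<sigma> (200 * (k * m)) (\<lambda>\<sigma>'. layered ta he s m t D H c (arr \<sigma>' 12) \<and>
    holds_network (int m * (D + 1)) (arr \<sigma>' 12) \<sigma>' \<and>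
    (\<forall>e<m. \<forall>j. 0 \<le> j \<longrightarrow> j \<le> D \<longrightarrow> arr \<sigma>' 17 (node m e j) = int e))"
proof -
  let ?row = "For 8 (Const 0) (Reg 2) build_node"
  let ?I = "\<lambda>j \<sigma>'. reg \<sigma>' 11 = j * int m \<and> built H t D (j * int m) \<sigma>'"
  let ?b = "for_cost (Const 0) (Reg 2) (int m - 0) 100"
  let ?t = "for_cost (Const 0) (Plus (Reg 6) (Const 1)) (D + 1 - 0) ?b"
  let ?\<sigma> = "\<sigma>\<lparr>reg := (reg \<sigma>)(11 := 0)\<rparr>"
  have r2: "reg \<sigma> 2 = int m" using p by (simp add: prepared_def)
  have 1: "runs (Assign 11 (Const 0)) \<sigma> 2 (\<lambda>\<sigma>'. \<sigma>' = ?\<sigma>)" by (simp add: runs_wp wp_simps)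
  have 2: "runs (For 9 (Const 0) (Plus (Reg 6) (Const 1)) ?row) ?\<sigma> ?t (?I (D + 1))"
  proof (rule runs_For[where I = ?I])
    have "\<not> node m e j \<le> 0" if "0 \<le> j" for e j using that by (simp add: node_def add_nonneg_pos not_le)
    then show "?I (aval (Const 0) ?\<sigma>) ?\<sigma>" by (simp add: built_def)
  next
    fix j \<sigma>1 assume j: "0 \<le> j" "j < D + 1" "reg \<sigma>1 9 = j" and I: "?I j \<sigma>1"
      and a: "loop_framed 9 ?row ?\<sigma> \<sigma>1"
    have a1: "agree {8, 9, 11, 12, 13} {11, 12, 17} \<sigma> \<sigma>1"
      by (rule agree_trans[of _ _ _ ?\<sigma>]) (use a in \<open>auto simp: agree_def\<close>)
    let ?K = "\<lambda>i \<sigma>'. reg \<sigma>' 11 = j * int m + i \<and> built H t D (j * int m + i) \<sigma>'"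
    have "runs ?row \<sigma>1 ?b (?K (int m))"
    proof (rule runs_For[where I = ?K])
      show "?K (aval (Const 0) \<sigma>1) \<sigma>1" using I by simp
    next
      fix i \<sigma>2 assume i: "0 \<le> i" "i < int m" "reg \<sigma>2 8 = i" and K: "?K i \<sigma>2"
        and "loop_framed 8 build_node \<sigma>1 \<sigma>2"
      then have a12: "agree {8, 11, 12, 13} {11, 12, 17} \<sigma>1 \<sigma>2" by simp
      have a2: "agree {8, 9, 11, 12, 13} {11, 12, 17} \<sigma> \<sigma>2"
        using a1 a12 by (auto simp: agree_def)
      define e where "e = nat i"
      have e: "e < m" "int e = i" using i by (auto simp: e_def)
      have nd: "node m e j - 1 = j * int m + i" "node m e j = j * int m + (i + 1)"
        using e by (simp_all add: node_def)
      have H: "alive \<sigma>2 = H" using a2 by (simp add: alive_def H_def agree_def)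
      have "reg \<sigma>2 9 = j" using a12 j by (simp add: agree_def)
      moreover have "prepared \<sigma>2" using prepared_agree[OF p a2] by simp
      moreover have "reg \<sigma>2 5 = int t" "reg \<sigma>2 6 = D" using a2 r by (simp_all add: agree_def)
      ultimately have "runs build_node \<sigma>2 100 (\<lambda>\<sigma>'. reg \<sigma>' 11 = node m e j \<and>
          arr \<sigma>' 11 = (arr \<sigma>2 11)(node m e j := node m e j, - node m e j := node m e j) \<and>
          arr \<sigma>' 12 = (arr \<sigma>2 12)(node m e j := take_head (alive \<sigma>2) t D e j, - node m e j := skip_head D e j) \<and>
          arr \<sigma>' 17 = (arr \<sigma>2 17)(node m e j := int e))"
        using i e j D c K nd H unfolding H_def by (intro runs_build_node) auto
      then show "runs build_node \<sigma>2 100 (?K (i + 1))"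
      proof (rule runs_mono)
        fix \<sigma>3 :: store assume "reg \<sigma>3 11 = node m e j \<and>
          arr \<sigma>3 11 = (arr \<sigma>2 11)(node m e j := node m e j, - node m e j := node m e j) \<and>
          arr \<sigma>3 12 = (arr \<sigma>2 12)(node m e j := take_head (alive \<sigma>2) t D e j, - node m e j := skip_head D e j) \<and>
          arr \<sigma>3 17 = (arr \<sigma>2 17)(node m e j := int e)"
        then show "?K (i + 1) \<sigma>3"
          using built_step[of H t D e j \<sigma>2 \<sigma>3] K e j unfolding nd H by simp
      qed simp
    next
      fix \<sigma>2 assume "loop_framed 8 build_node \<sigma>1 \<sigma>2"
      then show "aval (Reg 2) \<sigma>2 = int m" using a1 r2 by (simp add: agree_def)
    qed (auto simp: built_def)
    then show "runs ?row \<sigma>1 ?b (?I (j + 1))"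
      by (rule runs_mono) (simp_all add: algebra_simps)
  next
    fix \<sigma>1 assume "loop_framed 9 ?row ?\<sigma> \<sigma>1"
    then show "aval (Plus (Reg 6) (Const 1)) \<sigma>1 = D + 1" using r by (simp add: agree_def)
  qed (use D in \<open>auto simp: built_def\<close>)
  define M where "M = int m * (D + 1)"
  let ?end = "Assign 7 (Reg 11) ;; Put 11 (Const 0) (Const 0) ;; Put 12 (Const 0) (Get 7 (Reg 3))"
  let ?R = "\<lambda>\<sigma>'. layered ta he s m t D H c (arr \<sigma>' 12) \<and> holds_network M (arr \<sigma>' 12) \<sigma>' \<and>
    (\<forall>e<m. \<forall>j. 0 \<le> j \<longrightarrow> j \<le> D \<longrightarrow> arr \<sigma>' 17 (node m e j) = int e)"
  have "runs build \<sigma> (2 + (?t + 10)) ?R"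
    unfolding build_def
  proof (rule runs_Seq[OF 1], hypsubst, rule runs_Seq[OF runs_agree[OF 2]], elim conjE)
    fix \<sigma>1 assume r11: "reg \<sigma>1 11 = (D + 1) * int m" and bl: "built H t D ((D + 1) * int m) \<sigma>1"
      and "framed (For 9 (Const 0) (Plus (Reg 6) (Const 1)) ?row) ?\<sigma> \<sigma>1"
    then have a1: "agree {8, 9, 11, 12, 13} {11, 12, 17} \<sigma> \<sigma>1" by (simp add: agree_def)
    let ?\<sigma>2 = "\<sigma>1\<lparr>reg := (reg \<sigma>1)(7 := M),
      arr := (arr \<sigma>1)(11 := (arr \<sigma>1 11)(0 := 0), 12 := (arr \<sigma>1 12)(0 := int (last_arc ta s m)))\<rparr>"
    have "prepared \<sigma>1" using prepared_agree[OF p a1] by simp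
    then have "arr \<sigma>1 7 (reg \<sigma>1 3) = int (last_arc ta s m)" using s_less by (simp add: prepared_def)
    moreover have "reg \<sigma>1 11 = M" using r11 by (simp add: M_def)
    ultimately have fin: "runs ?end \<sigma>1 10 (\<lambda>\<sigma>'. \<sigma>' = ?\<sigma>2)" by (simp add: runs_wp wp_simps)
    have R: "?R ?\<sigma>2"
    proof -
      have Hm: "H \<subseteq> {..<m}" by (auto simp: H_def alive_def)
      have pos: "0 < node m e j" if "0 \<le> j" for e j using that by (simp add: node_def add_nonneg_pos)
      have le: "node m e j \<le> (D + 1) * int m" if "e < m" "0 \<le> j" "j \<le> D" for e j
      proof -
        have "j * int m \<le> D * int m" using that by (intro mult_right_mono) auto
        moreover have "int e + 1 \<le> int m" using that by simp
        ultimately show ?thesis unfolding node_def distrib_right by linarith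
      qed
      have spec: "arr ?\<sigma>2 11 (node m e j) = node m e j" "arr ?\<sigma>2 11 (- node m e j) = node m e j"
        "arr ?\<sigma>2 12 (node m e j) = take_head H t D e j" "arr ?\<sigma>2 12 (- node m e j) = skip_head D e j"
        "arr ?\<sigma>2 17 (node m e j) = int e" if "e < m" "0 \<le> j" "j \<le> D" for e j
        using bl le[OF that] pos[OF that(2), of e] that unfolding built_def Let_def by auto
      interpret L: layered ta he s m t D H c "arr ?\<sigma>2 12"
      proof
        show "0 < m" "0 \<le> D" "H \<subseteq> {..<m}" using m_pos D Hm by auto
        show "arr ?\<sigma>2 12 0 = int (last_arc ta s m)" by simp
        show "0 \<le> c e" if "e \<in> H" for e using c that by (simp add: H_def)
      qed (simp_all only: spec take_head_def skip_head_def)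
      have LM: "L.M = M" by (simp add: L.M_def M_def)
      have range: "-1 \<le> arr ?\<sigma>2 12 q \<and> arr ?\<sigma>2 12 q \<le> M \<and> arr ?\<sigma>2 11 q = \<bar>q\<bar>" if q: "q \<in> {- M..M}" for q
      proof (cases "q = 0")
        case True
        have "int (last_arc ta s m) \<le> int m" using last_arc_le by simp
        also have "int m * 1 \<le> M" unfolding M_def using D by (intro mult_left_mono) auto
        then have "int m \<le> M" by simp
        finally show ?thesis using True by simp
      next
        case False
        then have "1 \<le> \<bar>q\<bar>" "\<bar>q\<bar> \<le> L.M" using q LM by auto
        then obtain e j where ej: "e < m" "0 \<le> j" "j \<le> D" "\<bar>q\<bar> = node m e j" by (rule L.node_cases)
        have entry: "-1 \<le> i * int m + int (last_arc ta x b) \<and> i * int m + int (last_arc ta x b) \<le> M"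
          if "0 \<le> i" "i \<le> D" "b \<le> m" for i x b
        proof -
          have "i * int m \<le> D * int m" using that by (intro mult_right_mono) auto
          moreover have "int (last_arc ta x b) \<le> int m" using last_arc_le[of ta x b] that by simp
          moreover have "M = D * int m + int m" by (simp add: M_def algebra_simps)
          moreover have "0 \<le> i * int m" using that by simp
          ultimately show ?thesis by linarith
        qed
        have nM: "0 \<le> node m e j" "node m e j \<le> M" using L.node_bounds[OF ej(1-3)] LM by auto
        have ce: "e \<in> H \<Longrightarrow> 0 \<le> c e" using c by (simp add: H_def)
        have "-1 \<le> take_head H t D e j \<and> take_head H t D e j \<le> M"
          using entry[of "j + c e" m "he e"] nM ce ej by (auto simp: take_head_def)
        moreover have "-1 \<le> skip_head D e j \<and> skip_head D e j \<le> M"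
          using entry[of j e "ta e"] entry[of "j + 1" m "ta e"] nM ej by (auto simp: skip_head_def)
        moreover have "q = node m e j \<or> q = - node m e j" using ej(4) by linarith
        ultimately show ?thesis using spec[OF ej(1-3)] nM by (elim disjE) auto
      qed
      have "0 \<le> M" using D by (simp add: M_def)
      then have "holds_network M (arr ?\<sigma>2 12) ?\<sigma>2"
        unfolding holds_network_def using range by simp
      then show ?thesis using L.layered_axioms spec(5) by blast
    qed
    show "runs ?end \<sigma>1 10 ?R" by (rule runs_mono[OF fin], simp, hypsubst, rule R)
  qed
  then show ?thesis unfolding M_def
  proof (rule runs_mono)
    have kD: "nat (D + 1) \<le> k" using D by simp
    have "1 \<le> k * m" using D m_pos by simp
    have "2 + (?t + 10) = 19 + nat (D + 1) * (m * 107 + 14)" by simp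
    also have "\<dots> \<le> 19 + k * (m * 107 + 14 * m)"
      using kD m_pos by (intro add_mono mult_le_mono order_refl) auto
    also have "\<dots> = 19 + 121 * (k * m)" by (simp add: algebra_simps)
    also have "\<dots> \<le> 200 * (k * m)" using \<open>1 \<le> k * m\<close> by linarith
    finally show "2 + (?t + 10) \<le> 200 * (k * m)" .
  qed
qed

end

section \<open>Thinning out the arcs into one target\<close>

text \<open>Arcs with negative ids are skips and the arc \<open>0\<close> leads to a list, so arcs
  into the sink have positive ids. A negative head can only be the sink.\<close>

definition collect :: com where
  "collect =
     For 11 (Const 1) (Plus (Reg 7) (Const 1))
       (Cond (Conj (Less (Const 0) (Get 13 (Reg 11))) (Less (Get 12 (Reg 11)) (Const 0)))
         (Put 10 (Get 17 (Reg 11)) (Const 1)) Skip)"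

definition layer_pass :: com where
  "layer_pass = build ;; find_flow ;; collect"

definition drop_unkept :: com where
  "drop_unkept =
     if_eq (Get 1 (Reg 8)) (Reg 5)
       (Cond (Less (Get 10 (Reg 8)) (Const 1)) (Put 3 (Reg 8) (Const 0)) Skip) Skip"

text \<open>Arcs are deleted only after the passes for all cost bounds, so that all of them refer to
  the same graph and the kept arcs can simply be united.\<close>

definition process_target :: com where
  "process_target =
     For 8 (Const 0) (Reg 2) (Put 10 (Reg 8) (Const 0)) ;;
     For 6 (Const 0) (Reg 0) layer_pass ;;
     For 8 (Const 0) (Reg 2) drop_unkept"

definition process_targets :: com where
  "process_targets = For 5 (Const 0) (Reg 1) process_target"

lemma written_target [simp]:
  "regs_written collect = {11}" "arrs_written collect = {10}"
  "regs_written layer_pass = {7, 8, 9, 11, 12, 13, 17, 18, 19, 20, 21, 22, 23}"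
  "arrs_written layer_pass = {10, 11, 12, 13, 14, 15, 16, 17}"
  "regs_written drop_unkept = {}" "arrs_written drop_unkept = {3}"
  "regs_written process_target = {6, 7, 8, 9, 11, 12, 13, 17, 18, 19, 20, 21, 22, 23}"
  "arrs_written process_target = {3, 10, 11, 12, 13, 14, 15, 16, 17}"
  by (auto simp: collect_def layer_pass_def drop_unkept_def process_target_def if_eq_def written_simps)

section \<open>Size and tolerance for one target\<close>

context instance_data
begin

definition kept :: "store \<Rightarrow> nat set" where
  "kept \<sigma> = {e. e < m \<and> 0 < arr \<sigma> 10 (int e)}"

definition layer_tolerant :: "nat set \<Rightarrow> nat \<Rightarrow> nat set \<Rightarrow> int \<Rightarrow> bool" where
  "layer_tolerant H t K D \<longleftrightarrow> (\<forall>I d. (\<Sum>e<m. I e) \<le> k \<longrightarrow> walk_cost H (\<lambda>e. c e + int (I e)) t d \<longrightarrow>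
     d \<le> D \<longrightarrow> (\<exists>d'\<le>D. walk_cost {e \<in> H. he e = t \<longrightarrow> e \<in> K} (\<lambda>e. c e + int (I e)) t d'))"

lemma layer_tolerant_mono:
  assumes "layer_tolerant H t K D" "K \<subseteq> K'"
  shows "layer_tolerant H t K' D"
  unfolding layer_tolerant_def
proof (intro allI impI)
  fix I :: "nat \<Rightarrow> nat" and d
  assume "(\<Sum>e<m. I e) \<le> k" "walk_cost H (\<lambda>e. c e + int (I e)) t d" "d \<le> D"
  then obtain d' where "d' \<le> D" "walk_cost {e \<in> H. he e = t \<longrightarrow> e \<in> K} (\<lambda>e. c e + int (I e)) t d'"
    using assms(1) unfolding layer_tolerant_def by blast
  moreover have "{e \<in> H. he e = t \<longrightarrow> e \<in> K} \<subseteq> {e \<in> H. he e = t \<longrightarrow> e \<in> K'}" using assms(2) by blast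
  ultimately show "\<exists>d'\<le>D. walk_cost {e \<in> H. he e = t \<longrightarrow> e \<in> K'} (\<lambda>e. c e + int (I e)) t d'"
    using walk_cost_mono by blast
qed

text \<open>A bound for one layer pass: \<open>k + 1\<close> flows, \<open>2 ^ k + 1\<close>
  searches for each, and a search that is quadratic in the size of a network with at most
  \<open>m * k\<close> nodes besides source and sink.\<close>

definition size_bound :: nat where
  "size_bound = 2000 * (k + 1) * (2 ^ k + 1) * ((m * k + 1) * (m * k + 2))"

lemma runs_collect:
  assumes r: "reg \<sigma> 7 = int m * (D + 1)" and D: "0 \<le> D"
    and ar: "\<And>e j. e < m \<Longrightarrow> 0 \<le> j \<Longrightarrow> j \<le> D \<Longrightarrow> arr \<sigma> 17 (node m e j) = int e"
    and cases: "\<And>v. 1 \<le> v \<Longrightarrow> v \<le> int m * (D + 1) \<Longrightarrow> \<exists>e j. e < m \<and> 0 \<le> j \<and> j \<le> D \<and> v = node m e j"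
  shows "runs collect \<sigma> (40 * nat (int m * (D + 1) + 1)) (\<lambda>\<sigma>'. kept \<sigma>' = kept \<sigma> \<union>
    {e. e < m \<and> (\<exists>j. 0 \<le> j \<and> j \<le> D \<and> 1 \<le> node m e j \<and> node m e j < int m * (D + 1) + 1 \<and>
      arr \<sigma> 12 (node m e j) < 0 \<and> 0 < arr \<sigma> 13 (node m e j))})"
proof -
  define M where "M = int m * (D + 1)"
  have M: "0 \<le> M" using D by (simp add: M_def)
  let ?c = "Cond (Conj (Less (Const 0) (Get 13 (Reg 11))) (Less (Get 12 (Reg 11)) (Const 0)))
         (Put 10 (Get 17 (Reg 11)) (Const 1)) Skip"
  let ?E = "\<lambda>v. {e. e < m \<and> (\<exists>j. 0 \<le> j \<and> j \<le> D \<and> 1 \<le> node m e j \<and> node m e j < v \<and>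
      arr \<sigma> 12 (node m e j) < 0 \<and> 0 < arr \<sigma> 13 (node m e j))}"
  let ?I = "\<lambda>v \<sigma>'. kept \<sigma>' = kept \<sigma> \<union> ?E v"
  have "runs collect \<sigma> (for_cost (Const 1) (Plus (Reg 7) (Const 1)) (M + 1 - 1) 20) (?I (M + 1))"
    unfolding collect_def
  proof (rule runs_For[where I = ?I])
    fix v \<sigma>' assume v: "1 \<le> v" "v < M + 1" "reg \<sigma>' 11 = v" and I: "?I v \<sigma>'"
      and "loop_framed 11 ?c \<sigma> \<sigma>'"
    then have a: "arr \<sigma>' 12 = arr \<sigma> 12" "arr \<sigma>' 13 = arr \<sigma> 13" "arr \<sigma>' 17 = arr \<sigma> 17"
      by (simp_all add: agree_def)
    obtain e j where ej: "e < m" "0 \<le> j" "j \<le> D" "v = node m e j" using cases[of v] v by (auto simp: M_def)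
    have s: "?E (v + 1) = ?E v \<union> (if arr \<sigma> 12 v < 0 \<and> 0 < arr \<sigma> 13 v then {e} else {})"
    proof -
      have "x < v + 1 \<longleftrightarrow> x < v \<or> x = v" for x by linarith
      then have "?E (v + 1) = ?E v \<union> {e'. e' < m \<and> (\<exists>j'. 0 \<le> j' \<and> j' \<le> D \<and> node m e' j' = v \<and>
          arr \<sigma> 12 v < 0 \<and> 0 < arr \<sigma> 13 v)}" using v by auto
      also have "{e'. e' < m \<and> (\<exists>j'. 0 \<le> j' \<and> j' \<le> D \<and> node m e' j' = v \<and>
          arr \<sigma> 12 v < 0 \<and> 0 < arr \<sigma> 13 v)} = (if arr \<sigma> 12 v < 0 \<and> 0 < arr \<sigma> 13 v then {e} else {})"
        using ej node_inject[OF _ ej(1)] by auto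
      finally show ?thesis .
    qed
    show "runs ?c \<sigma>' 20 (?I (v + 1))"
    proof (cases "arr \<sigma> 12 v < 0 \<and> 0 < arr \<sigma> 13 v")
      case True
      have "kept (\<sigma>'\<lparr>arr := (arr \<sigma>')(10 := (arr \<sigma>' 10)(int e := 1))\<rparr>) = insert e (kept \<sigma>')"
        using ej(1) by (auto simp: kept_def)
      moreover have "arr \<sigma> 17 v = int e" using ar ej by simp
      ultimately show ?thesis unfolding s using True I v by (simp add: runs_wp wp_simps a)
    next
      case False
      then show ?thesis unfolding s using I v by (auto simp: runs_wp wp_simps a)
    qed
  next
    fix \<sigma>' assume "loop_framed 11 ?c \<sigma> \<sigma>'"
    then show "aval (Plus (Reg 7) (Const 1)) \<sigma>' = M + 1" using r by (simp add: agree_def M_def)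
  qed (use M in \<open>auto simp: kept_def\<close>)
  then show ?thesis unfolding M_def[symmetric]
    by (rule runs_mono) (use M in simp_all)
qed

lemma runs_layer_pass:
  assumes p: "prepared \<sigma>" and r: "reg \<sigma> 5 = int t" "reg \<sigma> 6 = D" and D: "0 \<le> D" "D < int k"
    and c: "\<And>e. e \<in> alive \<sigma> \<Longrightarrow> 0 \<le> c e"
  shows "runs layer_pass \<sigma> size_bound (\<lambda>\<sigma>'. kept \<sigma> \<subseteq> kept \<sigma>' \<and> card (kept \<sigma>') \<le> card (kept \<sigma>) + 2 ^ k \<and>
    (t \<noteq> s \<longrightarrow> layer_tolerant (alive \<sigma>) t (kept \<sigma>') D))"
proof -
  define M where "M = int m * (D + 1)"
  define N where "N = m * k"
  have "int m * (D + 1) \<le> int m * int k" using D by (intro mult_left_mono) auto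
  then have MN: "0 \<le> M" "nat M \<le> N" using D by (auto simp: M_def N_def nat_le_iff)
  define X where "X = (N + 1) * (N + 2)"
  have X: "nat (M + 1) * nat (M + 2) \<le> X" unfolding X_def using MN by (intro mult_le_mono) auto
  let ?R = "\<lambda>\<sigma>'. kept \<sigma> \<subseteq> kept \<sigma>' \<and> card (kept \<sigma>') \<le> card (kept \<sigma>) + 2 ^ k \<and>
    (t \<noteq> s \<longrightarrow> layer_tolerant (alive \<sigma>) t (kept \<sigma>') D)"
  let ?tf = "1000 * (k + 1) * (2 ^ k + 1) * (nat (M + 1) * nat (M + 2))"
  have "runs layer_pass \<sigma> (200 * (k * m) + (?tf + 40 * nat (M + 1))) ?R"
    unfolding layer_pass_def
  proof (rule runs_Seq[OF runs_agree[OF runs_build[OF p r D c]]], assumption, elim conjE)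
    fix \<sigma>1 assume lay: "layered ta he s m t D (alive \<sigma>) c (arr \<sigma>1 12)"
      and net: "holds_network (int m * (D + 1)) (arr \<sigma>1 12) \<sigma>1"
      and ar: "\<forall>e<m. \<forall>j. 0 \<le> j \<longrightarrow> j \<le> D \<longrightarrow> arr \<sigma>1 17 (node m e j) = int e"
      and a1: "framed build \<sigma> \<sigma>1"
    define h where "h = arr \<sigma>1 12"
    interpret L: layered ta he s m t D "alive \<sigma>" c h using lay by (simp add: h_def)
    have LM: "L.M = M" by (simp add: L.M_def M_def)
    have "prepared \<sigma>1" using prepared_agree[OF p a1] by simp
    then have "reg \<sigma>1 0 = int k" "reg \<sigma>1 4 = 2 ^ k + 1" by (simp_all add: prepared_def)
    then have 2: "runs find_flow \<sigma>1 ?tf (\<lambda>\<sigma>'. tolerant_flow M h k (arr \<sigma>' 13))"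
      using net unfolding M_def h_def by (intro runs_find_flow)
    show "runs (find_flow ;; collect) \<sigma>1 (?tf + 40 * nat (M + 1)) ?R"
    proof (rule runs_Seq[OF runs_agree[OF 2]], elim conjE)
      fix \<sigma>2 assume tf: "tolerant_flow M h k (arr \<sigma>2 13)"
        and a2: "framed find_flow \<sigma>1 \<sigma>2"
      define E where "E = {e. e < m \<and> (\<exists>j. 0 \<le> j \<and> j \<le> D \<and> h (node m e j) = -1 \<and> arr \<sigma>2 13 (node m e j) = 1)}"
      have unch: "reg \<sigma>2 7 = M" "arr \<sigma>2 12 = h" "arr \<sigma>2 17 = arr \<sigma>1 17" "kept \<sigma>2 = kept \<sigma>"
        using net a1 a2 by (simp_all add: holds_network_def agree_def written_simps M_def h_def kept_def)
      have "runs collect \<sigma>2 (40 * nat (int m * (D + 1) + 1)) (\<lambda>\<sigma>'. kept \<sigma>' = kept \<sigma>2 \<union>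
        {e. e < m \<and> (\<exists>j. 0 \<le> j \<and> j \<le> D \<and> 1 \<le> node m e j \<and> node m e j < int m * (D + 1) + 1 \<and>
          arr \<sigma>2 12 (node m e j) < 0 \<and> 0 < arr \<sigma>2 13 (node m e j))})"
      proof (rule runs_collect)
        fix v assume "1 \<le> v" "v \<le> int m * (D + 1)"
        then obtain e j where "e < m" "0 \<le> j" "j \<le> D" "v = node m e j"
          using L.node_cases[of v] LM by (auto simp: M_def)
        then show "\<exists>e j. e < m \<and> 0 \<le> j \<and> j \<le> D \<and> v = node m e j" by blast
      qed (use unch ar D in \<open>auto simp: M_def\<close>)
      then have 3: "runs collect \<sigma>2 (40 * nat (M + 1)) (\<lambda>\<sigma>'. kept \<sigma>' = kept \<sigma> \<union> E)"
        unfolding M_def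
      proof (rule runs_mono)
        \<comment> \<open>The program only tests signs. As the flow is 0 or 1 and heads are at least
          \<open>-1\<close>, this amounts to equality with 1 and with the sink.\<close>
        have "(1 \<le> v \<and> v < M + 1 \<and> h v < 0 \<and> 0 < arr \<sigma>2 13 v) \<longleftrightarrow> (h v = -1 \<and> arr \<sigma>2 13 v = 1)"
          if "e < m" "0 \<le> j" "j \<le> D" "v = node m e j" for v e j
        proof -
          have v: "1 \<le> v" "v \<le> M" using L.node_bounds[OF that(1-3)] that(4) LM by auto
          then have vM: "v \<in> {- M..M}" by simp
          have "arr \<sigma>2 13 v = 0 \<or> arr \<sigma>2 13 v = 1" using tf vM unfolding tolerant_flow_def by blast
          moreover have "-1 \<le> h v" using net vM by (auto simp: holds_network_def h_def M_def)
          ultimately show ?thesis using v by auto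
        qed
        then have E': "{e. e < m \<and> (\<exists>j. 0 \<le> j \<and> j \<le> D \<and> 1 \<le> node m e j \<and> node m e j < M + 1 \<and>
          h (node m e j) < 0 \<and> 0 < arr \<sigma>2 13 (node m e j))} = E" unfolding E_def by blast
        fix \<sigma>3 assume "kept \<sigma>3 = kept \<sigma>2 \<union> {e. e < m \<and> (\<exists>j. 0 \<le> j \<and> j \<le> D \<and> 1 \<le> node m e j \<and>
          node m e j < int m * (D + 1) + 1 \<and> arr \<sigma>2 12 (node m e j) < 0 \<and> 0 < arr \<sigma>2 13 (node m e j))}"
        then show "kept \<sigma>3 = kept \<sigma> \<union> E" using E' unch by (simp add: M_def)
      qed simp
      have cE: "card E \<le> 2 ^ k" using L.tolerant_flow_card[of k "arr \<sigma>2 13"] tf LM by (simp add: E_def)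
      show "runs collect \<sigma>2 (40 * nat (M + 1)) ?R"
      proof (rule runs_mono[OF 3])
        fix \<sigma>3 assume k3: "kept \<sigma>3 = kept \<sigma> \<union> E"
        have "card (kept \<sigma>3) \<le> card (kept \<sigma>) + card E" unfolding k3 by (rule card_Un_le)
        moreover have "layer_tolerant (alive \<sigma>) t (kept \<sigma>3) D" if "t \<noteq> s"
          unfolding layer_tolerant_def
        proof (intro allI impI)
          fix I :: "nat \<Rightarrow> nat" and d
          assume "(\<Sum>e<m. I e) \<le> k" "walk_cost (alive \<sigma>) (\<lambda>e. c e + int (I e)) t d" "d \<le> D"
          then show "\<exists>d'\<le>D. walk_cost {e \<in> alive \<sigma>. he e = t \<longrightarrow> e \<in> kept \<sigma>3} (\<lambda>e. c e + int (I e)) t d'"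
            using tf that k3 LM
            by (intro L.tolerant_flow_layer[of k "arr \<sigma>2 13"]) (auto simp: E_def)
        qed
        ultimately show "?R \<sigma>3" using cE k3 by auto
      qed simp
    qed
  qed
  then show ?thesis
  proof (rule runs_mono)
    define Q where "Q = (k + 1) * (2 ^ k + 1)"
    have Q: "1 \<le> Q" by (simp add: Q_def)
    have "k * m \<le> X" "nat (M + 1) \<le> X" using MN by (simp_all add: X_def N_def mult.commute)
    moreover have "1 * X \<le> Q * X" using Q by (rule mult_le_mono1)
    ultimately have "200 * (k * m) + 40 * nat (M + 1) \<le> 1000 * (Q * X)" by linarith
    moreover have "?tf = 1000 * (Q * (nat (M + 1) * nat (M + 2)))" by (simp only: Q_def mult.assoc)
    moreover have "Q * (nat (M + 1) * nat (M + 2)) \<le> Q * X" using X by (rule mult_le_mono2)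
    moreover have "size_bound = 2000 * (Q * X)" by (simp only: size_bound_def Q_def X_def N_def mult.assoc)
    ultimately show "200 * (k * m) + (?tf + 40 * nat (M + 1)) \<le> size_bound" by linarith
  qed
qed

lemma size_bound_ge: "m + 1 \<le> size_bound" "1 \<le> size_bound" if "1 \<le> k"
proof -
  have "m * 1 \<le> m * k" using that by (intro mult_le_mono) auto
  then have "1 * (m + 1) \<le> (m * k + 2) * (m * k + 1)" by (intro mult_le_mono) auto
  moreover have "1 * ((m * k + 1) * (m * k + 2)) \<le> 2000 * (k + 1) * (2 ^ k + 1) * ((m * k + 1) * (m * k + 2))"
    by (rule mult_le_mono1) simp
  ultimately show "m + 1 \<le> size_bound" unfolding size_bound_def by (simp add: mult.commute)
  then show "1 \<le> size_bound" by simp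
qed

lemma runs_process_target:
  assumes p: "prepared \<sigma>" and r: "reg \<sigma> 5 = int t" and k: "1 \<le> k"
    and c: "\<And>e. e \<in> alive \<sigma> \<Longrightarrow> 0 \<le> c e"
  shows "runs process_target \<sigma> (200 * k * size_bound) (\<lambda>\<sigma>'. \<exists>K.
    alive \<sigma>' = {e \<in> alive \<sigma>. he e = t \<longrightarrow> e \<in> K} \<and> finite K \<and> card K \<le> k * 2 ^ k \<and>
    (t \<noteq> s \<longrightarrow> (\<forall>D. 0 \<le> D \<longrightarrow> D < int k \<longrightarrow> layer_tolerant (alive \<sigma>) t K D)))"
    (is "runs _ _ _ ?R")
proof -
  have pr: "reg \<sigma> 2 = int m" "reg \<sigma> 0 = int k" using p by (simp_all add: prepared_def)
  let ?c1 = "For 8 (Const 0) (Reg 2) (Put 10 (Reg 8) (Const 0))"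
  let ?t1 = "for_cost (Const 0) (Reg 2) (int m - 0) 3"
  have 1: "runs ?c1 \<sigma> ?t1 (\<lambda>\<sigma>'. \<forall>e\<in>{0..<int m}. arr \<sigma>' 10 e = 0)"
    by (rule runs_For[where I = "\<lambda>i \<sigma>'. \<forall>e\<in>{0..<i}. arr \<sigma>' 10 e = 0"])
      (use pr in \<open>auto simp: agree_def runs_wp wp_simps\<close>)
  let ?c2 = "For 6 (Const 0) (Reg 0) layer_pass"
  let ?t2 = "for_cost (Const 0) (Reg 0) (int k - 0) size_bound"
  let ?c3 = "For 8 (Const 0) (Reg 2) drop_unkept"
  let ?t3 = "for_cost (Const 0) (Reg 2) (int m - 0) 30"
  have "runs process_target \<sigma> (?t1 + (?t2 + ?t3)) ?R"
    unfolding process_target_def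
  proof (rule runs_Seq[OF runs_agree[OF 1]], elim conjE)
    fix \<sigma>1 assume z: "\<forall>e\<in>{0..<int m}. arr \<sigma>1 10 e = 0"
      and "framed ?c1 \<sigma> \<sigma>1"
    then have a1: "agree {8} {10} \<sigma> \<sigma>1" by simp
    have p1: "prepared \<sigma>1" and al1: "alive \<sigma>1 = alive \<sigma>" and r1: "reg \<sigma>1 5 = int t" "reg \<sigma>1 0 = int k"
      using prepared_agree[OF p a1] a1 r pr by (simp_all add: agree_def alive_def)
    let ?I = "\<lambda>i \<sigma>'. card (kept \<sigma>') \<le> nat i * 2 ^ k \<and>
      (t \<noteq> s \<longrightarrow> (\<forall>D. 0 \<le> D \<longrightarrow> D < i \<longrightarrow> layer_tolerant (alive \<sigma>) t (kept \<sigma>') D))"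
    have 2: "runs ?c2 \<sigma>1 ?t2 (?I (int k))"
    proof (rule runs_For[where I = ?I])
      have "kept \<sigma>1 = {}" using z by (simp add: kept_def)
      then show "?I (aval (Const 0) \<sigma>1) \<sigma>1" by simp
    next
      fix i \<sigma>2 assume i: "0 \<le> i" "i < int k" "reg \<sigma>2 6 = i" and I: "?I i \<sigma>2"
        and a: "loop_framed 6 layer_pass \<sigma>1 \<sigma>2"
      have p2: "prepared \<sigma>2" using prepared_agree[OF p1 a] by simp
      have al2: "alive \<sigma>2 = alive \<sigma>" and r2: "reg \<sigma>2 5 = int t"
        using a al1 r1 by (simp_all add: agree_def alive_def)
      have c2: "\<And>e. e \<in> alive \<sigma>2 \<Longrightarrow> 0 \<le> c e" using c al2 by simp
      show "runs layer_pass \<sigma>2 size_bound (?I (i + 1))"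
      proof (rule runs_mono[OF runs_layer_pass[OF p2 r2 i(3,1,2) c2]], assumption, simp, elim conjE)
        fix \<sigma>3 assume s: "kept \<sigma>2 \<subseteq> kept \<sigma>3" and cd: "card (kept \<sigma>3) \<le> card (kept \<sigma>2) + 2 ^ k"
          and lt: "t \<noteq> s \<longrightarrow> layer_tolerant (alive \<sigma>2) t (kept \<sigma>3) i"
        have "card (kept \<sigma>3) \<le> nat (i + 1) * 2 ^ k"
          using cd I i by (simp add: nat_add_distrib)
        moreover have "layer_tolerant (alive \<sigma>) t (kept \<sigma>3) D" if "t \<noteq> s" "0 \<le> D" "D < i + 1" for D
        proof (cases "D = i")
          case True
          then show ?thesis using lt that al2 by simp
        next
          case False
          then have "layer_tolerant (alive \<sigma>) t (kept \<sigma>2) D" using I that by simp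
          then show ?thesis using s by (rule layer_tolerant_mono)
        qed
        ultimately show "?I (i + 1) \<sigma>3" by blast
      qed
    next
      fix \<sigma>2 assume "loop_framed 6 layer_pass \<sigma>1 \<sigma>2"
      then show "aval (Reg 0) \<sigma>2 = int k" using r1 by (simp add: agree_def)
    qed (auto simp: kept_def)
    show "runs (?c2 ;; ?c3) \<sigma>1 (?t2 + ?t3) ?R"
    proof (rule runs_Seq[OF runs_agree[OF 2]], elim conjE)
      fix \<sigma>2 assume cd: "card (kept \<sigma>2) \<le> nat (int k) * 2 ^ k"
        and lt: "t \<noteq> s \<longrightarrow> (\<forall>D. 0 \<le> D \<longrightarrow> D < int k \<longrightarrow> layer_tolerant (alive \<sigma>) t (kept \<sigma>2) D)"
        and a2: "framed ?c2 \<sigma>1 \<sigma>2"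
      have p2: "prepared \<sigma>2" using prepared_agree[OF p1 a2] by simp
      have al2: "alive \<sigma>2 = alive \<sigma>" and r2: "reg \<sigma>2 5 = int t"
        using a2 al1 r1 by (simp_all add: agree_def alive_def)
      let ?A = "\<lambda>i. {e \<in> alive \<sigma>. int e < i \<longrightarrow> he e = t \<longrightarrow> e \<in> kept \<sigma>2}"
      let ?K = "\<lambda>i \<sigma>'. alive \<sigma>' = ?A i"
      have "runs ?c3 \<sigma>2 ?t3 (?K (int m))"
      proof (rule runs_For[where I = ?K])
        show "?K (aval (Const 0) \<sigma>2) \<sigma>2" using al2 by simp
      next
        fix i \<sigma>3 assume i: "0 \<le> i" "i < int m" "reg \<sigma>3 8 = i" and K: "?K i \<sigma>3"
          and a: "loop_framed 8 drop_unkept \<sigma>2 \<sigma>3"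
        define e where "e = nat i"
        have e: "e < m" "int e = i" using i by (auto simp: e_def)
        have v: "arr \<sigma>3 1 i = int (he e)" "reg \<sigma>3 5 = int t" "arr \<sigma>3 10 = arr \<sigma>2 10"
          using p2 r2 a e by (auto simp: prepared_def agree_def)
        have lt: "int e' < i + 1 \<longleftrightarrow> int e' < i \<or> e' = e" for e' using e by auto
        have ke: "e \<in> kept \<sigma>2 \<longleftrightarrow> 0 < arr \<sigma>2 10 i" using e by (simp add: kept_def)
        consider "he e = t" "arr \<sigma>2 10 i < 1" | "he e = t" "1 \<le> arr \<sigma>2 10 i"
          | "he e < t" | "t < he e" by linarith
        then show "runs drop_unkept \<sigma>3 30 (?K (i + 1))"
        proof cases
          case 1
          have "alive (\<sigma>3\<lparr>arr := (arr \<sigma>3)(3 := (arr \<sigma>3 3)(i := 0))\<rparr>) = alive \<sigma>3 - {e}"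
            using e by (auto simp: alive_def)
          also have "\<dots> = ?A (i + 1)" unfolding K lt using 1 ke by auto
          finally show ?thesis using 1 v[unfolded One_nat_def] i
            by (simp add: runs_wp wp_simps drop_unkept_def if_eq_def)
        next
          case 2
          then have "?A i = ?A (i + 1)" unfolding lt using ke by auto
          then show ?thesis using 2 v[unfolded One_nat_def] i K
            by (simp add: runs_wp wp_simps drop_unkept_def if_eq_def)
        next
          case 3
          then have "?A i = ?A (i + 1)" unfolding lt by auto
          then show ?thesis using 3 v[unfolded One_nat_def] i K
            by (simp add: runs_wp wp_simps drop_unkept_def if_eq_def)
        next
          case 4
          then have "?A i = ?A (i + 1)" unfolding lt by auto
          then show ?thesis using 4 v[unfolded One_nat_def] i K
            by (simp add: runs_wp wp_simps drop_unkept_def if_eq_def)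
        qed
      next
        fix \<sigma>3 assume "loop_framed 8 drop_unkept \<sigma>2 \<sigma>3"
        then show "aval (Reg 2) \<sigma>3 = int m" using p2 by (simp add: agree_def prepared_def)
      qed (auto simp: alive_def)
      then show "runs ?c3 \<sigma>2 ?t3 ?R"
      proof (rule runs_mono)
        fix \<sigma>3 :: store assume "?K (int m) \<sigma>3"
        moreover have "?A (int m) = {e \<in> alive \<sigma>. he e = t \<longrightarrow> e \<in> kept \<sigma>2}" by (auto simp: alive_def)
        moreover have "finite (kept \<sigma>2)" by (simp add: kept_def)
        ultimately show "?R \<sigma>3" using cd lt by (intro exI[of _ "kept \<sigma>2"]) simp
      qed simp
    qed
  qed
  then show ?thesis
  proof (rule runs_mono)
    have s: "m + 1 \<le> size_bound" using size_bound_ge k by blast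
    have "1 * size_bound \<le> k * size_bound" using k by (rule mult_le_mono1)
    moreover have "k * 1 \<le> k * size_bound" using s by (intro mult_le_mono2) simp
    ultimately have "15 + 10 * m + 37 * m + k * 7 + k * size_bound \<le> 200 * (k * size_bound)"
      using s by linarith
    then show "?t1 + (?t2 + ?t3) \<le> 200 * k * size_bound" by (simp add: algebra_simps)
  qed
qed

end

context instance_data
begin

text \<open>The invariant compares the current graph with the initial one for all increments and all
  vertices. Each target extends it by \<open>walk_cost_dominated\<close>, because its step removes
  arcs into that target only.\<close>

lemma runs_process_targets:
  assumes p: "prepared \<sigma>" and k: "1 \<le> k"
    and c: "\<And>e. e \<in> alive \<sigma> \<Longrightarrow> 0 \<le> c e"
    and tight: "\<And>x d. walk_cost (alive \<sigma>) c x d \<Longrightarrow> walk_cost (alive \<sigma>) c x 0"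
  shows "runs process_targets \<sigma> (300 * n * k * size_bound) (\<lambda>\<sigma>'. alive \<sigma>' \<subseteq> alive \<sigma> \<and>
    (\<forall>I x d. (\<Sum>e<m. I e) \<le> k \<longrightarrow> walk_cost (alive \<sigma>) (\<lambda>e. c e + int (I e)) x d \<longrightarrow>
      (\<exists>d'\<le>d. walk_cost (alive \<sigma>') (\<lambda>e. c e + int (I e)) x d')) \<and>
    (\<forall>t<n. card {e \<in> alive \<sigma>'. he e = t} \<le> k * 2 ^ k))"
proof -
  let ?I = "\<lambda>i \<sigma>'. alive \<sigma>' \<subseteq> alive \<sigma> \<and>
    (\<forall>I x d. (\<Sum>e<m. I e) \<le> k \<longrightarrow> walk_cost (alive \<sigma>) (\<lambda>e. c e + int (I e)) x d \<longrightarrow>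
      (\<exists>d'\<le>d. walk_cost (alive \<sigma>') (\<lambda>e. c e + int (I e)) x d')) \<and>
    (\<forall>t. int t < i \<longrightarrow> card {e \<in> alive \<sigma>'. he e = t} \<le> k * 2 ^ k)"
  have r1: "reg \<sigma> 1 = int n" using p by (simp add: prepared_def)
  have "runs process_targets \<sigma> (for_cost (Const 0) (Reg 1) (int n - 0) (200 * k * size_bound)) (?I (int n))"
    unfolding process_targets_def
  proof (rule runs_For[where I = ?I])
    show "?I (aval (Const 0) \<sigma>) \<sigma>" by auto
  next
    fix i \<sigma>1 assume i: "0 \<le> i" "i < int n" "reg \<sigma>1 5 = i" and J: "?I i \<sigma>1"
      and a: "loop_framed 5 process_target \<sigma> \<sigma>1"
    define t where "t = nat i"
    have t: "int t = i" using i by (simp add: t_def)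
    have p1: "prepared \<sigma>1" using prepared_agree[OF p a] by simp
    have sub: "alive \<sigma>1 \<subseteq> alive \<sigma>" using J by blast
    have c1: "\<And>e. e \<in> alive \<sigma>1 \<Longrightarrow> 0 \<le> c e" using c sub by blast
    have r5: "reg \<sigma>1 5 = int t" using i t by simp
    have "runs process_target \<sigma>1 (200 * k * size_bound) (\<lambda>\<sigma>'. \<exists>K.
      alive \<sigma>' = {e \<in> alive \<sigma>1. he e = t \<longrightarrow> e \<in> K} \<and> finite K \<and> card K \<le> k * 2 ^ k \<and>
      (t \<noteq> s \<longrightarrow> (\<forall>D. 0 \<le> D \<longrightarrow> D < int k \<longrightarrow> layer_tolerant (alive \<sigma>1) t K D)))"
      using p1 r5 k c1 by (rule runs_process_target)
    then show "runs process_target \<sigma>1 (200 * k * size_bound) (?I (i + 1))"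
    proof (rule runs_mono, simp, elim exE conjE)
      fix \<sigma>2 :: store and K
      assume al: "alive \<sigma>2 = {e \<in> alive \<sigma>1. he e = t \<longrightarrow> e \<in> K}"
        and K: "finite K" "card K \<le> k * 2 ^ k"
        and lt: "t \<noteq> s \<longrightarrow> (\<forall>D. 0 \<le> D \<longrightarrow> D < int k \<longrightarrow> layer_tolerant (alive \<sigma>1) t K D)"
      have H: "alive \<sigma>1 \<subseteq> {..<m}" by (auto simp: alive_def)
      have into: "\<exists>d'\<le>d. walk_cost (alive \<sigma>2) (\<lambda>e. c e + int (I e)) t d'"
        if I: "(\<Sum>e<m. I e) \<le> k" and w: "walk_cost (alive \<sigma>1) (\<lambda>e. c e + int (I e)) t d" for I d
      proof (cases "t = s")
        \<comment> \<open>For the source itself the empty walk of cost \<open>0\<close> cannot be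
          beaten.\<close>
        case True
        have "0 \<le> d" using walk_cost_nonneg[OF w] c1 by fastforce
        then show ?thesis using True walk_cost.start by blast
      next
        case False
        have "walk_cost (alive \<sigma>) c t 0"
          using walk_cost_exists[OF walk_cost_mono[OF w sub], of c] tight by blast
        \<comment> \<open>The invariant for the zero increment keeps reduced distances at
          \<open>0\<close>, which is what the treatment of costs of at least \<open>k\<close> relies
          on.\<close>
        then obtain d' where d': "d' \<le> 0" "walk_cost (alive \<sigma>1) c t d'"
          using J[THEN conjunct2, THEN conjunct1, rule_format, of "\<lambda>_. 0" t 0] by auto
        moreover have "0 \<le> d'" using walk_cost_nonneg[OF d'(2)] c1 by blast
        ultimately have zero: "walk_cost (alive \<sigma>1) c t 0" by simp
        show ?thesis unfolding al
          by (rule walk_cost_tolerant[OF _ zero k H c1 I w])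
            (use lt False in \<open>auto simp: layer_tolerant_def\<close>)
      qed
      have "\<exists>d'\<le>d. walk_cost (alive \<sigma>2) (\<lambda>e. c e + int (I e)) x d'"
        if I: "(\<Sum>e<m. I e) \<le> k" and w: "walk_cost (alive \<sigma>) (\<lambda>e. c e + int (I e)) x d" for I x d
      proof -
        obtain d1 where d1: "d1 \<le> d" "walk_cost (alive \<sigma>1) (\<lambda>e. c e + int (I e)) x d1"
          using J I w by blast
        obtain d2 where "d2 \<le> d1" "walk_cost (alive \<sigma>2) (\<lambda>e. c e + int (I e)) x d2"
          using walk_cost_dominated[OF d1(2) into[OF I]] al by blast
        then show ?thesis using d1(1) order_trans by blast
      qed
      moreover have "card {e \<in> alive \<sigma>2. he e = t'} \<le> k * 2 ^ k" if "int t' < i + 1" for t'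
      proof (cases "t' = t")
        case True
        have "card {e \<in> alive \<sigma>2. he e = t'} \<le> card K"
          using K True al by (intro card_mono) auto
        then show ?thesis using K by simp
      next
        case False
        have "{e \<in> alive \<sigma>2. he e = t'} \<subseteq> {e \<in> alive \<sigma>1. he e = t'}" using al by auto
        moreover have "finite (alive \<sigma>1)" by (simp add: alive_def)
        ultimately have "card {e \<in> alive \<sigma>2. he e = t'} \<le> card {e \<in> alive \<sigma>1. he e = t'}"
          by (intro card_mono) auto
        also have "\<dots> \<le> k * 2 ^ k" using J that False t by force
        finally show ?thesis .
      qed
      moreover have "alive \<sigma>2 \<subseteq> alive \<sigma>" using al sub by blast
      ultimately show "?I (i + 1) \<sigma>2" by blast
    qed
  next
    fix \<sigma>1 assume "loop_framed 5 process_target \<sigma> \<sigma>1"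
    then show "aval (Reg 1) \<sigma>1 = int n" using r1 by (simp add: agree_def)
  qed (auto simp: alive_def)
  then show ?thesis
  proof (rule runs_mono)
    define Q where "Q = k * size_bound"
    have "1 * 1 \<le> k * size_bound" using k size_bound_ge(2)[OF k] by (rule mult_le_mono)
    then have "1 \<le> Q" by (simp only: Q_def)
    moreover have n: "1 \<le> n" using s_less by simp
    ultimately have "n * 1 \<le> n * Q" by (intro mult_le_mono2)
    then have "5 + n * 7 + 200 * (n * Q) \<le> 300 * (n * Q)" using n by linarith
    then show "for_cost (Const 0) (Reg 1) (int n - 0) (200 * k * size_bound) \<le> 300 * n * k * size_bound"
      by (simp add: Q_def algebra_simps)
  qed auto
qed

end

section \<open>Preparing the input\<close>

definition compute_bound :: com where
  "compute_bound =
     Assign 4 (Const 1) ;;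
     For 10 (Const 0) (Reg 0) (Assign 4 (Plus (Reg 4) (Reg 4))) ;;
     Assign 4 (Plus (Reg 4) (Const 1))"

definition relax :: com where
  "relax =
     Cond (Less (Const 0) (Get 6 (Get 0 (Reg 8))))
       (Assign 12 (Plus (Get 5 (Get 0 (Reg 8))) (Get 2 (Reg 8))) ;;
        Cond (Conj (Less (Const 0) (Get 6 (Get 1 (Reg 8)))) (Neg (Less (Reg 12) (Get 5 (Get 1 (Reg 8))))))
          Skip
          (Put 5 (Get 1 (Reg 8)) (Reg 12) ;; Put 6 (Get 1 (Reg 8)) (Const 1)))
       Skip"

definition bellman_ford :: com where
  "bellman_ford =
     Put 6 (Reg 3) (Const 1) ;;
     For 10 (Const 0) (Reg 1) (For 8 (Const 0) (Reg 2) relax)"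

text \<open>Arcs whose tail is unreachable keep the initial value 0 in array 3, so they are
  discarded right here.\<close>

definition reduce_weights :: com where
  "reduce_weights =
     For 8 (Const 0) (Reg 2)
       (Cond (Less (Const 0) (Get 6 (Get 0 (Reg 8))))
         (Put 3 (Reg 8) (Const 1) ;;
          Put 4 (Reg 8) (Minus (Plus (Get 2 (Reg 8)) (Get 5 (Get 0 (Reg 8)))) (Get 5 (Get 1 (Reg 8)))))
         Skip)"

definition make_lists :: com where
  "make_lists =
     For 8 (Const 0) (Reg 2)
       (Put 8 (Reg 8) (Get 7 (Get 0 (Reg 8))) ;;
        Put 7 (Get 0 (Reg 8)) (Plus (Reg 8) (Const 1)))"

definition make_rows :: com where
  "make_rows =
     Assign 11 (Const 0) ;;
     For 9 (Const 0) (Plus (Reg 0) (Const 1))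
       (Put 9 (Reg 9) (Reg 11) ;; Assign 11 (Plus (Reg 11) (Reg 2)))"

definition prepare :: com where
  "prepare = compute_bound ;; bellman_ford ;; reduce_weights ;; make_lists ;; make_rows"

lemma written_prepare [simp]:
  "regs_written compute_bound = {4, 10}" "arrs_written compute_bound = {}"
  "regs_written relax = {12}" "arrs_written relax = {5, 6}"
  "regs_written bellman_ford = {8, 10, 12}" "arrs_written bellman_ford = {5, 6}"
  "regs_written reduce_weights = {8}" "arrs_written reduce_weights = {3, 4}"
  "regs_written make_lists = {8}" "arrs_written make_lists = {7, 8}"
  "regs_written make_rows = {9, 11}" "arrs_written make_rows = {9}"
  by (auto simp: compute_bound_def relax_def bellman_ford_def reduce_weights_def make_lists_def
      make_rows_def)

lemma runs_compute_bound:
  assumes "reg \<sigma> 0 = int k"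
  shows "runs compute_bound \<sigma> (20 * (k + 1)) (\<lambda>\<sigma>'. reg \<sigma>' 4 = 2 ^ k + 1)"
proof -
  let ?\<sigma> = "\<sigma>\<lparr>reg := (reg \<sigma>)(4 := 1)\<rparr>"
  let ?c = "For 10 (Const 0) (Reg 0) (Assign 4 (Plus (Reg 4) (Reg 4)))"
  let ?t = "for_cost (Const 0) (Reg 0) (int k - 0) 4"
  have 1: "runs (Assign 4 (Const 1)) \<sigma> 2 (\<lambda>\<sigma>'. \<sigma>' = ?\<sigma>)" by (simp add: runs_wp wp_simps)
  have 2: "runs ?c ?\<sigma> ?t (\<lambda>\<sigma>'. reg \<sigma>' 4 = 2 ^ nat (int k))"
    by (rule runs_For[where I = "\<lambda>i \<sigma>'. reg \<sigma>' 4 = 2 ^ nat i"])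
      (use assms in \<open>auto simp: agree_def runs_wp wp_simps nat_add_distrib\<close>)
  have 3: "runs (Assign 4 (Plus (Reg 4) (Const 1))) \<sigma>' 4 (\<lambda>\<sigma>'. reg \<sigma>' 4 = 2 ^ k + 1)"
    if "reg \<sigma>' 4 = 2 ^ nat (int k)" for \<sigma>'
    using that by (simp add: runs_wp wp_simps)
  have "runs compute_bound \<sigma> (2 + (?t + 4)) (\<lambda>\<sigma>'. reg \<sigma>' 4 = 2 ^ k + 1)"
    unfolding compute_bound_def by (rule runs_Seq[OF 1]) (use runs_Seq[OF 2 3] in simp)
  then show ?thesis by (rule runs_mono) simp_all
qed

section \<open>Distances from the source and reduced weights\<close>

locale input_graph = arc_structure ta he s for ta he :: "nat \<Rightarrow> nat" and s :: nat +
  fixes k n m :: nat and w :: "nat \<Rightarrow> int" and \<delta> :: "nat \<Rightarrow> int"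
  assumes m_pos: "0 < m" and s_less: "s < n"
    and tail_less: "\<And>e. e < m \<Longrightarrow> ta e < n" and head_less: "\<And>e. e < m \<Longrightarrow> he e < n"
    and dist_attained: "\<And>x d. walk_cost {..<m} w x d \<Longrightarrow> walk_cost {..<m} w x (\<delta> x)"
    and dist_minimal: "\<And>x d. walk_cost {..<m} w x d \<Longrightarrow> \<delta> x \<le> d"
begin

text \<open>A closed walk of negative cost at \<open>s\<close> could be run through twice, which
  would contradict minimality.\<close>

lemma dist_source: "\<delta> s = 0"
proof -
  have "walk_cost {..<m} w s (\<delta> s)" using dist_attained walk_cost.start by blast
  then have "\<delta> s \<le> \<delta> s + \<delta> s" using dist_minimal walk_cost_append by blast
  moreover have "\<delta> s \<le> 0" using dist_minimal walk_cost.start by blast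
  ultimately show ?thesis by simp
qed

lemma dist_step: "walk_cost {..<m} w (ta e) d \<Longrightarrow> e < m \<Longrightarrow> \<delta> (he e) \<le> \<delta> (ta e) + w e"
  using dist_minimal dist_attained walk_cost.step by (metis lessThan_iff)

definition arcs_loaded :: "store \<Rightarrow> bool" where
  "arcs_loaded \<sigma> \<longleftrightarrow> reg \<sigma> 0 = int k \<and> reg \<sigma> 1 = int n \<and> reg \<sigma> 2 = int m \<and> reg \<sigma> 3 = int s \<and>
     (\<forall>e<m. arr \<sigma> 0 (int e) = int (ta e) \<and> arr \<sigma> 1 (int e) = int (he e) \<and> arr \<sigma> 2 (int e) = w e)"

lemma arcs_loaded_agree:
  assumes "arcs_loaded \<sigma>" "agree R A \<sigma> \<sigma>'" "R \<inter> {0, 1, 2, 3} = {}" "A \<inter> {0, 1, 2} = {}"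
  shows "arcs_loaded \<sigma>'"
proof -
  note agree_disjoint(1)[OF assms(2,3)] agree_disjoint(2)[OF assms(2,4)]
  with assms(1) show ?thesis unfolding arcs_loaded_def by simp
qed

definition sound_dists :: "store \<Rightarrow> bool" where
  "sound_dists \<sigma> \<longleftrightarrow> (\<forall>x<n. 0 < arr \<sigma> 6 (int x) \<longrightarrow> walk_cost {..<m} w x (arr \<sigma> 5 (int x)))"

definition settled :: "store \<Rightarrow> nat set" where
  "settled \<sigma> = {x. x < n \<and> 0 < arr \<sigma> 6 (int x) \<and> arr \<sigma> 5 (int x) = \<delta> x}"

definition reachable :: "nat set" where
  "reachable = {x. x < n \<and> (\<exists>d. walk_cost {..<m} w x d)}"

lemma settled_subset: "sound_dists \<sigma> \<Longrightarrow> settled \<sigma> \<subseteq> reachable"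
  by (auto simp: settled_def reachable_def sound_dists_def)

text \<open>Prefixes of a shortest walk are shortest, so such a walk uses tight arcs only. The
  induction covers all walks and claims something only for those whose cost is the distance.\<close>

lemma reachable_le_tight_closed:
  assumes "s \<in> Z" and closed: "\<And>e. e < m \<Longrightarrow> ta e \<in> Z \<Longrightarrow> \<delta> (he e) = \<delta> (ta e) + w e \<Longrightarrow> he e \<in> Z"
  shows "reachable \<subseteq> Z"
proof -
  have "d = \<delta> x \<longrightarrow> x \<in> Z" if "walk_cost {..<m} w x d" for x d
    using that
  proof (induction rule: walk_cost.induct)
    case (step e d)
    show ?case
    proof
      assume eq: "d + w e = \<delta> (he e)"
      moreover have "\<delta> (ta e) \<le> d" "\<delta> (he e) \<le> \<delta> (ta e) + w e"
        using dist_minimal dist_step step.hyps by auto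
      ultimately have "d = \<delta> (ta e)" "\<delta> (he e) = \<delta> (ta e) + w e" by auto
      then show "he e \<in> Z" using step closed by simp
    qed
  qed (use assms(1) in simp)
  then show ?thesis using dist_attained by (auto simp: reachable_def)
qed

lemma runs_relax:
  assumes ld: "arcs_loaded \<sigma>" and r: "reg \<sigma> 8 = int e" and e: "e < m" and s: "sound_dists \<sigma>"
  shows "runs relax \<sigma> 60 (\<lambda>\<sigma>'. sound_dists \<sigma>' \<and> settled \<sigma> \<subseteq> settled \<sigma>' \<and>
    (ta e \<in> settled \<sigma> \<longrightarrow> \<delta> (he e) = \<delta> (ta e) + w e \<longrightarrow> he e \<in> settled \<sigma>'))"
    (is "runs _ _ _ ?R")
proof -
  define u v where "u = ta e" and "v = he e"
  have uv: "u < n" "v < n" using tail_less head_less e by (auto simp: u_def v_def)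
  have val: "arr \<sigma> 0 (int e) = int u" "arr \<sigma> (Suc 0) (int e) = int v" "arr \<sigma> 2 (int e) = w e"
    using ld e by (auto simp: arcs_loaded_def u_def v_def)
  define a where "a = arr \<sigma> 5 (int u) + w e"
  note run = runs_wp wp_simps relax_def val r
  have step: "walk_cost {..<m} w v a" "\<delta> v \<le> a" if "0 < arr \<sigma> 6 (int u)"
  proof -
    have "walk_cost {..<m} w u (arr \<sigma> 5 (int u))" using s that uv by (simp add: sound_dists_def)
    then show "walk_cost {..<m} w v a"
      using walk_cost.step[of "{..<m}" w e] e by (simp add: a_def u_def v_def)
    then show "\<delta> v \<le> a" by (rule dist_minimal)
  qed
  consider "\<not> 0 < arr \<sigma> 6 (int u)"
    | "0 < arr \<sigma> 6 (int u)" "0 < arr \<sigma> 6 (int v) \<and> \<not> a < arr \<sigma> 5 (int v)"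
    | "0 < arr \<sigma> 6 (int u)" "\<not> (0 < arr \<sigma> 6 (int v) \<and> \<not> a < arr \<sigma> 5 (int v))" by blast
  then show ?thesis
  proof cases
    case 1
    then have "?R \<sigma>" using s by (simp add: settled_def u_def)
    then show ?thesis using 1 by (simp add: run)
  next
    case 2
    have "\<delta> v \<le> arr \<sigma> 5 (int v)" using 2 s uv dist_minimal by (simp add: sound_dists_def)
    then have R: "?R \<sigma>" using 2 s uv by (auto simp: settled_def u_def v_def a_def)
    have "?R (\<sigma>\<lparr>reg := r'\<rparr>)" for r' using R by (simp add: settled_def sound_dists_def)
    then show ?thesis using 2 by (simp add: run a_def)
  next
    case 3
    let ?\<sigma> = "\<lambda>r'. \<sigma>\<lparr>reg := r', arr := (arr \<sigma>)(5 := (arr \<sigma> 5)(int v := a), 6 := (arr \<sigma> 6)(int v := 1))\<rparr>"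
    have "sound_dists (?\<sigma> r')" for r' using s step(1)[OF 3(1)] by (simp add: sound_dists_def)
    moreover have "settled \<sigma> \<subseteq> settled (?\<sigma> r')" for r'
      using 3 step(2)[OF 3(1)] by (auto simp: settled_def)
    moreover have "u \<in> settled \<sigma> \<longrightarrow> \<delta> v = \<delta> u + w e \<longrightarrow> v \<in> settled (?\<sigma> r')" for r'
      using uv by (simp add: settled_def a_def)
    ultimately have R: "?R (?\<sigma> r')" for r' by (simp add: u_def v_def)
    have "\<not> 0 < arr \<sigma> 6 (int v) \<or> a < arr \<sigma> 5 (int v)" using 3 by blast
    then show ?thesis by (elim disjE) (use R 3(1) in \<open>simp_all add: run a_def\<close>)
  qed
qed

lemma runs_bellman_ford:
  assumes ld: "arcs_loaded \<sigma>" and init: "\<forall>x. arr \<sigma> 5 x = 0" "\<forall>x. arr \<sigma> 6 x = 0"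
  shows "runs bellman_ford \<sigma> (200 * (n * m)) (\<lambda>\<sigma>'. \<forall>x<n.
    (0 < arr \<sigma>' 6 (int x) \<longleftrightarrow> (\<exists>d. walk_cost {..<m} w x d)) \<and>
    (0 < arr \<sigma>' 6 (int x) \<longrightarrow> arr \<sigma>' 5 (int x) = \<delta> x))"
proof -
  let ?\<sigma> = "\<sigma>\<lparr>arr := (arr \<sigma>)(6 := (arr \<sigma> 6)(int s := 1))\<rparr>"
  let ?row = "For 8 (Const 0) (Reg 2) relax"
  let ?b = "for_cost (Const 0) (Reg 2) (int m - 0) 60"
  let ?t = "for_cost (Const 0) (Reg 1) (int n - 0) ?b"
  have r3: "reg \<sigma> 3 = int s" "reg \<sigma> 1 = int n" using ld by (simp_all add: arcs_loaded_def)
  have 1: "runs (Put 6 (Reg 3) (Const 1)) \<sigma> 3 (\<lambda>\<sigma>'. \<sigma>' = ?\<sigma>)"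
    by (simp add: runs_wp wp_simps r3)
  have s0: "sound_dists ?\<sigma>" "s \<in> settled ?\<sigma>"
    using init walk_cost.start dist_source s_less by (simp_all add: sound_dists_def settled_def)
  have fin: "finite reachable" by (simp add: reachable_def)
  \<comment> \<open>Each sweep settles a further vertex until all reachable ones are settled;
    \<open>n\<close> sweeps suffice because more than \<open>n\<close> vertices cannot be
    settled.\<close>
  let ?I = "\<lambda>i \<sigma>'. sound_dists \<sigma>' \<and> s \<in> settled \<sigma>' \<and>
    (settled \<sigma>' = reachable \<or> i < int (card (settled \<sigma>')))"
  have 2: "runs (For 10 (Const 0) (Reg 1) ?row) ?\<sigma> ?t (?I (int n))"
  proof (rule runs_For[where I = ?I])
    have "finite (settled ?\<sigma>)" by (simp add: settled_def)
    then have "0 < card (settled ?\<sigma>)" using s0 by (auto simp: card_gt_0_iff)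
    then show "?I (aval (Const 0) ?\<sigma>) ?\<sigma>" using s0 by simp
  next
    fix i \<sigma>1 assume I: "?I i \<sigma>1"
      and "loop_framed 10 ?row ?\<sigma> \<sigma>1"
    then have a1: "agree {8, 10, 12} {5, 6} \<sigma> \<sigma>1" by (auto simp: agree_def)
    have ld1: "arcs_loaded \<sigma>1" using arcs_loaded_agree[OF ld a1] by simp
    let ?Z = "settled \<sigma>1"
    let ?K = "\<lambda>i \<sigma>'. sound_dists \<sigma>' \<and> ?Z \<subseteq> settled \<sigma>' \<and>
      (\<forall>e. int e < i \<longrightarrow> ta e \<in> ?Z \<longrightarrow> \<delta> (he e) = \<delta> (ta e) + w e \<longrightarrow> he e \<in> settled \<sigma>')"
    have "runs ?row \<sigma>1 ?b (?K (int m))"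
    proof (rule runs_For[where I = ?K])
      show "?K (aval (Const 0) \<sigma>1) \<sigma>1" using I by simp
    next
      fix i \<sigma>2 assume i: "0 \<le> i" "i < int m" "reg \<sigma>2 8 = i" and K: "?K i \<sigma>2"
        and a: "loop_framed 8 relax \<sigma>1 \<sigma>2"
      define e where "e = nat i"
      have e: "e < m" "int e = i" using i by (auto simp: e_def)
      have ld2: "arcs_loaded \<sigma>2" using arcs_loaded_agree[OF ld1 a] by simp
      have r8: "reg \<sigma>2 8 = int e" using i e by simp
      have lt: "int e' < i + 1 \<longleftrightarrow> int e' < i \<or> e' = e" for e' using e by auto
      show "runs relax \<sigma>2 60 (?K (i + 1))"
        unfolding lt by (rule runs_mono[OF runs_relax[OF ld2 r8 e(1)]]) (use K in blast)+
    next
      fix \<sigma>2 assume "loop_framed 8 relax \<sigma>1 \<sigma>2"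
      then show "aval (Reg 2) \<sigma>2 = int m" using ld1 by (simp add: agree_def arcs_loaded_def)
    qed (auto simp: sound_dists_def settled_def)
    then show "runs ?row \<sigma>1 ?b (?I (i + 1))"
    proof (rule runs_mono)
      fix \<sigma>2 :: store assume K: "?K (int m) \<sigma>2"
      have sub: "settled \<sigma>2 \<subseteq> reachable" using K settled_subset by blast
      have "i + 1 < int (card (settled \<sigma>2))" if ne: "settled \<sigma>2 \<noteq> reachable"
      proof -
        have Z: "?Z \<noteq> reachable" using K sub ne by blast
        \<comment> \<open>So the settled set is not closed under tight arcs, and the sweep settles
          the head of a tight arc that leaves it.\<close>
        have "\<not> reachable \<subseteq> ?Z" using Z I settled_subset by blast
        then obtain e where "e < m" "ta e \<in> ?Z" "\<delta> (he e) = \<delta> (ta e) + w e" "he e \<notin> ?Z"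
          using reachable_le_tight_closed[of ?Z] I by blast
        then have "?Z \<subset> settled \<sigma>2" using K by auto
        then have "card ?Z < card (settled \<sigma>2)" using finite_subset[OF sub fin] by (rule psubset_card_mono[rotated])
        then show ?thesis using I Z by auto
      qed
      then show "?I (i + 1) \<sigma>2" using K I by blast
    qed simp
  next
    fix \<sigma>1 assume "loop_framed 10 ?row ?\<sigma> \<sigma>1"
    then show "aval (Reg 1) \<sigma>1 = int n" using r3 by (simp add: agree_def)
  qed (auto simp: sound_dists_def settled_def)
  have "runs bellman_ford \<sigma> (3 + ?t) (?I (int n))"
    unfolding bellman_ford_def by (rule runs_Seq[OF 1]) (use 2 in simp)
  then show ?thesis
  proof (rule runs_mono)
    have "1 \<le> n" "1 \<le> m" using m_pos s_less by auto
    then have "1 * 1 \<le> n * m" "n * 1 \<le> n * m" by (intro mult_le_mono; simp)+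
    then have "8 + n * 12 + 67 * (n * m) \<le> 200 * (n * m)" by linarith
    then show "3 + ?t \<le> 200 * (n * m)" by (simp add: algebra_simps)
  next
    fix \<sigma>' :: store assume I: "?I (int n) \<sigma>'"
    have "card (settled \<sigma>') \<le> card {..<n}" by (intro card_mono) (auto simp: settled_def)
    then have eq: "settled \<sigma>' = reachable" using I by auto
    show "\<forall>x<n. (0 < arr \<sigma>' 6 (int x) \<longleftrightarrow> (\<exists>d. walk_cost {..<m} w x d)) \<and>
      (0 < arr \<sigma>' 6 (int x) \<longrightarrow> arr \<sigma>' 5 (int x) = \<delta> x)"
    proof (intro allI impI)
      fix x assume x: "x < n"
      have "x \<in> settled \<sigma>' \<longleftrightarrow> (\<exists>d. walk_cost {..<m} w x d)" using eq x by (simp add: reachable_def)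
      moreover have "0 < arr \<sigma>' 6 (int x) \<Longrightarrow> \<exists>d. walk_cost {..<m} w x d"
        using I x by (auto simp: sound_dists_def)
      ultimately show "(0 < arr \<sigma>' 6 (int x) \<longleftrightarrow> (\<exists>d. walk_cost {..<m} w x d)) \<and>
        (0 < arr \<sigma>' 6 (int x) \<longrightarrow> arr \<sigma>' 5 (int x) = \<delta> x)"
        by (auto simp: settled_def)
    qed
  qed
qed

end

definition thin_out :: com where
  "thin_out = prepare ;; process_targets"

context input_graph
begin

lemma runs_reduce_weights:
  assumes ld: "arcs_loaded \<sigma>" and z: "\<forall>x. arr \<sigma> 3 x = 0"
    and bf: "\<forall>x<n. (0 < arr \<sigma> 6 (int x) \<longleftrightarrow> (\<exists>d. walk_cost {..<m} w x d)) \<and>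
      (0 < arr \<sigma> 6 (int x) \<longrightarrow> arr \<sigma> 5 (int x) = \<delta> x)"
  shows "runs reduce_weights \<sigma> (50 * m + 5) (\<lambda>\<sigma>'. \<forall>e<m.
    (0 < arr \<sigma>' 3 (int e) \<longleftrightarrow> (\<exists>d. walk_cost {..<m} w (ta e) d)) \<and>
    (0 < arr \<sigma>' 3 (int e) \<longrightarrow> arr \<sigma>' 4 (int e) = w e + \<delta> (ta e) - \<delta> (he e)))"
proof -
  let ?P = "\<lambda>e. \<exists>d. walk_cost {..<m} w (ta e) d"
  let ?I = "\<lambda>i \<sigma>'. \<forall>e<m. (0 < arr \<sigma>' 3 (int e) \<longleftrightarrow> int e < i \<and> ?P e) \<and>
    (0 < arr \<sigma>' 3 (int e) \<longrightarrow> arr \<sigma>' 4 (int e) = w e + \<delta> (ta e) - \<delta> (he e))"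
  let ?c = "Cond (Less (Const 0) (Get 6 (Get 0 (Reg 8))))
         (Put 3 (Reg 8) (Const 1) ;;
          Put 4 (Reg 8) (Minus (Plus (Get 2 (Reg 8)) (Get 5 (Get 0 (Reg 8)))) (Get 5 (Get 1 (Reg 8)))))
         Skip"
  have "runs reduce_weights \<sigma> (for_cost (Const 0) (Reg 2) (int m - 0) 40) (?I (int m))"
    unfolding reduce_weights_def
  proof (rule runs_For[where I = ?I])
    fix i \<sigma>1 assume i: "0 \<le> i" "i < int m" "reg \<sigma>1 8 = i" and I: "?I i \<sigma>1"
      and a: "loop_framed 8 ?c \<sigma> \<sigma>1"
    define e where "e = nat i"
    have e: "e < m" "int e = i" using i by (auto simp: e_def)
    have lt: "int e' < i + 1 \<longleftrightarrow> int e' < i \<or> e' = e" for e' using e by auto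
    have ld1: "arcs_loaded \<sigma>1" using arcs_loaded_agree[OF ld a] by simp
    have v: "arr \<sigma>1 0 i = int (ta e)" "arr \<sigma>1 (Suc 0) i = int (he e)" "arr \<sigma>1 2 i = w e"
      using ld1 e by (auto simp: arcs_loaded_def)
    have b: "arr \<sigma>1 5 = arr \<sigma> 5" "arr \<sigma>1 6 = arr \<sigma> 6" using a by (simp_all add: agree_def)
    have t: "0 < arr \<sigma> 6 (int (ta e)) \<longleftrightarrow> ?P e" "?P e \<Longrightarrow> arr \<sigma> 5 (int (ta e)) = \<delta> (ta e)"
      using bf tail_less e by auto
    have h: "?P e \<Longrightarrow> arr \<sigma> 5 (int (he e)) = \<delta> (he e)"
      using bf head_less[OF e(1)] walk_cost.step[of "{..<m}" w e] e by blast
    show "runs ?c \<sigma>1 40 (?I (i + 1))"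
    proof (cases "?P e")
      case True
      then have "?I (i + 1) (\<sigma>1\<lparr>arr := (arr \<sigma>1)(3 := (arr \<sigma>1 3)(i := 1),
          4 := (arr \<sigma>1 4)(i := w e + \<delta> (ta e) - \<delta> (he e)))\<rparr>)"
        using I e unfolding lt by auto
      then show ?thesis using True i by (simp add: runs_wp wp_simps v b t h)
    next
      case False
      then have "?I (i + 1) \<sigma>1" using I unfolding lt by auto
      then show ?thesis using False i by (simp add: runs_wp wp_simps v b t)
    qed
  next
    fix \<sigma>1 assume "loop_framed 8 ?c \<sigma> \<sigma>1"
    then show "aval (Reg 2) \<sigma>1 = int m" using ld by (simp add: agree_def arcs_loaded_def)
  qed (use z in auto)
  then show ?thesis by (rule runs_mono) auto
qed

lemma runs_make_lists:
  assumes ld: "arcs_loaded \<sigma>" and z: "\<forall>x. arr \<sigma> 7 x = 0"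
  shows "runs make_lists \<sigma> (50 * m + 5) (\<lambda>\<sigma>'.
    (\<forall>e<m. arr \<sigma>' 8 (int e) = int (last_arc ta (ta e) e)) \<and>
    (\<forall>x<n. arr \<sigma>' 7 (int x) = int (last_arc ta x m)))"
proof -
  let ?I = "\<lambda>i \<sigma>'. (\<forall>e<m. int e < i \<longrightarrow> arr \<sigma>' 8 (int e) = int (last_arc ta (ta e) e)) \<and>
    (\<forall>x<n. arr \<sigma>' 7 (int x) = int (last_arc ta x (nat i)))"
  let ?c = "Put 8 (Reg 8) (Get 7 (Get 0 (Reg 8))) ;; Put 7 (Get 0 (Reg 8)) (Plus (Reg 8) (Const 1))"
  have "runs make_lists \<sigma> (for_cost (Const 0) (Reg 2) (int m - 0) 40) (?I (int m))"
    unfolding make_lists_def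
  proof (rule runs_For[where I = ?I])
    fix i \<sigma>1 assume i: "0 \<le> i" "i < int m" "reg \<sigma>1 8 = i" and I: "?I i \<sigma>1"
      and a: "loop_framed 8 ?c \<sigma> \<sigma>1"
    define e where "e = nat i"
    have e: "e < m" "int e = i" "nat (i + 1) = Suc e" using i by (auto simp: e_def)
    have lt: "int e' < i + 1 \<longleftrightarrow> int e' < i \<or> e' = e" for e' using e by auto
    have ld1: "arcs_loaded \<sigma>1" using arcs_loaded_agree[OF ld a] by simp
    have v: "arr \<sigma>1 0 i = int (ta e)" using ld1 e by (auto simp: arcs_loaded_def)
    have "arr \<sigma>1 7 (int (ta e)) = int (last_arc ta (ta e) e)"
      using I tail_less[OF e(1)] by (simp add: e_def)
    then have "?I (i + 1) (\<sigma>1\<lparr>arr := (arr \<sigma>1)(8 := (arr \<sigma>1 8)(i := arr \<sigma>1 7 (int (ta e))),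
        7 := (arr \<sigma>1 7)(int (ta e) := i + 1))\<rparr>)"
      using I e unfolding lt e(3) by (auto simp: e_def)
    then show "runs ?c \<sigma>1 40 (?I (i + 1))" using i by (simp add: runs_wp wp_simps v)
  next
    fix \<sigma>1 assume "loop_framed 8 ?c \<sigma> \<sigma>1"
    then show "aval (Reg 2) \<sigma>1 = int m" using ld by (simp add: agree_def arcs_loaded_def)
  qed (use z in auto)
  then show ?thesis by (rule runs_mono) auto
qed

lemma runs_make_rows:
  assumes ld: "arcs_loaded \<sigma>"
  shows "runs make_rows \<sigma> (40 * (k + 1)) (\<lambda>\<sigma>'. \<forall>j\<in>{0..int k}. arr \<sigma>' 9 j = j * int m)"
proof -
  have r: "reg \<sigma> 0 = int k" "reg \<sigma> 2 = int m" using ld by (simp_all add: arcs_loaded_def)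
  let ?\<sigma> = "\<sigma>\<lparr>reg := (reg \<sigma>)(11 := 0)\<rparr>"
  let ?I = "\<lambda>i \<sigma>'. reg \<sigma>' 11 = i * int m \<and> (\<forall>j\<in>{0..<i}. arr \<sigma>' 9 j = j * int m)"
  let ?c = "Put 9 (Reg 9) (Reg 11) ;; Assign 11 (Plus (Reg 11) (Reg 2))"
  let ?t = "for_cost (Const 0) (Plus (Reg 0) (Const 1)) (int k + 1 - 0) 10"
  have 1: "runs (Assign 11 (Const 0)) \<sigma> 2 (\<lambda>\<sigma>'. \<sigma>' = ?\<sigma>)" by (simp add: runs_wp wp_simps)
  have 2: "runs (For 9 (Const 0) (Plus (Reg 0) (Const 1)) ?c) ?\<sigma> ?t (?I (int k + 1))"
  proof (rule runs_For[where I = ?I])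
    fix i \<sigma>1 assume i: "0 \<le> i" "reg \<sigma>1 9 = i" and I: "?I i \<sigma>1"
      and a: "loop_framed 9 ?c ?\<sigma> \<sigma>1"
    have "{0..<i + 1} = insert i {0..<i}" using i by auto
    moreover have "reg \<sigma>1 2 = int m" using a r by (simp add: agree_def)
    ultimately show "runs ?c \<sigma>1 10 (?I (i + 1))"
      using I i by (simp add: runs_wp wp_simps algebra_simps)
  next
    fix \<sigma>1 assume "loop_framed 9 ?c ?\<sigma> \<sigma>1"
    then show "aval (Plus (Reg 0) (Const 1)) \<sigma>1 = int k + 1" using r by (simp add: agree_def)
  qed auto
  have "runs make_rows \<sigma> (2 + ?t) (?I (int k + 1))"
    unfolding make_rows_def by (rule runs_Seq[OF 1]) (use 2 in simp)
  then show ?thesis by (rule runs_mono) (auto simp: nat_add_distrib)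
qed

definition usable :: "nat set" where
  "usable = {e. e < m \<and> (\<exists>d. walk_cost {..<m} w (ta e) d)}"

text \<open>Each arc of a walk from \<open>s\<close> has a reachable tail, and reachability does not
  depend on the weights.\<close>

lemma walk_cost_usable: "walk_cost {..<m} \<omega> x d \<Longrightarrow> walk_cost usable \<omega> x d"
proof (induction rule: walk_cost.induct)
  case (step e d)
  then have "e \<in> usable" using walk_cost_exists by (auto simp: usable_def)
  then show ?case using step walk_cost.step by blast
qed (rule walk_cost.start)

lemma runs_prepare:
  assumes ld: "arcs_loaded \<sigma>" and z: "\<And>a x. a \<in> {3, 5, 6, 7} \<Longrightarrow> arr \<sigma> a x = 0"
  shows "runs prepare \<sigma> (60 * (k + 1) + 200 * (n * m) + 100 * m + 10) (\<lambda>\<sigma>'. \<exists>c.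
    instance_data.prepared k n m s ta he c \<sigma>' \<and> instance_data.alive m \<sigma>' = usable \<and>
    (\<forall>e\<in>usable. c e = w e + \<delta> (ta e) - \<delta> (he e)))"
    (is "runs _ _ _ ?R")
proof -
  let ?P = "\<lambda>e. \<exists>d. walk_cost {..<m} w (ta e) d"
  have r0: "reg \<sigma> 0 = int k" using ld by (simp add: arcs_loaded_def)
  have "runs prepare \<sigma> (20 * (k + 1) + (200 * (n * m) + ((50 * m + 5) + ((50 * m + 5) + 40 * (k + 1))))) ?R"
    unfolding prepare_def
  proof (rule runs_Seq[OF runs_agree[OF runs_compute_bound[OF r0]]], elim conjE)
    fix \<sigma>1 assume r4: "reg \<sigma>1 4 = 2 ^ k + 1"
      and "framed compute_bound \<sigma> \<sigma>1"
    then have a1: "agree {4, 10} {} \<sigma> \<sigma>1" by simp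
    have ld1: "arcs_loaded \<sigma>1" using arcs_loaded_agree[OF ld a1] by simp
    have z1: "\<forall>x. arr \<sigma>1 5 x = 0" "\<forall>x. arr \<sigma>1 6 x = 0" using a1 z by (simp_all add: agree_def)
    show "runs (bellman_ford ;; reduce_weights ;; make_lists ;; make_rows) \<sigma>1
      (200 * (n * m) + ((50 * m + 5) + ((50 * m + 5) + 40 * (k + 1)))) ?R"
    proof (rule runs_Seq[OF runs_agree[OF runs_bellman_ford[OF ld1 z1]]], elim conjE)
      fix \<sigma>2 assume bf: "\<forall>x<n. (0 < arr \<sigma>2 6 (int x) \<longleftrightarrow> (\<exists>d. walk_cost {..<m} w x d)) \<and>
          (0 < arr \<sigma>2 6 (int x) \<longrightarrow> arr \<sigma>2 5 (int x) = \<delta> x)"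
        and "framed bellman_ford \<sigma>1 \<sigma>2"
      then have a2: "agree {8, 10, 12} {5, 6} \<sigma>1 \<sigma>2" by simp
      have ld2: "arcs_loaded \<sigma>2" using arcs_loaded_agree[OF ld1 a2] by simp
      have z2: "\<forall>x. arr \<sigma>2 3 x = 0" using a1 a2 z by (simp add: agree_def)
      show "runs (reduce_weights ;; make_lists ;; make_rows) \<sigma>2
        ((50 * m + 5) + ((50 * m + 5) + 40 * (k + 1))) ?R"
      proof (rule runs_Seq[OF runs_agree[OF runs_reduce_weights[OF ld2 z2 bf]]], elim conjE)
        fix \<sigma>3 assume rw: "\<forall>e<m. (0 < arr \<sigma>3 3 (int e) \<longleftrightarrow> ?P e) \<and>
            (0 < arr \<sigma>3 3 (int e) \<longrightarrow> arr \<sigma>3 4 (int e) = w e + \<delta> (ta e) - \<delta> (he e))"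
          and "framed reduce_weights \<sigma>2 \<sigma>3"
        then have a3: "agree {8} {3, 4} \<sigma>2 \<sigma>3" by simp
        have ld3: "arcs_loaded \<sigma>3" using arcs_loaded_agree[OF ld2 a3] by simp
        have z3: "\<forall>x. arr \<sigma>3 7 x = 0" using a1 a2 a3 z by (simp add: agree_def)
        show "runs (make_lists ;; make_rows) \<sigma>3 ((50 * m + 5) + 40 * (k + 1)) ?R"
        proof (rule runs_Seq[OF runs_agree[OF runs_make_lists[OF ld3 z3]]], elim conjE)
          fix \<sigma>4 assume ls: "\<forall>e<m. arr \<sigma>4 8 (int e) = int (last_arc ta (ta e) e)"
              "\<forall>x<n. arr \<sigma>4 7 (int x) = int (last_arc ta x m)"
            and "framed make_lists \<sigma>3 \<sigma>4"
          then have a4: "agree {8} {7, 8} \<sigma>3 \<sigma>4" by simp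
          have ld4: "arcs_loaded \<sigma>4" using arcs_loaded_agree[OF ld3 a4] by simp
          show "runs make_rows \<sigma>4 (40 * (k + 1)) ?R"
          proof (rule runs_mono[OF runs_agree[OF runs_make_rows[OF ld4]]], simp, elim conjE)
            fix \<sigma>5 assume rows: "\<forall>j\<in>{0..int k}. arr \<sigma>5 9 j = j * int m"
              and "framed make_rows \<sigma>4 \<sigma>5"
            then have a5: "agree {9, 11} {9} \<sigma>4 \<sigma>5" by simp
            have ld5: "arcs_loaded \<sigma>5" using arcs_loaded_agree[OF ld4 a5] by simp
            \<comment> \<open>Array 4 is read as it stands; it holds reduced weights only at the
              arcs with reachable tail, hence the restriction of the specification to
              \<open>usable\<close>.\<close>
            define c where "c = (\<lambda>e. arr \<sigma>5 4 (int e))"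
            interpret instance_data k n m s ta he c
              by unfold_locales (use m_pos s_less tail_less head_less in auto)
            have "reg \<sigma>5 4 = 2 ^ k + 1" using r4 a2 a3 a4 a5 by (simp add: agree_def)
            moreover have "arr \<sigma>5 7 = arr \<sigma>4 7" "arr \<sigma>5 8 = arr \<sigma>4 8" "arr \<sigma>5 3 = arr \<sigma>3 3" "arr \<sigma>5 4 = arr \<sigma>3 4"
              using a4 a5 by (simp_all add: agree_def)
            moreover have "arr \<sigma>5 4 (int e) = c e" for e by (simp add: c_def)
            ultimately have "prepared \<sigma>5" "alive \<sigma>5 = usable"
                "\<forall>e\<in>usable. c e = w e + \<delta> (ta e) - \<delta> (he e)"
              using ld5 ls rows rw by (auto simp: prepared_def arcs_loaded_def alive_def usable_def)
            then show "?R \<sigma>5" by blast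
          qed
        qed
      qed
    qed
  qed
  then show ?thesis by (rule runs_mono) (simp, assumption)
qed

lemma runs_thin_out:
  assumes ld: "arcs_loaded \<sigma>" and z: "\<And>a x. a \<in> {3, 5, 6, 7} \<Longrightarrow> arr \<sigma> a x = 0" and k: "1 \<le> k"
  shows "runs thin_out \<sigma> (1000 * n * k * (2000 * (k + 1) * (2 ^ k + 1) * ((m * k + 1) * (m * k + 2))))
    (\<lambda>\<sigma>'. let H = {e. e < m \<and> 0 < arr \<sigma>' 3 (int e)} in
      (\<forall>I x d. (\<Sum>e<m. I e) \<le> k \<longrightarrow> walk_cost {..<m} (\<lambda>e. w e + int (I e)) x d \<longrightarrow>
        (\<exists>d'\<le>d. walk_cost H (\<lambda>e. w e + int (I e)) x d')) \<and>
      (\<forall>t<n. card {e \<in> H. he e = t} \<le> k * 2 ^ k))"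
    (is "runs _ _ ?b ?R")
proof -
  define B where "B = 2000 * (k + 1) * (2 ^ k + 1) * ((m * k + 1) * (m * k + 2))"
  have "runs thin_out \<sigma> ((60 * (k + 1) + 200 * (n * m) + 100 * m + 10) + 300 * n * k * B) ?R"
    unfolding thin_out_def
  proof (rule runs_Seq[OF runs_prepare[OF ld z]], assumption, elim exE conjE)
    fix \<sigma>1 c
    assume p: "instance_data.prepared k n m s ta he c \<sigma>1" and al: "instance_data.alive m \<sigma>1 = usable"
      and c: "\<forall>e\<in>usable. c e = w e + \<delta> (ta e) - \<delta> (he e)"
    interpret instance_data k n m s ta he c
      by unfold_locales (use m_pos s_less tail_less head_less in auto)
    have c_nonneg: "0 \<le> c e" if "e \<in> alive \<sigma>1" for e
    proof -
      have e: "e \<in> usable" using that al by simp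
      then obtain d where "walk_cost {..<m} w (ta e) d" "e < m" unfolding usable_def by blast
      then have "\<delta> (he e) \<le> \<delta> (ta e) + w e" by (rule dist_step)
      then show ?thesis using c e by simp
    qed
    \<comment> \<open>The potential turns a walk of cost \<open>\<delta> x\<close> into one of cost
      \<open>0\<close>, as \<open>\<delta> s = 0\<close>.\<close>
    have tight: "walk_cost (alive \<sigma>1) c x 0" if "walk_cost (alive \<sigma>1) c x d" for x d
    proof -
      have "alive \<sigma>1 \<subseteq> {..<m}" by (auto simp: alive_def)
      then have "\<exists>d. walk_cost {..<m} w x d"
        using walk_cost_exists[OF walk_cost_mono[OF that]] by blast
      then have "walk_cost usable w x (\<delta> x)" using dist_attained walk_cost_usable by blast
      then have "walk_cost usable c x (\<delta> x + \<delta> s - \<delta> x)"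
        by (rule walk_cost_reweight) (use c in blast)
      then show ?thesis using al dist_source by simp
    qed
    have 2: "runs process_targets \<sigma>1 (300 * n * k * size_bound) (\<lambda>\<sigma>'. alive \<sigma>' \<subseteq> alive \<sigma>1 \<and>
        (\<forall>I x d. (\<Sum>e<m. I e) \<le> k \<longrightarrow> walk_cost (alive \<sigma>1) (\<lambda>e. c e + int (I e)) x d \<longrightarrow>
          (\<exists>d'\<le>d. walk_cost (alive \<sigma>') (\<lambda>e. c e + int (I e)) x d')) \<and>
        (\<forall>t<n. card {e \<in> alive \<sigma>'. he e = t} \<le> k * 2 ^ k))"
      using p k c_nonneg tight by (rule runs_process_targets)
    show "runs process_targets \<sigma>1 (300 * n * k * B) ?R"
    proof (rule runs_mono[OF 2])
      fix \<sigma>2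
      assume A: "alive \<sigma>2 \<subseteq> alive \<sigma>1 \<and>
        (\<forall>I x d. (\<Sum>e<m. I e) \<le> k \<longrightarrow> walk_cost (alive \<sigma>1) (\<lambda>e. c e + int (I e)) x d \<longrightarrow>
          (\<exists>d'\<le>d. walk_cost (alive \<sigma>2) (\<lambda>e. c e + int (I e)) x d')) \<and>
        (\<forall>t<n. card {e \<in> alive \<sigma>2. he e = t} \<le> k * 2 ^ k)"
      have "\<exists>d'\<le>d. walk_cost (alive \<sigma>2) (\<lambda>e. w e + int (I e)) x d'"
        if I: "(\<Sum>e<m. I e) \<le> k" and d: "walk_cost {..<m} (\<lambda>e. w e + int (I e)) x d" for I x d
      proof -
        have "walk_cost usable (\<lambda>e. c e + int (I e)) x (d + \<delta> s - \<delta> x)"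
          using walk_cost_usable[OF d] by (rule walk_cost_reweight) (use c in auto)
        then obtain d' where d': "d' \<le> d + \<delta> s - \<delta> x"
          "walk_cost (alive \<sigma>2) (\<lambda>e. c e + int (I e)) x d'"
          using A I al by metis
        \<comment> \<open>Back to the original weights with the negated potential. Its contribution
          depends only on the ends of the walk, so the comparison of costs is unaffected.\<close>
        have "walk_cost (alive \<sigma>2) (\<lambda>e. w e + int (I e)) x (d' + - \<delta> s - - \<delta> x)"
          using d'(2) by (rule walk_cost_reweight) (use c A al in auto)
        then show ?thesis using d'(1) by (intro exI[of _ "d' + - \<delta> s - - \<delta> x"]) simp
      qed
      then show "?R \<sigma>2" using A unfolding Let_def alive_def by blast
    qed (simp add: size_bound_def B_def)
  qed
  then show ?thesis unfolding B_def[symmetric]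
  proof (rule runs_mono, goal_cases)
    case 1
    interpret instance_data k n m s ta he w
      by unfold_locales (use m_pos s_less tail_less head_less in auto)
    have Bm: "m + 1 \<le> B" using size_bound_ge[OF k] by (simp add: size_bound_def B_def)
    have "(k + 1) * 1 \<le> (2000 * (k + 1) * (2 ^ k + 1)) * ((m * k + 1) * (m * k + 2))"
      by (intro mult_le_mono) simp_all
    then have Bk: "k + 1 \<le> B" by (simp add: B_def)
    have "1 \<le> n" using s_less by simp
    define Q where "Q = k * (n * B)"
    have "1 * (n * B) \<le> Q" unfolding Q_def using k by (rule mult_le_mono1)
    moreover have "n * m \<le> n * B" using Bm by (intro mult_le_mono2) simp
    moreover have "1 * B \<le> n * B" using \<open>1 \<le> n\<close> by (rule mult_le_mono1)
    ultimately have Q: "n * m \<le> Q" "B \<le> Q" by linarith+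
    have eq: "300 * n * k * B = 300 * Q" "1000 * n * k * B = 1000 * Q"
      by (simp_all add: Q_def ac_simps)
    have "k + 1 \<le> Q" "m \<le> Q" "1 \<le> Q" using Q Bm Bk k by linarith+
    with Q(1) show ?case unfolding eq by simp
  qed
qed

end

section \<open>From costs of walks to distances\<close>

text \<open>The program tests whether entries of array 3 are positive, while the output selects
  those different from 0. The two agree since only nonnegative constants are ever written
  there.\<close>

fun nonneg_puts :: "nat \<Rightarrow> com \<Rightarrow> bool" where
  "nonneg_puts a Skip = True"
| "nonneg_puts a (Assign x e) = True"
| "nonneg_puts a (Put x i e) = (x = a \<longrightarrow> (\<exists>v\<ge>0. e = Const v))"
| "nonneg_puts a (c1 ;; c2) = (nonneg_puts a c1 \<and> nonneg_puts a c2)"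
| "nonneg_puts a (Cond b c1 c2) = (nonneg_puts a c1 \<and> nonneg_puts a c2)"
| "nonneg_puts a (While b c) = nonneg_puts a c"

lemma exec_arr_nonneg:
  "exec c \<sigma> T \<sigma>' \<Longrightarrow> nonneg_puts a c \<Longrightarrow> \<forall>x. 0 \<le> arr \<sigma> a x \<Longrightarrow> \<forall>x. 0 \<le> arr \<sigma>' a x"
  by (induction rule: exec.induct) auto

text \<open>A graph without arcs is left alone; everything else assumes \<open>0 < m\<close>,
  beginning with the numbering of the nodes by quotient and remainder modulo
  \<open>m\<close>.\<close>

definition wtss_program :: com where
  "wtss_program = Cond (Less (Const 0) (Reg 2)) thin_out Skip"

lemma nonneg_puts_wtss_program: "nonneg_puts 3 wtss_program"
  by (simp add: wtss_program_def thin_out_def prepare_def compute_bound_def bellman_ford_def relax_def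
      reduce_weights_def make_lists_def make_rows_def process_targets_def process_target_def
      layer_pass_def build_def build_node_def if_eq_def find_flow_def maximize_def
      advance_sources_def augment_def search_def find_node_def push_def push_step_def
      for_arcs_def scan_arc_def collect_def drop_unkept_def For_def)

text \<open>The consistency of arc lists is defined from the front, but \<open>walk_cost\<close>
  extends a walk at its end.\<close>

lemma (in pre_digraph) cas_snoc:
  "cas u (p @ [e]) v \<longleftrightarrow> cas u p (tail G e) \<and> head G e = v"
  by (induction p arbitrary: u) auto

lemma awalk_walk_cost:
  assumes s: "s \<in> verts G"
  shows "arc_structure.walk_cost (tail G) (head G) s (arcs G) \<omega> x d \<longleftrightarrow>
    (\<exists>p. pre_digraph.awalk G s p x \<and> (\<Sum>a\<leftarrow>p. \<omega> a) = d)"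
proof -
  interpret pre_digraph G .
  interpret arc_structure "tail G" "head G" s .
  have "walk_cost (arcs G) \<omega> x d \<Longrightarrow> \<exists>p. awalk s p x \<and> (\<Sum>a\<leftarrow>p. \<omega> a) = d"
  proof (induction rule: walk_cost.induct)
    case start
    show ?case using s by (intro exI[of _ "[]"]) (simp add: awalk_def)
  next
    case (step e d)
    then obtain p where "awalk s p (tail G e)" "(\<Sum>a\<leftarrow>p. \<omega> a) = d" by blast
    then show ?case using step.hyps by (intro exI[of _ "p @ [e]"]) (simp add: awalk_def cas_snoc del: cas_append_iff)
  qed
  moreover have "awalk s p x \<Longrightarrow> walk_cost (arcs G) \<omega> x (\<Sum>a\<leftarrow>p. \<omega> a)" for p
  proof (induction p arbitrary: x rule: rev_induct)
    case Nil
    then show ?case using walk_cost.start by (simp add: awalk_def)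
  next
    case (snoc e p)
    then have "walk_cost (arcs G) \<omega> (tail G e) (\<Sum>a\<leftarrow>p. \<omega> a)" "e \<in> arcs G" "head G e = x"
      by (auto simp: awalk_def cas_snoc simp del: cas_append_iff)
    then show ?case using walk_cost.step by fastforce
  qed
  ultimately show ?thesis by blast
qed

lemma sum_list_real_of_int: "(\<Sum>a\<leftarrow>p. real_of_int (f a)) = real_of_int (\<Sum>a\<leftarrow>p. f a)"
  by (induction p) auto

text \<open>The infima are compared walk by walk: walks of \<open>H\<close> are walks of
  \<open>G\<close>, and each walk of \<open>G\<close> is matched by one of \<open>H\<close> that is
  not more expensive. This also covers unreachable vertices, where both index sets are
  empty.\<close>

lemma sp_dist_eqI:
  fixes G H :: "(nat, nat) pre_digraph"
  assumes wf: "wf_digraph G" "wf_digraph H" and s: "s \<in> verts G"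
    and sub: "verts H = verts G" "arcs H \<subseteq> arcs G" "tail H = tail G" "head H = head G"
    and dom: "\<And>d. arc_structure.walk_cost (tail G) (head G) s (arcs G) w x d \<Longrightarrow>
      \<exists>d'\<le>d. arc_structure.walk_cost (tail G) (head G) s (arcs H) w x d'"
  shows "sp_dist G w s x = sp_dist H w s x"
proof -
  have \<mu>: "sp_dist F w s x = (INF p\<in>{p. pre_digraph.awalk F s p x}. ereal (real_of_int (\<Sum>a\<leftarrow>p. w a)))"
    if "wf_digraph F" for F :: "(nat, nat) pre_digraph"
    using wf_digraph.\<mu>_def[OF that] unfolding sp_dist_def
    by (simp add: wf_digraph.awalk_cost_def[OF that] sum_list_real_of_int)
  have sH: "s \<in> verts H" using s sub by simp
  show ?thesis unfolding \<mu>[OF wf(1)] \<mu>[OF wf(2)]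
  proof (rule antisym)
    have "pre_digraph.awalk H s p x \<Longrightarrow> pre_digraph.awalk G s p x" for p
    proof -
      have "pre_digraph.cas H u p x = pre_digraph.cas G u p x" for u
        by (induction p arbitrary: u) (auto simp: pre_digraph.cas.simps sub)
      then show "pre_digraph.awalk H s p x \<Longrightarrow> pre_digraph.awalk G s p x"
        using sub by (auto simp: pre_digraph.awalk_def)
    qed
    then show "(INF p\<in>{p. pre_digraph.awalk G s p x}. ereal (real_of_int (\<Sum>a\<leftarrow>p. w a)))
        \<le> (INF p\<in>{p. pre_digraph.awalk H s p x}. ereal (real_of_int (\<Sum>a\<leftarrow>p. w a)))"
      by (intro INF_superset_mono) auto
  next
    show "(INF p\<in>{p. pre_digraph.awalk H s p x}. ereal (real_of_int (\<Sum>a\<leftarrow>p. w a)))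
        \<le> (INF p\<in>{p. pre_digraph.awalk G s p x}. ereal (real_of_int (\<Sum>a\<leftarrow>p. w a)))"
    proof (rule INF_mono)
      fix p assume "p \<in> {p. pre_digraph.awalk G s p x}"
      then have "arc_structure.walk_cost (tail G) (head G) s (arcs G) w x (\<Sum>a\<leftarrow>p. w a)"
        using awalk_walk_cost[OF s, of w x] by blast
      then obtain d' where "d' \<le> (\<Sum>a\<leftarrow>p. w a)"
        "arc_structure.walk_cost (tail H) (head H) s (arcs H) w x d'"
        using dom unfolding sub(3,4) by blast
      then show "\<exists>q\<in>{p. pre_digraph.awalk H s p x}.
          ereal (real_of_int (\<Sum>a\<leftarrow>q. w a)) \<le> ereal (real_of_int (\<Sum>a\<leftarrow>p. w a))"
        using awalk_walk_cost[OF sH, of w x d'] by auto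
    qed
  qed
qed

text \<open>From \<open>k < 2 ^ k\<close> the left side is at most \<open>32 ^ k\<close>. This is at
  most \<open>k ^ k\<close> as soon as \<open>32 \<le> k\<close>, and for smaller \<open>k\<close>
  the constant absorbs it.\<close>

lemma power_le_self_power:
  assumes "1 \<le> k"
  shows "k ^ 4 * 2 ^ k \<le> 32 ^ 32 * (k :: nat) ^ k"
proof -
  have "k ^ 4 \<le> (2 ^ k) ^ 4" using less_exp[of k] by (intro power_mono) auto
  also have "\<dots> = 16 ^ k" by (simp add: power_mult[symmetric] mult.commute[of k]) (simp add: power_mult)
  finally have "k ^ 4 * 2 ^ k \<le> 16 ^ k * 2 ^ k" by simp
  also have "\<dots> = 32 ^ k" by (simp add: power_mult_distrib[symmetric])
  also have "\<dots> \<le> 32 ^ 32 * k ^ k"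
  proof (cases "32 \<le> k")
    case True
    then have "(32::nat) ^ k \<le> k ^ k" by (intro power_mono) auto
    then show ?thesis by (rule order_trans) simp
  next
    case False
    then have "(32::nat) ^ k \<le> 32 ^ 32" by (intro power_increasing) auto
    moreover have "1 \<le> k ^ k" using assms by simp
    ultimately have "32 ^ k * 1 \<le> 32 ^ 32 * k ^ k" by (intro mult_le_mono)
    then show ?thesis by simp
  qed
  finally show ?thesis .
qed

text \<open>The constant is \<open>1000 * 2000\<close> times the factors 2, 2, 2 and 3 lost in
  replacing \<open>k + 1\<close>, \<open>2 ^ k + 1\<close>, \<open>m * k + 1\<close> and
  \<open>m * k + 2\<close> by multiples of their leading terms.\<close>

lemma time_bound:
  assumes k: "1 \<le> k" and m: "1 \<le> m"
  shows "1000 * n * k * (2000 * (k + 1) * (2 ^ k + 1) * ((m * k + 1) * (m * k + 2)))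
    \<le> 48000000 * 32 ^ 32 * (k ^ k * m ^ 2 * n :: nat)"
proof -
  have mk: "1 \<le> m * k" using k m by simp
  have 1: "(m * k + 1) * (m * k + 2) \<le> (2 * (m * k)) * (3 * (m * k))"
    using mk by (intro mult_le_mono) linarith+
  have 2: "2 ^ k + 1 \<le> 2 * (2 :: nat) ^ k" by simp
  have 3: "k + 1 \<le> 2 * k" using k by simp
  have "1000 * n * k * (2000 * (k + 1) * (2 ^ k + 1) * ((m * k + 1) * (m * k + 2)))
      \<le> 1000 * n * k * (2000 * (2 * k) * (2 * 2 ^ k) * ((2 * (m * k)) * (3 * (m * k))))"
    by (rule mult_le_mono[OF order_refl mult_le_mono[OF mult_le_mono[OF mult_le_mono[OF order_refl 3] 2] 1]])
  also have "\<dots> = 48000000 * m ^ 2 * n * (k ^ 4 * 2 ^ k)"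
    by (simp add: power2_eq_square power4_eq_xxxx ac_simps)
  also have "\<dots> \<le> 48000000 * m ^ 2 * n * (32 ^ 32 * k ^ k)"
    by (intro mult_le_mono2 power_le_self_power k)
  also have "\<dots> = 48000000 * 32 ^ 32 * (k ^ k * m ^ 2 * n)" by (simp only: ac_simps)
  finally show ?thesis .
qed

text \<open>It suffices that Euler's number is at least 2 and that \<open>k\<close> is at most twice
  the factorial of \<open>k - 1\<close>.\<close>

lemma self_le_exp_fact:
  assumes "1 \<le> k"
  shows "real (k * 2 ^ k) \<le> exp 1 * fact (k - 1) * 2 ^ k"
proof -
  have e: "2 \<le> exp (1 :: real)" using exp_ge_add_one_self[of 1] by simp
  have "k \<le> 2 * fact (k - 1)"
  proof (cases "k = 1")
    case False
    have "k - 1 \<le> fact (k - 1)" by (rule fact_ge_self)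
    then show ?thesis using False assms by linarith
  qed simp
  then have "real k \<le> 2 * fact (k - 1)"
    by (metis of_nat_fact of_nat_le_iff of_nat_mult of_nat_numeral)
  also have "\<dots> \<le> exp 1 * fact (k - 1)" using e by (intro mult_right_mono) auto
  finally have "real k * 2 ^ k \<le> exp 1 * fact (k - 1) * 2 ^ k" by (intro mult_right_mono) auto
  then show ?thesis by simp
qed

section \<open>Correctness, size and running time together\<close>

lemma wtss_program_correct:
  assumes k: "1 \<le> k" and G: "input_digraph n m G" and s: "s \<in> verts G" and min: "min_dists_exist G w s"
  shows "\<exists>T \<sigma>. exec wtss_program (input_store k n m G w s) T \<sigma> \<and>
    T \<le> 48000000 * 32 ^ 32 * (k ^ k * m ^ 2 * n) + 4 \<and> wtss k G w s (output_digraph G \<sigma>) \<and>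
    (\<forall>t<n. in_degree (output_digraph G \<sigma>) t \<le> k * 2 ^ k)"
proof -
  interpret arc_structure "tail G" "head G" s .
  interpret G: fin_digraph G using G by (simp add: input_digraph_def)
  have VA: "verts G = {..<n}" "arcs G = {..<m}" using G by (auto simp: input_digraph_def)
  let ?\<sigma> = "input_store k n m G w s"
  let ?H = "\<lambda>\<sigma>. {e. e < m \<and> 0 < arr \<sigma> 3 (int e)}"
  let ?R = "\<lambda>\<sigma>. (\<forall>I x d. (\<Sum>e<m. I e) \<le> k \<longrightarrow> walk_cost {..<m} (\<lambda>e. w e + int (I e)) x d \<longrightarrow>
        (\<exists>d'\<le>d. walk_cost (?H \<sigma>) (\<lambda>e. w e + int (I e)) x d')) \<and>
      (\<forall>t<n. card {e \<in> ?H \<sigma>. head G e = t} \<le> k * 2 ^ k)"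
  have "\<exists>T \<sigma>. exec wtss_program ?\<sigma> T \<sigma> \<and> T \<le> 48000000 * 32 ^ 32 * (k ^ k * m ^ 2 * n) + 4 \<and> ?R \<sigma>"
  proof (cases "m = 0")
    case True
    then have "\<not> bval (Less (Const 0) (Reg 2)) ?\<sigma>" by (simp add: input_store_def)
    then have "exec wtss_program ?\<sigma> (bcost (Less (Const 0) (Reg 2)) + 1) ?\<sigma>"
      unfolding wtss_program_def by (intro exec.CondFalse exec.Skip)
    moreover have "?R ?\<sigma>" using True by auto
    ultimately show ?thesis
      by (intro exI[of _ "bcost (Less (Const 0) (Reg 2)) + 1"] exI[of _ ?\<sigma>]) simp
  next
    case False
    \<comment> \<open>The choice is meaningful exactly where some walk arrives. There
      \<open>min_dists_exist\<close> provides a cheapest one.\<close>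
    define \<delta> where "\<delta> = (\<lambda>x. SOME d. walk_cost {..<m} w x d \<and> (\<forall>d'. walk_cost {..<m} w x d' \<longrightarrow> d \<le> d'))"
    have \<delta>: "walk_cost {..<m} w x (\<delta> x) \<and> (\<forall>d'. walk_cost {..<m} w x d' \<longrightarrow> \<delta> x \<le> d')"
      if w: "walk_cost {..<m} w x d" for x d
    proof -
      note aw = awalk_walk_cost[OF s, unfolded VA(2)]
      obtain p where p: "G.awalk s p x" using w aw by blast
      then have xG: "x \<in> verts G" by (rule G.awalk_last_in_verts)
      have "\<exists>q. G.awalk s q x \<and> (\<forall>q'. G.awalk s q' x \<longrightarrow> (\<Sum>a\<leftarrow>q. w a) \<le> (\<Sum>a\<leftarrow>q'. w a))"
        by (rule bspec[OF min[unfolded min_dists_exist_def] xG, THEN mp, OF exI, OF p])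
      then obtain q where q: "G.awalk s q x \<and>
          (\<forall>q'. G.awalk s q' x \<longrightarrow> (\<Sum>a\<leftarrow>q. w a) \<le> (\<Sum>a\<leftarrow>q'. w a))" ..
      have "walk_cost {..<m} w x (\<Sum>a\<leftarrow>q. w a)"
        unfolding aw by (rule exI[of _ q], rule conjI[OF conjunct1[OF q] refl])
      moreover have "(\<Sum>a\<leftarrow>q. w a) \<le> d'" if d': "walk_cost {..<m} w x d'" for d'
      proof -
        obtain q' where q': "G.awalk s q' x \<and> (\<Sum>a\<leftarrow>q'. w a) = d'" using d' unfolding aw ..
        have "(\<Sum>a\<leftarrow>q. w a) \<le> (\<Sum>a\<leftarrow>q'. w a)"
          by (rule conjunct2[OF q, THEN spec, THEN mp, OF conjunct1[OF q']])
        then show ?thesis using conjunct2[OF q'] by simp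
      qed
      ultimately have "walk_cost {..<m} w x (\<Sum>a\<leftarrow>q. w a) \<and>
          (\<forall>d'. walk_cost {..<m} w x d' \<longrightarrow> (\<Sum>a\<leftarrow>q. w a) \<le> d')" by simp
      then show ?thesis unfolding \<delta>_def by (rule someI)
    qed
    interpret input_graph "tail G" "head G" s k n m w \<delta>
    proof
      show "0 < m" "s < n" using False s VA by auto
      show "tail G e < n" "head G e < n" if "e < m" for e
        using G.tail_in_verts[of e] G.head_in_verts[of e] that VA by auto
    qed (use \<delta> in blast)+
    have "arcs_loaded ?\<sigma>" by (simp add: arcs_loaded_def input_store_def array_of_def)
    moreover have "arr ?\<sigma> a x = 0" if "a \<in> {3, 5, 6, 7}" for a x
      using that by (auto simp: input_store_def)
    ultimately obtain T \<sigma> where "exec thin_out ?\<sigma> T \<sigma>" "?R \<sigma>" and T: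
      "T \<le> 1000 * n * k * (2000 * (k + 1) * (2 ^ k + 1) * ((m * k + 1) * (m * k + 2)))"
      using runs_thin_out k unfolding runs_def Let_def by blast
    moreover from this have "exec wtss_program ?\<sigma> (bcost (Less (Const 0) (Reg 2)) + T) \<sigma>"
      unfolding wtss_program_def using False by (intro exec.CondTrue) (simp_all add: input_store_def)
    moreover have "T \<le> 48000000 * 32 ^ 32 * (k ^ k * m ^ 2 * n)"
      using T time_bound[of k m n] k False by (meson order_trans less_one not_le)
    ultimately show ?thesis
      by (intro exI[of _ "bcost (Less (Const 0) (Reg 2)) + T"] exI[of _ \<sigma>]) simp
  qed
  then obtain T \<sigma> where ex: "exec wtss_program ?\<sigma> T \<sigma>"
    and T: "T \<le> 48000000 * 32 ^ 32 * (k ^ k * m ^ 2 * n) + 4" and R: "?R \<sigma>" by blast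
  have "\<forall>x. 0 \<le> arr ?\<sigma> 3 x" by (simp add: input_store_def)
  then have "\<forall>x. 0 \<le> arr \<sigma> 3 x" using exec_arr_nonneg[OF ex nonneg_puts_wtss_program] by blast
  then have "arr \<sigma> 3 (int e) \<noteq> 0 \<longleftrightarrow> 0 < arr \<sigma> 3 (int e)" for e by (metis less_le)
  then have arcs: "arcs (output_digraph G \<sigma>) = ?H \<sigma>" by (auto simp: output_digraph_def VA)
  have out: "verts (output_digraph G \<sigma>) = verts G" "tail (output_digraph G \<sigma>) = tail G"
    "head (output_digraph G \<sigma>) = head G" "arcs (output_digraph G \<sigma>) \<subseteq> arcs G"
    by (auto simp: output_digraph_def)
  have wf: "wf_digraph (output_digraph G \<sigma>)"
    by unfold_locales (use out in auto)
  have "spanning (output_digraph G \<sigma>) G"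
    using out wf G.wf_digraph_axioms by (simp add: spanning_def subgraph_def compatible_def)
  moreover have "sp_dist G (\<lambda>a. w a + int (I a)) s t = sp_dist (output_digraph G \<sigma>) (\<lambda>a. w a + int (I a)) s t"
    if "(\<Sum>a\<in>arcs G. I a) \<le> k" for I t
    using G.wf_digraph_axioms wf s out(1,4,2,3)
    by (rule sp_dist_eqI) (use R that arcs in \<open>simp add: VA\<close>)
  ultimately have "wtss k G w s (output_digraph G \<sigma>)" unfolding wtss_def by blast
  moreover have "\<forall>t<n. in_degree (output_digraph G \<sigma>) t \<le> k * 2 ^ k"
    using R by (simp add: in_degree_def in_arcs_def arcs out)
  ultimately show ?thesis using ex T by blast
qed

theorem theorem1:
  shows "\<exists>(A :: com) (C :: real) (f :: nat \<Rightarrow> real).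
    \<forall>(k :: nat) (n :: nat) (m :: nat) (G :: (nat, nat) pre_digraph) (w :: nat \<Rightarrow> int) (s :: nat).
      k \<ge> 1 \<and> input_digraph n m G \<and> s \<in> verts G \<and> min_dists_exist G w s \<longrightarrow>
      (\<exists>T \<sigma>. exec A (input_store k n m G w s) T \<sigma> \<and>
         real T \<le> C * (real k ^ k * real m ^ 2 * real n + 1) \<and>
         wtss k G w s (output_digraph G \<sigma>) \<and>
         real (card (arcs (output_digraph G \<sigma>))) \<le> f k * real n \<and>
         (\<forall>v \<in> verts G. real (in_degree (output_digraph G \<sigma>) v) \<le> exp 1 * fact (k - 1) * 2 ^ k))"
proof (rule exI[of _ wtss_program], rule exI[of _ "48000000 * 32 ^ 32"],
    rule exI[of _ "\<lambda>k. real (k * 2 ^ k)"], intro allI impI, elim conjE)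
  fix k n m :: nat and G :: "(nat, nat) pre_digraph" and w :: "nat \<Rightarrow> int" and s :: nat
  assume k: "1 \<le> k" and G: "input_digraph n m G" and s: "s \<in> verts G" and min: "min_dists_exist G w s"
  obtain T \<sigma> where ex: "exec wtss_program (input_store k n m G w s) T \<sigma>"
    and T: "T \<le> 48000000 * 32 ^ 32 * (k ^ k * m ^ 2 * n) + 4"
    and wt: "wtss k G w s (output_digraph G \<sigma>)"
    and deg: "\<forall>t<n. in_degree (output_digraph G \<sigma>) t \<le> k * 2 ^ k"
    using wtss_program_correct[OF k G s min] by blast
  let ?H = "output_digraph G \<sigma>"
  have VA: "verts G = {..<n}" "arcs G = {..<m}" "fin_digraph G" using G by (auto simp: input_digraph_def)
  \<comment> \<open>The cost of the initial test, and of \<open>Skip\<close> when there are no arcs,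
    is absorbed by the additive 1 in the time bound.\<close>
  have "4 \<le> 48000000 * 32 ^ 32 * (1 :: nat)" by simp
  then have "T \<le> 48000000 * 32 ^ 32 * (k ^ k * m ^ 2 * n + 1)" using T by (simp only: distrib_left)
  then have "real T \<le> real (48000000 * 32 ^ 32 * (k ^ k * m ^ 2 * n + 1))" by (simp only: of_nat_le_iff)
  then have time: "real T \<le> 48000000 * 32 ^ 32 * (real k ^ k * real m ^ 2 * real n + 1)" by simp
  \<comment> \<open>Counting arcs by their heads turns the bound on in-degrees into a bound linear
    in \<open>n\<close>.\<close>
  have "arcs ?H \<subseteq> (\<Union>t<n. in_arcs ?H t)"
  proof
    fix e assume e: "e \<in> arcs ?H"
    then have "head G e \<in> verts G"
      using VA(3) by (auto simp: output_digraph_def fin_digraph_def wf_digraph_def)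
    then show "e \<in> (\<Union>t<n. in_arcs ?H t)" using e VA by (auto simp: output_digraph_def)
  qed
  moreover have "finite (arcs ?H)" by (simp add: output_digraph_def VA)
  ultimately have "card (arcs ?H) \<le> card (\<Union>t<n. in_arcs ?H t)"
    by (intro card_mono finite_UN_I) (auto simp: in_arcs_def)
  also have "\<dots> \<le> (\<Sum>t<n. card (in_arcs ?H t))" by (intro card_UN_le) simp
  also have "\<dots> \<le> (\<Sum>t<n. k * 2 ^ k)" using deg by (intro sum_mono) (auto simp: in_degree_def)
  finally have "card (arcs ?H) \<le> (k * 2 ^ k) * n" by (simp add: mult.commute)
  then have "real (card (arcs ?H)) \<le> real (k * 2 ^ k) * real n"
    by (metis of_nat_le_iff of_nat_mult)
  moreover have "real (in_degree ?H v) \<le> exp 1 * fact (k - 1) * 2 ^ k" if "v \<in> verts G" for v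
  proof -
    have "real (in_degree ?H v) \<le> real (k * 2 ^ k)" using deg that VA by (simp only: of_nat_le_iff) simp
    then show ?thesis using self_le_exp_fact[OF k] by (rule order_trans)
  qed
  ultimately show "\<exists>T \<sigma>. exec wtss_program (input_store k n m G w s) T \<sigma> \<and>
      real T \<le> 48000000 * 32 ^ 32 * (real k ^ k * real m ^ 2 * real n + 1) \<and>
      wtss k G w s (output_digraph G \<sigma>) \<and>
      real (card (arcs (output_digraph G \<sigma>))) \<le> real (k * 2 ^ k) * real n \<and>
      (\<forall>v \<in> verts G. real (in_degree (output_digraph G \<sigma>) v) \<le> exp 1 * fact (k - 1) * 2 ^ k)"
    using ex time wt by blast
qed

end
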